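(* Let $\mathbf{k}$ be a field of characteristic $p>0$, $d\in\mathbb{Z}$, and let $\mathrm{A}$ with the automorphism $\Sigma$ be a weakly $d$-Calabi-Yau ($\mathbf{k}$-linear, small) category. Then, for any $n\ge0$, the map $$\Theta_n:\mathrm{HH}^n(\mathrm{A},\mathrm{A}/\Sigma)\rightarrow\mathrm{HH}_n(\mathrm{A},\mathrm{A}/\Sigma)^*[-d]$$ defined by $\Theta_n(\alpha)=tr_{\mathrm{A}}\,\mathbf{i}_{\alpha}$ for $\alpha\in\mathrm{HH}^n(\mathrm{A},\mathrm{A}/\Sigma)$ is an isomorphism of graded spaces. Moreover, if $\mathrm{A}$ is $d$-Calabi-Yau, then $\Theta_n$ induces an isomorphism of graded spaces $$\Theta_n:\mathrm{HH}^n(\mathrm{A},\mathrm{A}/\Sigma)^{\Sigma}\rightarrow\big(\mathrm{HH}_n(\mathrm{A},\mathrm{A}/\Sigma)_{-\Sigma}\big)^*[-d].$$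
   Context: All categories are small and $\mathbf{k}$-linear; $\mathrm{A}_x^y=\mathrm{Hom}_{\mathrm{A}}(x,y)$; $fg$ means $f$ after $g$; $\otimes,\mathrm{Hom}$ are over $\mathbf{k}$. $\mathrm{A}$ is an ungraded category, $\Sigma$ an automorphism of it. (Weakly) Calabi-Yau: $\mathrm{A}$ is $d$-Calabi-Yau if all $\mathrm{A}_x^y$ are finite dimensional and there are linear maps $tr_x:\mathrm{A}_x^{\Sigma^dx}\to\mathbf{k}$ ($x\in\mathrm{A}$) such that (1) the pairing $\mathrm{A}_y^{\Sigma^dx}\times\mathrm{A}_x^y\to\mathbf{k}$, $(f,g)\mapsto tr_x(fg)$ is nondegenerate for all $x,y$; (2) for all $m\in\mathbb{Z}$, $g\in\mathrm{A}_x^{\Sigma^my}$, $f\in\mathrm{A}_y^{\Sigma^{d-m}x}$ one has $tr_x(\Sigma^m(f)g)=(-1)^{m(d-m)}tr_y(\Sigma^{d-m}(g)f)$. If finite dimensionality and (1) hold and (2) holds for $m=0$, $\mathrm{A}$ is weakly $d$-Calabi-Yau. The maps $tr_x$ are fixed. Orbit category $\mathrm{A}/\Sigma$: graded category with the objects of $\mathrm{A}$, $((\mathrm{A}/\Sigma)_x^y)_n=\mathrm{A}_x^{\Sigma^ny}$, composition $g\circ f=\Sigma^n(g)f$ for $f$ of degree $n$. It is a graded $\mathrm{A}$-bimodule $\mathrm{M}=\mathrm{A}/\Sigma$ with $\mathrm{M}(x,y)=(\mathrm{A}/\Sigma)_y^x$ and $f u g=\Sigma^n(f)ug$ for $u$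 of degree $n$ and $f,g$ morphisms of $\mathrm{A}$. $\Sigma$ acts on $\mathrm{M}$ by ${}^{\Sigma}u=(-1)^n\Sigma(u)$ for $u$ of degree $n$. Hochschild-Mitchell (co)homology: for each degree component $\mathrm{M}_i$ put $$C^n(\mathrm{A},\mathrm{M}_i)=\prod_{x_0,\dots,x_n}\mathrm{Hom}(\mathrm{A}^{x_0}_{x_1}\otimes\cdots\otimes\mathrm{A}^{x_{n-1}}_{x_n},\mathrm{M}(x_0,x_n)_i),\quad C_n(\mathrm{A},\mathrm{M}_i)=\bigoplus_{x_0,\dots,x_n}\mathrm{M}(x_n,x_0)_i\otimes\mathrm{A}^{x_0}_{x_1}\otimes\cdots\otimes\mathrm{A}^{x_{n-1}}_{x_n},$$ with differentials $C^n\to C^{n+1}$, $$(d\alpha)(f_0\otimes\cdots\otimes f_n)=f_0\alpha(f_1\otimes\cdots\otimes f_n)+\sum_{i=1}^n(-1)^i\alpha(f_0\otimes\cdots\otimes f_{i-1}f_i\otimes\cdots\otimes f_n)+(-1)^{n+1}\alpha(f_0\otimes\cdots\otimes f_{n-1})f_n,$$ and $C_{n+1}\to C_n$, $$d(u\otimes f_0\otimes\cdots\otimes f_n)=uf_0\otimes f_1\otimes\cdots\otimes f_n+\sum_{i=1}^n(-1)^iu\otimes f_0\otimes\cdots\otimes f_{i-1}f_i\otimes\cdots\otimes f_n+(-1)^{n+1}f_nu\otimes f_0\otimes\cdots\otimes f_{n-1}.$$ $\mathrm{HH}^n(\mathrm{A},\mathrm{M}_i)$ and $\mathrm{HH}_n(\mathrm{A},\mathrm{M}_i)$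 are the resulting cohomology and homology in degree $n$; $\mathrm{HH}^n(\mathrm{A},\mathrm{M})=\oplus_i\mathrm{HH}^n(\mathrm{A},\mathrm{M}_i)$ and $\mathrm{HH}_n(\mathrm{A},\mathrm{M})=\oplus_i\mathrm{HH}_n(\mathrm{A},\mathrm{M}_i)$ are graded by $i$. In particular $\mathrm{HH}_0(\mathrm{A},\mathrm{M})=\oplus_x\mathrm{M}(x,x)/\langle fu-uf\rangle$ ($f$ a morphism of $\mathrm{A}$). Contraction: $\mathbf{i}_\alpha(u\otimes f_1\otimes\cdots\otimes f_n)=u\circ\alpha(f_1\otimes\cdots\otimes f_n)$ (composition in $\mathrm{A}/\Sigma$) induces $\mathbf{i}_\alpha:\mathrm{HH}_n(\mathrm{A},\mathrm{A}/\Sigma)\to\mathrm{HH}_0(\mathrm{A},\mathrm{A}/\Sigma)$ for $\alpha\in\mathrm{HH}^n(\mathrm{A},\mathrm{A}/\Sigma)$. The map $tr_{\mathrm{A}}:\oplus_{x,n}\mathrm{A}_x^{\Sigma^nx}\to\mathbf{k}$ equal to $tr_x$ on $\mathrm{A}_x^{\Sigma^dx}$ and to $0$ on $\mathrm{A}_x^{\Sigma^nx}$, $n\ne d$, induces $tr_{\mathrm{A}}:\mathrm{HH}_0(\mathrm{A},\mathrm{A}/\Sigma)\to\mathbf{k}$ in the weakly $d$-Calabi-Yau case. $\Sigma$-action: $({}^\Sigma\alpha)(f_1\otimes\cdots\otimes f_n)={}^\Sigma\big(\alpha(\Sigma^{-1}f_1\otimes\cdots\otimes\Sigma^{-1}f_n)\big)$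 and ${}^\Sigma(u\otimes f_1\otimes\cdots\otimes f_n)={}^\Sigma u\otimes\Sigma f_1\otimes\cdots\otimes\Sigma f_n$, inducing actions on $\mathrm{HH}^n$ and $\mathrm{HH}_n$. $\mathrm{V}^\Sigma$ denotes the $\Sigma$-invariants and $\mathrm{V}_{-\Sigma}=\mathrm{V}/\{v+{}^\Sigma v\mid v\in\mathrm{V}\}$. For a graded space $\mathrm{V}$: $(\mathrm{V}^* )_i=(\mathrm{V}_{-i})^*$ and $\mathrm{V}[n]_i=\mathrm{V}_{i+n}$; so $(\mathrm{V}^*[-d])_i=(\mathrm{V}_{d-i})^*$. *)

theory Defs
  imports Complex_Main "HOL-Library.FuncSet" "HOL-Library.Poly_Mapping"
begin

section \<open>Vector spaces with a carrier\<close>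

record ('k, 'v) vs =
  carr :: "'v set"
  vzero :: 'v
  vadd :: "'v \<Rightarrow> 'v \<Rightarrow> 'v"
  vscl :: "'k \<Rightarrow> 'v \<Rightarrow> 'v"

definition lin_iso :: "('k, 'v) vs \<Rightarrow> ('k, 'w) vs \<Rightarrow> ('v \<Rightarrow> 'w) \<Rightarrow> bool" where
  "lin_iso V W f \<longleftrightarrow> bij_betw f (carr V) (carr W) \<and>
     (\<forall>u\<in>carr V. \<forall>v\<in>carr V. f (vadd V u v) = vadd W (f u) (f v)) \<and>
     (\<forall>c. \<forall>v\<in>carr V. f (vscl V c v) = vscl W c (f v))"

definition coset :: "('k, 'v) vs \<Rightarrow> 'v set \<Rightarrow> 'v \<Rightarrow> 'v set" where
  "coset V N v = vadd V v ` N"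

text \<open>The map with values in the quotient of \<^term>\<open>W\<close> by \<^term>\<open>N\<close> induced by \<^term>\<open>f\<close>
  on cosets \<^term>\<open>P\<close>: all representatives of \<^term>\<open>P\<close> give the same coset as soon as
  \<^term>\<open>f\<close> respects the two subspaces, so the union is that coset.\<close>

definition qmap :: "('k, 'w) vs \<Rightarrow> 'w set \<Rightarrow> ('v \<Rightarrow> 'w) \<Rightarrow> 'v set \<Rightarrow> 'w set" where
  "qmap W N f P = (\<Union>p\<in>P. coset W N (f p))"

definition quot :: "('k, 'v) vs \<Rightarrow> 'v set \<Rightarrow> ('k, 'v set) vs" where
  "quot V N =
     \<lparr>carr = coset V N ` carr V,
      vzero = coset V N (vzero V),
      vadd = (\<lambda>P Q. \<Union>q\<in>Q. qmap V N (\<lambda>p. vadd V p q) P),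
      vscl = (\<lambda>c. qmap V N (vscl V c))\<rparr>"

definition dual :: "('k::field, 'v) vs \<Rightarrow> ('k, 'v \<Rightarrow> 'k) vs" where
  "dual V =
     \<lparr>carr = {\<phi> \<in> extensional (carr V).
        (\<forall>u\<in>carr V. \<forall>v\<in>carr V. \<phi> (vadd V u v) = \<phi> u + \<phi> v) \<and>
        (\<forall>c. \<forall>v\<in>carr V. \<phi> (vscl V c v) = c * \<phi> v)},
      vzero = restrict (\<lambda>v. 0) (carr V),
      vadd = (\<lambda>\<phi> \<psi>. restrict (\<lambda>v. \<phi> v + \<psi> v) (carr V)),
      vscl = (\<lambda>c \<phi>. restrict (\<lambda>v. c * \<phi> v) (carr V))\<rparr>"

text \<open>Invariants of an operator \<open>\<sigma>\<close>, and the quotient by all \<open>v + \<sigma> v\<close>.\<close>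

definition invar :: "('v \<Rightarrow> 'v) \<Rightarrow> ('k, 'v) vs \<Rightarrow> ('k, 'v) vs" where
  "invar \<sigma> V = V\<lparr>carr := {v \<in> carr V. \<sigma> v = v}\<rparr>"

definition anti_coinvar :: "('v \<Rightarrow> 'v) \<Rightarrow> ('k, 'v) vs \<Rightarrow> ('k, 'v set) vs" where
  "anti_coinvar \<sigma> V = quot V ((\<lambda>v. vadd V v (\<sigma> v)) ` carr V)"

text \<open>Graded spaces are families indexed by \<^typ>\<open>int\<close>.\<close>

definition gdual :: "(int \<Rightarrow> ('k::field, 'v) vs) \<Rightarrow> int \<Rightarrow> ('k, 'v \<Rightarrow> 'k) vs" where
  "gdual V i = dual (V (- i))"

definition gshift :: "(int \<Rightarrow> ('k, 'v) vs) \<Rightarrow> int \<Rightarrow> int \<Rightarrow> ('k, 'v) vs" where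
  "gshift V n i = V (i + n)"

definition graded_iso ::
  "(int \<Rightarrow> ('k, 'v) vs) \<Rightarrow> (int \<Rightarrow> ('k, 'w) vs) \<Rightarrow> (int \<Rightarrow> 'v \<Rightarrow> 'w) \<Rightarrow> bool" where
  "graded_iso V W f \<longleftrightarrow> (\<forall>i. lin_iso (V i) (W i) (f i))"

text \<open>The free vector space on a set of generators, and linear extension.\<close>

definition fscale :: "'k::field \<Rightarrow> ('g \<Rightarrow>\<^sub>0 'k) \<Rightarrow> 'g \<Rightarrow>\<^sub>0 'k" where
  "fscale c = Poly_Mapping.map ((*) c)"

definition free :: "'g set \<Rightarrow> ('k::field, 'g \<Rightarrow>\<^sub>0 'k) vs" where
  "free G = \<lparr>carr = {c. Poly_Mapping.keys c \<subseteq> G}, vzero = 0, vadd = (+), vscl = fscale\<rparr>"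

definition linext ::
  "('k::field \<Rightarrow> 'v \<Rightarrow> 'v) \<Rightarrow> ('g \<Rightarrow> 'v) \<Rightarrow> ('g \<Rightarrow>\<^sub>0 'k) \<Rightarrow> 'v::comm_monoid_add" where
  "linext s \<phi> c = (\<Sum>g\<in>Poly_Mapping.keys c. s (Poly_Mapping.lookup c g) (\<phi> g))"


section \<open>Linear categories, automorphisms, Calabi-Yau categories\<close>

text \<open>The space of morphisms from \<open>x\<close> to \<open>y\<close> is \<open>hom A x y\<close>, a subspace of an ambient
  vector space \<^typ>\<open>'m\<close> (any family of vector spaces embeds into one, e.g. its direct
  sum).  These subspaces may overlap, which is why composition and the action of functors
  on morphisms also take the objects as arguments.  For \<open>f\<close> in \<open>hom A x y\<close> and \<open>g\<close> in
  \<open>hom A y z\<close>, \<open>cmp A x y z g f\<close> is \<open>g\<close> after \<open>f\<close>.\<close>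

record ('k, 'o, 'm) lincat =
  obj :: "'o set"
  smul :: "'k \<Rightarrow> 'm \<Rightarrow> 'm"
  hom :: "'o \<Rightarrow> 'o \<Rightarrow> 'm set"
  cmp :: "'o \<Rightarrow> 'o \<Rightarrow> 'o \<Rightarrow> 'm \<Rightarrow> 'm \<Rightarrow> 'm"
  ide :: "'o \<Rightarrow> 'm"

locale linear_category = vector_space "smul A"
  for A :: "('k::field, 'o, 'm::ab_group_add) lincat" +
  assumes hom_subspace: "x \<in> obj A \<Longrightarrow> y \<in> obj A \<Longrightarrow> subspace (hom A x y)"
    and cmp_in_hom: "x \<in> obj A \<Longrightarrow> y \<in> obj A \<Longrightarrow> z \<in> obj A \<Longrightarrow>
      g \<in> hom A y z \<Longrightarrow> f \<in> hom A x y \<Longrightarrow> cmp A x y z g f \<in> hom A x z"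
    and cmp_add_left: "x \<in> obj A \<Longrightarrow> y \<in> obj A \<Longrightarrow> z \<in> obj A \<Longrightarrow>
      g \<in> hom A y z \<Longrightarrow> g' \<in> hom A y z \<Longrightarrow> f \<in> hom A x y \<Longrightarrow>
      cmp A x y z (g + g') f = cmp A x y z g f + cmp A x y z g' f"
    and cmp_add_right: "x \<in> obj A \<Longrightarrow> y \<in> obj A \<Longrightarrow> z \<in> obj A \<Longrightarrow>
      g \<in> hom A y z \<Longrightarrow> f \<in> hom A x y \<Longrightarrow> f' \<in> hom A x y \<Longrightarrow>
      cmp A x y z g (f + f') = cmp A x y z g f + cmp A x y z g f'"
    and cmp_smul_left: "x \<in> obj A \<Longrightarrow> y \<in> obj A \<Longrightarrow> z \<in> obj A \<Longrightarrow>
      g \<in> hom A y z \<Longrightarrow> f \<in> hom A x y \<Longrightarrow>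
      cmp A x y z (smul A c g) f = smul A c (cmp A x y z g f)"
    and cmp_smul_right: "x \<in> obj A \<Longrightarrow> y \<in> obj A \<Longrightarrow> z \<in> obj A \<Longrightarrow>
      g \<in> hom A y z \<Longrightarrow> f \<in> hom A x y \<Longrightarrow>
      cmp A x y z g (smul A c f) = smul A c (cmp A x y z g f)"
    and cmp_assoc: "w \<in> obj A \<Longrightarrow> x \<in> obj A \<Longrightarrow> y \<in> obj A \<Longrightarrow> z \<in> obj A \<Longrightarrow>
      h \<in> hom A y z \<Longrightarrow> g \<in> hom A x y \<Longrightarrow> f \<in> hom A w x \<Longrightarrow>
      cmp A w x z (cmp A x y z h g) f = cmp A w y z h (cmp A w x y g f)"
    and ide_in_hom: "x \<in> obj A \<Longrightarrow> ide A x \<in> hom A x x"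
    and cmp_ide_left: "x \<in> obj A \<Longrightarrow> y \<in> obj A \<Longrightarrow> f \<in> hom A x y \<Longrightarrow>
      cmp A x y y (ide A y) f = f"
    and cmp_ide_right: "x \<in> obj A \<Longrightarrow> y \<in> obj A \<Longrightarrow> f \<in> hom A x y \<Longrightarrow>
      cmp A x x y f (ide A x) = f"

record ('o, 'm) func =
  fobj :: "'o \<Rightarrow> 'o"
  farr :: "'o \<Rightarrow> 'o \<Rightarrow> 'm \<Rightarrow> 'm"

locale linear_automorphism = linear_category A
  for A :: "('k::field, 'o, 'm::ab_group_add) lincat" and S :: "('o, 'm) func" +
  assumes fobj_bij: "bij_betw (fobj S) (obj A) (obj A)"
    and farr_bij: "x \<in> obj A \<Longrightarrow> y \<in> obj A \<Longrightarrow>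
      bij_betw (farr S x y) (hom A x y) (hom A (fobj S x) (fobj S y))"
    and farr_add: "x \<in> obj A \<Longrightarrow> y \<in> obj A \<Longrightarrow> f \<in> hom A x y \<Longrightarrow> g \<in> hom A x y \<Longrightarrow>
      farr S x y (f + g) = farr S x y f + farr S x y g"
    and farr_smul: "x \<in> obj A \<Longrightarrow> y \<in> obj A \<Longrightarrow> f \<in> hom A x y \<Longrightarrow>
      farr S x y (smul A c f) = smul A c (farr S x y f)"
    and farr_cmp: "x \<in> obj A \<Longrightarrow> y \<in> obj A \<Longrightarrow> z \<in> obj A \<Longrightarrow>
      g \<in> hom A y z \<Longrightarrow> f \<in> hom A x y \<Longrightarrow>
      farr S x z (cmp A x y z g f) =
        cmp A (fobj S x) (fobj S y) (fobj S z) (farr S y z g) (farr S x y f)"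
    and farr_ide: "x \<in> obj A \<Longrightarrow> farr S x x (ide A x) = ide A (fobj S x)"

definition fid :: "('o, 'm) func" where
  "fid = \<lparr>fobj = (\<lambda>x. x), farr = (\<lambda>x y f. f)\<rparr>"

definition fcomp :: "('o, 'm) func \<Rightarrow> ('o, 'm) func \<Rightarrow> ('o, 'm) func" where
  "fcomp F G = \<lparr>fobj = (\<lambda>x. fobj F (fobj G x)),
     farr = (\<lambda>x y f. farr F (fobj G x) (fobj G y) (farr G x y f))\<rparr>"

definition finv :: "('k, 'o, 'm) lincat \<Rightarrow> ('o, 'm) func \<Rightarrow> ('o, 'm) func" where
  "finv A F = (let o' = inv_into (obj A) (fobj F) in
     \<lparr>fobj = o',
      farr = (\<lambda>x y. inv_into (hom A (o' x) (o' y)) (farr F (o' x) (o' y)))\<rparr>)"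

primrec fnpow :: "('o, 'm) func \<Rightarrow> nat \<Rightarrow> ('o, 'm) func" where
  "fnpow F 0 = fid"
| "fnpow F (Suc n) = fcomp F (fnpow F n)"

definition fzpow :: "('k, 'o, 'm) lincat \<Rightarrow> ('o, 'm) func \<Rightarrow> int \<Rightarrow> ('o, 'm) func" where
  "fzpow A F n = (if n \<ge> 0 then fnpow F (nat n) else fnpow (finv A F) (nat (- n)))"

abbreviation So :: "('k, 'o, 'm) lincat \<Rightarrow> ('o, 'm) func \<Rightarrow> int \<Rightarrow> 'o \<Rightarrow> 'o" where
  "So A S n \<equiv> fobj (fzpow A S n)"

abbreviation Sa :: "('k, 'o, 'm) lincat \<Rightarrow> ('o, 'm) func \<Rightarrow> int \<Rightarrow> 'o \<Rightarrow> 'o \<Rightarrow> 'm \<Rightarrow> 'm" where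
  "Sa A S n \<equiv> farr (fzpow A S n)"

text \<open>The second Calabi-Yau condition, for a given \<^term>\<open>m\<close>.\<close>

definition trace_symmetric ::
  "('k::field, 'o, 'm) lincat \<Rightarrow> ('o, 'm) func \<Rightarrow> int \<Rightarrow> ('o \<Rightarrow> 'm \<Rightarrow> 'k) \<Rightarrow> int \<Rightarrow> bool" where
  "trace_symmetric A S d tr m \<longleftrightarrow>
     (\<forall>x\<in>obj A. \<forall>y\<in>obj A. \<forall>g\<in>hom A x (So A S m y). \<forall>f\<in>hom A y (So A S (d - m) x).
        tr x (cmp A x (So A S m y) (So A S d x) (Sa A S m y (So A S (d - m) x) f) g) =
        (- 1) powi (m * (d - m)) *
        tr y (cmp A y (So A S (d - m) x) (So A S d y) (Sa A S (d - m) x (So A S m y) g) f))"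

locale weakly_calabi_yau = linear_automorphism A S
  for A :: "('k::field, 'o, 'm::ab_group_add) lincat" and S :: "('o, 'm) func" +
  fixes d :: int and tr :: "'o \<Rightarrow> 'm \<Rightarrow> 'k"
  assumes finite_dim: "x \<in> obj A \<Longrightarrow> y \<in> obj A \<Longrightarrow> \<exists>B. finite B \<and> span B = hom A x y"
    and tr_add: "x \<in> obj A \<Longrightarrow> f \<in> hom A x (So A S d x) \<Longrightarrow> g \<in> hom A x (So A S d x) \<Longrightarrow>
      tr x (f + g) = tr x f + tr x g"
    and tr_smul: "x \<in> obj A \<Longrightarrow> f \<in> hom A x (So A S d x) \<Longrightarrow>
      tr x (smul A c f) = c * tr x f"
    and nondegenerate_left: "x \<in> obj A \<Longrightarrow> y \<in> obj A \<Longrightarrow> f \<in> hom A y (So A S d x) \<Longrightarrow>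
      (\<forall>g\<in>hom A x y. tr x (cmp A x y (So A S d x) f g) = 0) \<Longrightarrow> f = 0"
    and nondegenerate_right: "x \<in> obj A \<Longrightarrow> y \<in> obj A \<Longrightarrow> g \<in> hom A x y \<Longrightarrow>
      (\<forall>f\<in>hom A y (So A S d x). tr x (cmp A x y (So A S d x) f g) = 0) \<Longrightarrow> g = 0"
    and tr_symmetric_0: "trace_symmetric A S d tr 0"

locale calabi_yau = weakly_calabi_yau A S d tr
  for A :: "('k::field, 'o, 'm::ab_group_add) lincat" and S :: "('o, 'm) func"
    and d :: int and tr :: "'o \<Rightarrow> 'm \<Rightarrow> 'k" +
  assumes tr_symmetric: "trace_symmetric A S d tr m"


section \<open>The orbit category and the bimodule it defines\<close>

text \<open>Morphisms \<open>x \<rightarrow> y\<close> of degree \<open>n\<close>, and \<open>g \<circ> f\<close> for \<open>f : x \<rightarrow> y\<close> of degree \<open>n\<close> and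
  \<open>g : y \<rightarrow> z\<close> of degree \<open>m\<close>.\<close>

definition orb_hom ::
  "('k, 'o, 'm) lincat \<Rightarrow> ('o, 'm) func \<Rightarrow> 'o \<Rightarrow> 'o \<Rightarrow> int \<Rightarrow> 'm set" where
  "orb_hom A S x y n = hom A x (So A S n y)"

definition orb_cmp ::
  "('k, 'o, 'm) lincat \<Rightarrow> ('o, 'm) func \<Rightarrow> 'o \<Rightarrow> 'o \<Rightarrow> 'o \<Rightarrow> int \<Rightarrow> int \<Rightarrow> 'm \<Rightarrow> 'm \<Rightarrow> 'm" where
  "orb_cmp A S x y z m n g f =
     cmp A x (So A S n y) (So A S (n + m) z) (Sa A S n y (So A S m z) g) f"

definition bimod ::
  "('k, 'o, 'm) lincat \<Rightarrow> ('o, 'm) func \<Rightarrow> int \<Rightarrow> 'o \<Rightarrow> 'o \<Rightarrow> 'm set" where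
  "bimod A S i x y = orb_hom A S y x i"

text \<open>For \<open>u\<close> in \<open>bimod A S i x y\<close>: the left action of \<open>f : x \<rightarrow> x'\<close> and the right action of
  \<open>g : y' \<rightarrow> y\<close>.\<close>

definition lact :: "('k, 'o, 'm) lincat \<Rightarrow> ('o, 'm) func \<Rightarrow> int \<Rightarrow>
    'o \<Rightarrow> 'o \<Rightarrow> 'o \<Rightarrow> 'm \<Rightarrow> 'm \<Rightarrow> 'm" where
  "lact A S i x x' y f u = cmp A y (So A S i x) (So A S i x') (Sa A S i x x' f) u"

definition ract :: "('k, 'o, 'm) lincat \<Rightarrow> ('o, 'm) func \<Rightarrow> int \<Rightarrow>
    'o \<Rightarrow> 'o \<Rightarrow> 'o \<Rightarrow> 'm \<Rightarrow> 'm \<Rightarrow> 'm" where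
  "ract A S i x y y' u g = cmp A y' y (So A S i x) u g"

text \<open>The map from \<open>bimod A S i x y\<close> to \<open>bimod A S i (\<Sigma> x) (\<Sigma> y)\<close>.\<close>

definition sact :: "('k::field, 'o, 'm) lincat \<Rightarrow> ('o, 'm) func \<Rightarrow> int \<Rightarrow>
    'o \<Rightarrow> 'o \<Rightarrow> 'm \<Rightarrow> 'm" where
  "sact A S i x y u = smul A ((- 1) powi i) (farr S y (So A S i x) u)"


section \<open>Strings of morphisms\<close>

text \<open>For objects \<open>x\<^sub>0, \<dots>, x\<^sub>n\<close>, the list of the \<open>n\<close> spaces of morphisms
  \<open>x\<^sub>j\<^sub>+\<^sub>1 \<rightarrow> x\<^sub>j\<close>.\<close>

definition homs :: "('k, 'o, 'm) lincat \<Rightarrow> 'o list \<Rightarrow> 'm set list" where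
  "homs A xs = map (\<lambda>j. hom A (xs ! Suc j) (xs ! j)) [0..<length xs - 1]"

definition obj_tuples :: "('k, 'o, 'm) lincat \<Rightarrow> nat \<Rightarrow> 'o list set" where
  "obj_tuples A n = {xs. length xs = Suc n \<and> set xs \<subseteq> obj A}"

text \<open>\<open>f\<^sub>0, \<dots>, f\<^sub>j\<^sub>-\<^sub>1 f\<^sub>j, \<dots>, f\<^sub>n\<close> and the corresponding objects, with \<open>x\<^sub>j\<close> omitted.\<close>

definition omit_obj :: "nat \<Rightarrow> 'o list \<Rightarrow> 'o list" where
  "omit_obj j xs = take j xs @ drop (Suc j) xs"

definition merge :: "('k, 'o, 'm) lincat \<Rightarrow> nat \<Rightarrow> 'o list \<Rightarrow> 'm list \<Rightarrow> 'm list" where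
  "merge A j xs fs = take (j - 1) fs @
     [cmp A (xs ! (j + 1)) (xs ! j) (xs ! (j - 1)) (fs ! (j - 1)) (fs ! j)] @
     drop (j + 1) fs"

definition map_arrs :: "('o, 'm) func \<Rightarrow> 'o list \<Rightarrow> 'm list \<Rightarrow> 'm list" where
  "map_arrs F xs fs = map (\<lambda>j. farr F (xs ! Suc j) (xs ! j) (fs ! j)) [0..<length fs]"


section \<open>Hochschild-Mitchell cohomology of the orbit category\<close>

text \<open>Linear maps out of a tensor product of spaces of morphisms are given as multilinear
  maps.  A cochain takes the objects \<open>x\<^sub>0, \<dots>, x\<^sub>n\<close> and the morphisms \<open>f\<^sub>1, \<dots>, f\<^sub>n\<close>, and is set
  to \<open>0\<close> on lists that are not of this form.\<close>

definition multilinear_on ::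
  "('k \<Rightarrow> 'm \<Rightarrow> 'm) \<Rightarrow> 'm::ab_group_add set list \<Rightarrow> ('m list \<Rightarrow> 'm) \<Rightarrow> bool" where
  "multilinear_on s Vs \<phi> \<longleftrightarrow>
     (\<forall>us\<in>listset Vs. \<forall>j<length Vs. \<forall>v\<in>Vs ! j. \<forall>w\<in>Vs ! j.
        \<phi> (us[j := v + w]) = \<phi> (us[j := v]) + \<phi> (us[j := w])) \<and>
     (\<forall>us\<in>listset Vs. \<forall>j<length Vs. \<forall>v\<in>Vs ! j. \<forall>c.
        \<phi> (us[j := s c v]) = s c (\<phi> (us[j := v])))"

definition cochains :: "('k::field, 'o, 'm::ab_group_add) lincat \<Rightarrow> ('o, 'm) func \<Rightarrow> nat \<Rightarrow> int \<Rightarrow>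
    ('k, 'o list \<Rightarrow> 'm list \<Rightarrow> 'm) vs" where
  "cochains A S n i =
     \<lparr>carr = {\<alpha>.
        (\<forall>xs\<in>obj_tuples A n. multilinear_on (smul A) (homs A xs) (\<alpha> xs) \<and>
           (\<forall>fs\<in>listset (homs A xs). \<alpha> xs fs \<in> bimod A S i (hd xs) (last xs))) \<and>
        (\<forall>xs fs. \<not> (xs \<in> obj_tuples A n \<and> fs \<in> listset (homs A xs)) \<longrightarrow> \<alpha> xs fs = 0)},
      vzero = (\<lambda>xs fs. 0),
      vadd = (\<lambda>\<alpha> \<beta> xs fs. \<alpha> xs fs + \<beta> xs fs),
      vscl = (\<lambda>c \<alpha> xs fs. smul A c (\<alpha> xs fs))\<rparr>"

text \<open>The differential from degree \<open>n\<close> to degree \<open>n + 1\<close>.\<close>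

definition codiff :: "('k::field, 'o, 'm::ab_group_add) lincat \<Rightarrow> ('o, 'm) func \<Rightarrow> nat \<Rightarrow> int \<Rightarrow>
    ('o list \<Rightarrow> 'm list \<Rightarrow> 'm) \<Rightarrow> 'o list \<Rightarrow> 'm list \<Rightarrow> 'm" where
  "codiff A S n i \<alpha> xs fs =
     (if xs \<in> obj_tuples A (Suc n) \<and> fs \<in> listset (homs A xs)
      then lact A S i (xs ! 1) (xs ! 0) (last xs) (hd fs) (\<alpha> (tl xs) (tl fs))
         + (\<Sum>j=1..n. smul A ((- 1) ^ j) (\<alpha> (omit_obj j xs) (merge A j xs fs)))
         + smul A ((- 1) ^ (n + 1))
             (ract A S i (hd xs) (xs ! n) (last xs) (\<alpha> (butlast xs) (butlast fs)) (last fs))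
      else 0)"

definition cocycles :: "('k::field, 'o, 'm::ab_group_add) lincat \<Rightarrow> ('o, 'm) func \<Rightarrow> nat \<Rightarrow> int \<Rightarrow>
    ('o list \<Rightarrow> 'm list \<Rightarrow> 'm) set" where
  "cocycles A S n i =
     {\<alpha> \<in> carr (cochains A S n i). codiff A S n i \<alpha> = vzero (cochains A S (Suc n) i)}"

definition coboundaries :: "('k::field, 'o, 'm::ab_group_add) lincat \<Rightarrow> ('o, 'm) func \<Rightarrow> nat \<Rightarrow> int \<Rightarrow>
    ('o list \<Rightarrow> 'm list \<Rightarrow> 'm) set" where
  "coboundaries A S n i =
     (case n of 0 \<Rightarrow> {vzero (cochains A S n i)}
      | Suc m \<Rightarrow> codiff A S m i ` carr (cochains A S m i))"

definition HH_coh :: "('k::field, 'o, 'm::ab_group_add) lincat \<Rightarrow> ('o, 'm) func \<Rightarrow> nat \<Rightarrow> int \<Rightarrow>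
    ('k, ('o list \<Rightarrow> 'm list \<Rightarrow> 'm) set) vs" where
  "HH_coh A S n i =
     quot ((cochains A S n i)\<lparr>carr := cocycles A S n i\<rparr>) (coboundaries A S n i)"


section \<open>Hochschild-Mitchell homology of the orbit category\<close>

text \<open>The direct sum over \<open>x\<^sub>0, \<dots>, x\<^sub>n\<close> of the tensor products is the free vector space on all
  \<open>(x\<^sub>0, \<dots>, x\<^sub>n; u, f\<^sub>1, \<dots>, f\<^sub>n)\<close> modulo multilinearity in \<open>u, f\<^sub>1, \<dots>, f\<^sub>n\<close>.\<close>

type_synonym ('o, 'm) gen = "'o list \<times> 'm list"

definition factors :: "('k, 'o, 'm) lincat \<Rightarrow> ('o, 'm) func \<Rightarrow> int \<Rightarrow> 'o list \<Rightarrow> 'm set list" where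
  "factors A S i xs = bimod A S i (last xs) (hd xs) # homs A xs"

definition gens :: "('k, 'o, 'm) lincat \<Rightarrow> ('o, 'm) func \<Rightarrow> nat \<Rightarrow> int \<Rightarrow> ('o, 'm) gen set" where
  "gens A S n i = {(xs, us). xs \<in> obj_tuples A n \<and> us \<in> listset (factors A S i xs)}"

definition rels :: "('k::field, 'o, 'm::ab_group_add) lincat \<Rightarrow> ('o, 'm) func \<Rightarrow> nat \<Rightarrow> int \<Rightarrow>
    (('o, 'm) gen \<Rightarrow>\<^sub>0 'k) set" where
  "rels A S n i = module.span fscale
     ({Poly_Mapping.single (xs, us[j := v + w]) 1
         - Poly_Mapping.single (xs, us[j := v]) 1 - Poly_Mapping.single (xs, us[j := w]) 1
        | xs us j v w. (xs, us) \<in> gens A S n i \<and> j < length us \<and>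
            v \<in> factors A S i xs ! j \<and> w \<in> factors A S i xs ! j} \<union>
      {Poly_Mapping.single (xs, us[j := smul A c v]) 1
         - fscale c (Poly_Mapping.single (xs, us[j := v]) 1)
        | xs us j v c. (xs, us) \<in> gens A S n i \<and> j < length us \<and>
            v \<in> factors A S i xs ! j})"

definition chains :: "('k::field, 'o, 'm::ab_group_add) lincat \<Rightarrow> ('o, 'm) func \<Rightarrow> nat \<Rightarrow> int \<Rightarrow>
    ('k, (('o, 'm) gen \<Rightarrow>\<^sub>0 'k) set) vs" where
  "chains A S n i = quot (free (gens A S n i)) (rels A S n i)"

text \<open>The map into chains of degree \<open>n\<close> given on pure tensors by \<open>\<phi>\<close>.\<close>

definition tensor_map :: "('k::field, 'o, 'm::ab_group_add) lincat \<Rightarrow> ('o, 'm) func \<Rightarrow> nat \<Rightarrow> int \<Rightarrow>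
    (('o, 'm) gen \<Rightarrow> ('o, 'm) gen \<Rightarrow>\<^sub>0 'k) \<Rightarrow>
    (('o, 'm) gen \<Rightarrow>\<^sub>0 'k) set \<Rightarrow> (('o, 'm) gen \<Rightarrow>\<^sub>0 'k) set" where
  "tensor_map A S n i \<phi> = qmap (free (gens A S n i)) (rels A S n i) (linext fscale \<phi>)"

text \<open>The differential from degree \<open>n + 1\<close> to degree \<open>n\<close>; the morphisms of a generator of
  degree \<open>n + 1\<close> are \<open>f\<^sub>0, \<dots>, f\<^sub>n\<close>.\<close>

definition diff_gen :: "('k::field, 'o, 'm::ab_group_add) lincat \<Rightarrow> ('o, 'm) func \<Rightarrow> nat \<Rightarrow> int \<Rightarrow>
    ('o, 'm) gen \<Rightarrow> ('o, 'm) gen \<Rightarrow>\<^sub>0 'k" where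
  "diff_gen A S n i = (\<lambda>(xs, us). let u = hd us; fs = tl us in
     Poly_Mapping.single
       (tl xs, ract A S i (last xs) (xs ! 0) (xs ! 1) u (hd fs) # tl fs) 1
     + (\<Sum>j=1..n. Poly_Mapping.single (omit_obj j xs, u # merge A j xs fs) ((- 1) ^ j))
     + Poly_Mapping.single
       (butlast xs, lact A S i (last xs) (xs ! n) (hd xs) (last fs) u # butlast fs)
       ((- 1) ^ (n + 1)))"

definition diff :: "('k::field, 'o, 'm::ab_group_add) lincat \<Rightarrow> ('o, 'm) func \<Rightarrow> nat \<Rightarrow> int \<Rightarrow>
    (('o, 'm) gen \<Rightarrow>\<^sub>0 'k) set \<Rightarrow> (('o, 'm) gen \<Rightarrow>\<^sub>0 'k) set" where
  "diff A S n i = tensor_map A S n i (diff_gen A S n i)"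

definition cycles :: "('k::field, 'o, 'm::ab_group_add) lincat \<Rightarrow> ('o, 'm) func \<Rightarrow> nat \<Rightarrow> int \<Rightarrow>
    (('o, 'm) gen \<Rightarrow>\<^sub>0 'k) set set" where
  "cycles A S n i =
     (case n of 0 \<Rightarrow> carr (chains A S n i)
      | Suc m \<Rightarrow> {P \<in> carr (chains A S n i). diff A S m i P = vzero (chains A S m i)})"

definition boundaries :: "('k::field, 'o, 'm::ab_group_add) lincat \<Rightarrow> ('o, 'm) func \<Rightarrow> nat \<Rightarrow> int \<Rightarrow>
    (('o, 'm) gen \<Rightarrow>\<^sub>0 'k) set set" where
  "boundaries A S n i = diff A S n i ` carr (chains A S (Suc n) i)"

definition HH_hom :: "('k::field, 'o, 'm::ab_group_add) lincat \<Rightarrow> ('o, 'm) func \<Rightarrow> nat \<Rightarrow> int \<Rightarrow>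
    ('k, (('o, 'm) gen \<Rightarrow>\<^sub>0 'k) set set) vs" where
  "HH_hom A S n i =
     quot ((chains A S n i)\<lparr>carr := cycles A S n i\<rparr>) (boundaries A S n i)"


section \<open>Contraction, trace and the map \<open>\<Theta>\<close>\<close>

text \<open>For a cochain \<open>\<alpha>\<close> with values in degree \<open>i\<close> and a generator with \<open>u\<close> in degree \<open>j\<close>, the
  element \<open>u \<circ> \<alpha>(f\<^sub>1, \<dots>, f\<^sub>n)\<close> is an endomorphism of \<open>x\<^sub>n\<close> of degree \<open>i + j\<close> in the orbit
  category.\<close>

definition contr_gen :: "('k::field, 'o, 'm::ab_group_add) lincat \<Rightarrow> ('o, 'm) func \<Rightarrow> int \<Rightarrow> int \<Rightarrow>
    ('o list \<Rightarrow> 'm list \<Rightarrow> 'm) \<Rightarrow> ('o, 'm) gen \<Rightarrow> ('o, 'm) gen \<Rightarrow>\<^sub>0 'k" where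
  "contr_gen A S i j \<alpha> = (\<lambda>(xs, us).
     Poly_Mapping.single
       ([last xs], [orb_cmp A S (last xs) (hd xs) (last xs) j i (hd us) (\<alpha> xs (tl us))]) 1)"

text \<open>The contraction of a homology class \<open>H\<close> in internal degree \<open>j\<close> with a cohomology class
  \<open>X\<close> in internal degree \<open>i\<close>, for any representatives.\<close>

definition contr :: "('k::field, 'o, 'm::ab_group_add) lincat \<Rightarrow> ('o, 'm) func \<Rightarrow> int \<Rightarrow> int \<Rightarrow>
    ('o list \<Rightarrow> 'm list \<Rightarrow> 'm) set \<Rightarrow>
    (('o, 'm) gen \<Rightarrow>\<^sub>0 'k) set set \<Rightarrow> (('o, 'm) gen \<Rightarrow>\<^sub>0 'k) set set" where
  "contr A S i j X H =
     (\<Union>\<alpha>\<in>X. qmap (chains A S 0 (i + j)) (boundaries A S 0 (i + j))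
        (tensor_map A S 0 (i + j) (contr_gen A S i j \<alpha>)) H)"

text \<open>The trace on the component of internal degree \<open>m\<close> of the zeroth homology.  It is constant
  on each class, and \<^const>\<open>the_elem\<close> extracts the common value.\<close>

definition tr_gen :: "int \<Rightarrow> ('o \<Rightarrow> 'm \<Rightarrow> 'k::field) \<Rightarrow> int \<Rightarrow> ('o, 'm) gen \<Rightarrow> 'k" where
  "tr_gen d tr m = (\<lambda>(xs, us). if m = d then tr (hd xs) (hd us) else 0)"

definition tr_HH :: "int \<Rightarrow> ('o \<Rightarrow> 'm \<Rightarrow> 'k::field) \<Rightarrow> int \<Rightarrow> (('o, 'm) gen \<Rightarrow>\<^sub>0 'k) set set \<Rightarrow> 'k" where
  "tr_HH d tr m H =
     the_elem ((\<lambda>P. the_elem (linext (*) (tr_gen d tr m) ` P)) ` H)"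

text \<open>Only the component of internal degree \<open>d - i\<close> of the homology is relevant to a class of
  internal degree \<open>i\<close>: on the others the trace of the contraction is zero.\<close>

definition Theta :: "('k::field, 'o, 'm::ab_group_add) lincat \<Rightarrow> ('o, 'm) func \<Rightarrow> int \<Rightarrow>
    ('o \<Rightarrow> 'm \<Rightarrow> 'k) \<Rightarrow> nat \<Rightarrow> int \<Rightarrow> ('o list \<Rightarrow> 'm list \<Rightarrow> 'm) set \<Rightarrow>
    (('o, 'm) gen \<Rightarrow>\<^sub>0 'k) set set \<Rightarrow> 'k" where
  "Theta A S d tr n i X =
     restrict (\<lambda>H. tr_HH d tr (i + (d - i)) (contr A S i (d - i) X H))
       (carr (HH_hom A S n (d - i)))"


section \<open>The action of \<open>\<Sigma>\<close>\<close>

definition sigma_cochain :: "('k::field, 'o, 'm::ab_group_add) lincat \<Rightarrow> ('o, 'm) func \<Rightarrow> nat \<Rightarrow> int \<Rightarrow>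
    ('o list \<Rightarrow> 'm list \<Rightarrow> 'm) \<Rightarrow> 'o list \<Rightarrow> 'm list \<Rightarrow> 'm" where
  "sigma_cochain A S n i \<alpha> xs fs =
     (if xs \<in> obj_tuples A n \<and> fs \<in> listset (homs A xs)
      then let ys = map (fobj (finv A S)) xs in
        sact A S i (hd ys) (last ys) (\<alpha> ys (map_arrs (finv A S) xs fs))
      else 0)"

definition sigma_coh :: "('k::field, 'o, 'm::ab_group_add) lincat \<Rightarrow> ('o, 'm) func \<Rightarrow> nat \<Rightarrow> int \<Rightarrow>
    ('o list \<Rightarrow> 'm list \<Rightarrow> 'm) set \<Rightarrow> ('o list \<Rightarrow> 'm list \<Rightarrow> 'm) set" where
  "sigma_coh A S n i = qmap (cochains A S n i) (coboundaries A S n i) (sigma_cochain A S n i)"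

definition sigma_gen :: "('k::field, 'o, 'm::ab_group_add) lincat \<Rightarrow> ('o, 'm) func \<Rightarrow> int \<Rightarrow>
    ('o, 'm) gen \<Rightarrow> ('o, 'm) gen \<Rightarrow>\<^sub>0 'k" where
  "sigma_gen A S i = (\<lambda>(xs, us).
     Poly_Mapping.single
       (map (fobj S) xs, sact A S i (last xs) (hd xs) (hd us) # map_arrs S xs (tl us)) 1)"

definition sigma_hom :: "('k::field, 'o, 'm::ab_group_add) lincat \<Rightarrow> ('o, 'm) func \<Rightarrow> nat \<Rightarrow> int \<Rightarrow>
    (('o, 'm) gen \<Rightarrow>\<^sub>0 'k) set set \<Rightarrow> (('o, 'm) gen \<Rightarrow>\<^sub>0 'k) set set" where
  "sigma_hom A S n i =
     qmap (chains A S n i) (boundaries A S n i) (tensor_map A S n i (sigma_gen A S i))"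

definition HH_coh_invar :: "('k::field, 'o, 'm::ab_group_add) lincat \<Rightarrow> ('o, 'm) func \<Rightarrow> nat \<Rightarrow> int \<Rightarrow>
    ('k, ('o list \<Rightarrow> 'm list \<Rightarrow> 'm) set) vs" where
  "HH_coh_invar A S n i = invar (sigma_coh A S n i) (HH_coh A S n i)"

definition HH_hom_anti_coinvar ::
  "('k::field, 'o, 'm::ab_group_add) lincat \<Rightarrow> ('o, 'm) func \<Rightarrow> nat \<Rightarrow> int \<Rightarrow>
    ('k, (('o, 'm) gen \<Rightarrow>\<^sub>0 'k) set set set) vs" where
  "HH_hom_anti_coinvar A S n i = anti_coinvar (sigma_hom A S n i) (HH_hom A S n i)"

definition Theta_sigma :: "('k::field, 'o, 'm::ab_group_add) lincat \<Rightarrow> ('o, 'm) func \<Rightarrow> int \<Rightarrow>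
    ('o \<Rightarrow> 'm \<Rightarrow> 'k) \<Rightarrow> nat \<Rightarrow> int \<Rightarrow> ('o list \<Rightarrow> 'm list \<Rightarrow> 'm) set \<Rightarrow>
    (('o, 'm) gen \<Rightarrow>\<^sub>0 'k) set set set \<Rightarrow> 'k" where
  "Theta_sigma A S d tr n i X =
     restrict (\<lambda>Q. the_elem (Theta A S d tr n i X ` Q))
       (carr (HH_hom_anti_coinvar A S n (d - i)))"

end

theory Submission
  imports Defs "HOL-Library.Function_Algebras"
begin

text \<open>On chains, \<open>\<alpha> \<mapsto> tr (u \<circ> \<alpha>(f\<^sub>1, \<dots>, f\<^sub>n))\<close> identifies the space of cochains of internal
  degree \<open>i\<close> with the dual of the space of chains of internal degree \<open>d - i\<close>: for fixed
  \<open>f\<^sub>1, \<dots>, f\<^sub>n\<close> every functional of \<open>u\<close> has this form for a unique value of \<open>\<alpha>\<close>, because the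
  pairing is perfect on finite dimensional spaces, and uniqueness makes \<open>\<alpha>\<close> multilinear.
  The case \<open>m = 0\<close> of the trace identity turns the last summand of \<open>d\<alpha>\<close> into the last
  summand of the differential of chains, so the two differentials are adjoint. Over a field
  the cohomology of the dual complex is the dual of the homology.

  For the second part, the case \<open>m = 1\<close> gives \<open>tr (\<Sigma> f) = (-1)\<^sup>d\<^sup>-\<^sup>1 tr f\<close>, hence the pairing of
  \<open>\<^sup>\<Sigma>\<alpha>\<close> with a chain \<open>c\<close> is minus the pairing of \<open>\<alpha>\<close> with the translate of \<open>c\<close> by the
  inverse of \<open>\<Sigma>\<close>. So \<open>\<alpha>\<close> is invariant in cohomology iff it annihilates all \<open>c + \<^sup>\<Sigma>c\<close>.\<close>


section \<open>Extension and separation of linear functionals\<close>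

text \<open>The obstacle is the nesting of quotients: chains are a quotient of a free space,
  homology is a quotient of cycles inside that quotient, and the anti-coinvariants are a quotient
  once more. All computations therefore take place on representatives in the free space on
  generators \<open>(xs, u # fs)\<close>. There a cycle is an element whose boundary lies in
  \<open>rels\<close>, and the bilinear form \<open>pairing\<close> is evaluated directly;
  \<open>presents\<close> records how each quotient arises from representatives, and
  \<open>lin_iso_dual\<close> passes to classes once. Finite dimension is available for single
  morphism spaces only, so the perfect pairing is used one string at a time, while functionals on
  spaces of chains are extended by means of bases of arbitrary size. Cohomology is described through
  homology: cocycles annihilate boundaries, coboundaries annihilate cycles, and that the square of
  the codifferential is zero or that \<Sigma> preserves cocycles is read off from the corresponding
  fact for chains.\<close>

definition (in vector_space) functional_on :: "'b set \<Rightarrow> ('b \<Rightarrow> 'a) \<Rightarrow> bool" where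
  "functional_on Z \<phi> \<longleftrightarrow> (\<forall>x\<in>Z. \<forall>y\<in>Z. \<phi> (x + y) = \<phi> x + \<phi> y) \<and>
     (\<forall>c. \<forall>x\<in>Z. \<phi> (scale c x) = c * \<phi> x)"

lemma linear_comp:
  "Vector_Spaces.linear s1 s2 f \<Longrightarrow> Vector_Spaces.linear s2 s3 g \<Longrightarrow> Vector_Spaces.linear s1 s3 (g \<circ> f)"
  by (simp add: Vector_Spaces.linear_iff)

lemma vector_space_mult: "vector_space ((*) :: 'k::field \<Rightarrow> 'k \<Rightarrow> 'k)"
  by unfold_locales (simp_all add: algebra_simps)

context vector_space
begin

lemma functional_on_add: "functional_on Z \<phi> \<Longrightarrow> x \<in> Z \<Longrightarrow> y \<in> Z \<Longrightarrow> \<phi> (x + y) = \<phi> x + \<phi> y"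
  by (simp add: functional_on_def)

lemma functional_on_scale: "functional_on Z \<phi> \<Longrightarrow> x \<in> Z \<Longrightarrow> \<phi> (scale c x) = c * \<phi> x"
  by (simp add: functional_on_def)

lemma functional_on_zero: "functional_on Z \<phi> \<Longrightarrow> subspace Z \<Longrightarrow> \<phi> 0 = 0"
  using functional_on_scale[of Z \<phi> 0 0] by (simp add: subspace_0)

lemma functional_on_diff:
  assumes "functional_on Z \<phi>" "subspace Z" "x \<in> Z" "y \<in> Z"
  shows "\<phi> (x - y) = \<phi> x - \<phi> y"
  using functional_on_add[OF assms(1) subspace_diff[OF assms(2-4)] assms(4)] by simp

lemma functional_on_sum:
  assumes \<phi>: "functional_on Z \<phi>" "subspace Z" and f: "\<And>j. j \<in> J \<Longrightarrow> f j \<in> Z"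
  shows "\<phi> (\<Sum>j\<in>J. f j) = (\<Sum>j\<in>J. \<phi> (f j))"
  using f
proof (induction J rule: infinite_finite_induct)
  case (insert j J)
  then show ?case
    using functional_on_add[OF \<phi>(1), of "f j" "sum f J"] subspace_sum[OF \<phi>(2), of J f] by simp
qed (simp_all add: functional_on_zero[OF \<phi>])

lemma linear_functional_on: "Vector_Spaces.linear scale (*) \<psi> \<Longrightarrow> functional_on Z \<psi>"
  by (simp add: functional_on_def Vector_Spaces.linear_iff)

text \<open>A maximal independent subset of \<open>Z\<close> determines \<open>\<phi>\<close>, and
  prescribed values on an independent set always extend to a linear map on the whole space.\<close>

lemma extend_functional:
  assumes Z: "subspace Z" and \<phi>: "functional_on Z \<phi>"
  shows "\<exists>\<psi>. Vector_Spaces.linear scale (*) \<psi> \<and> (\<forall>x\<in>Z. \<psi> x = \<phi> x)"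
proof -
  interpret k: vector_space "(*) :: 'a \<Rightarrow> 'a \<Rightarrow> 'a" by (rule vector_space_mult)
  interpret vector_space_pair scale "(*) :: 'a \<Rightarrow> 'a \<Rightarrow> 'a" by unfold_locales
  obtain B where B: "B \<subseteq> Z" "independent B" "Z \<subseteq> span B"
    by (rule maximal_independent_subset)
  obtain \<psi> where \<psi>: "Vector_Spaces.linear scale (*) \<psi>" "\<forall>x\<in>B. \<psi> x = \<phi> x"
    using linear_independent_extend[OF B(2)] by blast
  \<comment> \<open>The two functionals are known to agree on \<open>B\<close> only; the set of
    agreement is a subspace, so it contains the span of \<open>B\<close>.\<close>
  have "subspace {x \<in> Z. \<psi> x = \<phi> x}"
    using Z \<phi> \<psi>(1) functional_on_zero[OF \<phi> Z] functional_on_zero[OF linear_functional_on[OF \<psi>(1)]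
      subspace_UNIV]
    by (auto simp: subspace_def functional_on_def Vector_Spaces.linear_iff)
  then have "span B \<subseteq> {x \<in> Z. \<psi> x = \<phi> x}"
    by (intro span_minimal) (use B \<psi> in auto)
  with B(3) \<psi>(1) show ?thesis by blast
qed

end

text \<open>Exactness of duality: \<open>t\<close> kills every element of \<open>F\<close> that
  \<open>D\<close> sends into \<open>R\<close>, so it factors through the image of \<open>F\<close>
  modulo \<open>R\<close> and extends from there. It is applied with \<open>D\<close> a differential
  (to recognise coboundaries), the identity (to extend functionals from cycles to chains) and the
  parametrisation of a line.\<close>

lemma functional_factor:
  fixes D :: "'v::ab_group_add \<Rightarrow> 'w::ab_group_add" and t :: "'v \<Rightarrow> 'k::field"
  assumes D: "Vector_Spaces.linear s1 s2 D"
    and F: "module.subspace s1 F" and R: "module.subspace s2 R"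
    and t: "vector_space.functional_on s1 F t"
    and kern: "\<And>c. c \<in> F \<Longrightarrow> D c \<in> R \<Longrightarrow> t c = 0"
  obtains \<psi> where "Vector_Spaces.linear s2 (*) \<psi>" "\<And>c. c \<in> F \<Longrightarrow> \<psi> (D c) = t c"
    "\<And>r. r \<in> R \<Longrightarrow> \<psi> r = 0"
proof -
  interpret D: Vector_Spaces.linear s1 s2 D by (rule D)
  define W where "W = {x + y |x y. x \<in> D ` F \<and> y \<in> R}"
  have W: "D.vs2.subspace W"
    unfolding W_def by (intro D.vs2.subspace_sums D.subspace_image F R)
  \<comment> \<open>The value at \<open>w\<close> is \<open>t\<close> of any preimage of
    \<open>w\<close> modulo \<open>R\<close>; two preimages differ by an element that
    \<open>D\<close> sends into \<open>R\<close>, where \<open>t\<close> vanishes by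
    \<open>kern\<close>.\<close>
  define \<phi> where "\<phi> w = t (SOME c. c \<in> F \<and> w - D c \<in> R)" for w
  have \<phi>: "\<phi> (D c + r) = t c" if "c \<in> F" "r \<in> R" for c r
  proof -
    let ?c = "SOME c'. c' \<in> F \<and> D c + r - D c' \<in> R"
    have *: "?c \<in> F \<and> D c + r - D ?c \<in> R"
      by (rule someI[of _ c]) (use that in auto)
    have "D (c - ?c) = (D c + r - D ?c) - r" by (simp add: D.diff)
    then have "D (c - ?c) \<in> R" using D.vs2.subspace_diff[OF R conjunct2[OF *] that(2)] by (simp only:)
    then have "t (c - ?c) = 0" using kern * that D.vs1.subspace_diff[OF F] by blast
    then show ?thesis
      unfolding \<phi>_def using D.vs1.functional_on_diff[OF t F that(1), of ?c] * by simp
  qed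
  have "D.vs2.functional_on W \<phi>"
    unfolding D.vs2.functional_on_def
  proof (intro conjI ballI allI)
    fix x y assume "x \<in> W" "y \<in> W"
    then obtain c r c' r' where *: "x = D c + r" "y = D c' + r'" "c \<in> F" "c' \<in> F" "r \<in> R" "r' \<in> R"
      unfolding W_def by blast
    have "x + y = D (c + c') + (r + r')" unfolding * D.add by (simp only: ac_simps)
    then have "\<phi> (x + y) = t (c + c')"
      using \<phi>[OF D.vs1.subspace_add[OF F *(3,4)] D.vs2.subspace_add[OF R *(5,6)]] by (simp only:)
    then show "\<phi> (x + y) = \<phi> x + \<phi> y"
      using * D.vs1.functional_on_add[OF t] by (simp add: \<phi>)
  next
    fix a x assume "x \<in> W"
    then obtain c r where *: "x = D c + r" "c \<in> F" "r \<in> R"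
      unfolding W_def by blast
    have "s2 a x = D (s1 a c) + s2 a r" unfolding * D.scale D.vs2.scale_right_distrib ..
    then show "\<phi> (s2 a x) = a * \<phi> x"
      using * D.vs1.subspace_scale[OF F] D.vs2.subspace_scale[OF R] D.vs1.functional_on_scale[OF t]
      by (simp add: \<phi>)
  qed
  then obtain \<psi> where \<psi>: "Vector_Spaces.linear s2 (*) \<psi>" "\<forall>x\<in>W. \<psi> x = \<phi> x"
    using D.vs2.extend_functional[OF W] by blast
  show ?thesis
  proof
    show "Vector_Spaces.linear s2 (*) \<psi>" by (rule \<psi>)
    fix c assume c: "c \<in> F"
    then have "D c + 0 \<in> W" unfolding W_def using D.vs2.subspace_0[OF R] by blast
    then show "\<psi> (D c) = t c" using \<psi>(2) \<phi>[OF c D.vs2.subspace_0[OF R]] by simp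
  next
    fix r assume r: "r \<in> R"
    have "D 0 + r \<in> W" unfolding W_def using D.vs1.subspace_0[OF F] r by blast
    then show "\<psi> r = 0"
      using \<psi>(2) \<phi>[OF D.vs1.subspace_0[OF F] r] D.vs1.functional_on_zero[OF t F] by simp
  qed
qed

text \<open>The identity of the field is factored through \<open>a \<mapsto> a v\<close>, a map that
  is injective modulo \<open>S\<close> because \<open>v\<close> lies outside
  \<open>S\<close>.\<close>

lemma (in vector_space) separating_functional:
  assumes S: "subspace S" and v: "v \<notin> S"
  obtains \<psi> where "Vector_Spaces.linear scale (*) \<psi>" "\<psi> v = 1" "\<And>x. x \<in> S \<Longrightarrow> \<psi> x = 0"
proof -
  interpret k: vector_space "(*) :: 'a \<Rightarrow> 'a \<Rightarrow> 'a" by (rule vector_space_mult)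
  have D: "Vector_Spaces.linear (*) scale (\<lambda>a. scale a v)"
    by unfold_locales (simp_all add: scale_left_distrib)
  have "a = 0" if "scale a v \<in> S" for a
    using subspace_scale[OF S that, of "inverse a"] v by (cases "a = 0") auto
  then obtain \<psi> where "Vector_Spaces.linear scale (*) \<psi>" "\<And>c. \<psi> (scale c v) = c"
      "\<And>x. x \<in> S \<Longrightarrow> \<psi> x = 0"
    using functional_factor[OF D k.subspace_UNIV S, of "\<lambda>a. a"] by (auto simp: k.functional_on_def)
  then show ?thesis using that by (metis scale_one)
qed


section \<open>Presentations of vector spaces by subquotients\<close>

text \<open>\<open>h\<close> exhibits \<open>W\<close> as the image of \<open>Z\<close> in the quotient by \<open>B\<close>; \<open>B\<close> need not be
  contained in \<open>Z\<close>.\<close>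

definition (in vector_space) presents :: "'b set \<Rightarrow> 'b set \<Rightarrow> ('a, 'w) vs \<Rightarrow> ('b \<Rightarrow> 'w) \<Rightarrow> bool" where
  "presents Z B W h \<longleftrightarrow> subspace Z \<and> subspace B \<and> h ` Z = carr W \<and>
     (\<forall>x\<in>Z. \<forall>y\<in>Z. h x = h y \<longleftrightarrow> x - y \<in> B) \<and>
     (\<forall>x\<in>Z. \<forall>y\<in>Z. vadd W (h x) (h y) = h (x + y)) \<and>
     (\<forall>c. \<forall>x\<in>Z. vscl W c (h x) = h (scale c x))"

lemma qmap_eqI: "P \<noteq> {} \<Longrightarrow> (\<And>p. p \<in> P \<Longrightarrow> coset W N (f p) = Q) \<Longrightarrow> qmap W N f P = Q"
  unfolding qmap_def by auto

text \<open>The operations of \<open>quot\<close> do not look at the carrier. So homology, defined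
  as a quotient of cycles, can be computed as a part of the quotient of all chains, and likewise
  cohomology.\<close>

lemma quot_restrict_carr:
  "quot (V\<lparr>carr := C\<rparr>) N = (quot V N)\<lparr>carr := coset V N ` C\<rparr>"
  by (simp add: quot_def qmap_def[abs_def] coset_def[abs_def])

context vector_space
begin

lemma presentsD:
  assumes "presents Z B W h"
  shows "subspace Z" "subspace B" "h ` Z = carr W"
    "\<And>x y. x \<in> Z \<Longrightarrow> y \<in> Z \<Longrightarrow> h x = h y \<longleftrightarrow> x - y \<in> B"
    "\<And>x y. x \<in> Z \<Longrightarrow> y \<in> Z \<Longrightarrow> vadd W (h x) (h y) = h (x + y)"
    "\<And>c x. x \<in> Z \<Longrightarrow> vscl W c (h x) = h (scale c x)"
  using assms unfolding presents_def by blast+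

text \<open>This is the benefit of letting \<open>B\<close> leave \<open>Z\<close>: passing to
  cycles or cocycles keeps the same \<open>B\<close>.\<close>

lemma presents_subspace:
  "presents Z B W h \<Longrightarrow> subspace Z' \<Longrightarrow> Z' \<subseteq> Z \<Longrightarrow> presents Z' B (W\<lparr>carr := h ` Z'\<rparr>) h"
  unfolding presents_def by (simp add: subset_iff)

lemma presents_self: "subspace Z \<Longrightarrow> carr W = Z \<Longrightarrow> vadd W = (+) \<Longrightarrow> vscl W = scale \<Longrightarrow>
    presents Z {0} W (\<lambda>x. x)"
  unfolding presents_def by auto

lemma mem_coset:
  assumes "presents Z B W h" "B' \<subseteq> Z" "x \<in> Z"
  shows "p \<in> coset W (h ` B') (h x) \<longleftrightarrow> (\<exists>b\<in>B'. p = h (x + b))"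
proof -
  have "vadd W (h x) (h b) = h (x + b)" if "b \<in> B'" for b
    using assms that by (auto intro!: presentsD(5))
  then show ?thesis unfolding coset_def image_image by auto
qed

text \<open>Third isomorphism theorem. The map \<open>h\<close> already divides by \<open>B\<close>,
  and \<open>B \<inter> Z \<subseteq> B'\<close> says that dividing by the image of
  \<open>B'\<close> afterwards is coarser.\<close>

lemma coset_eq_iff:
  assumes h: "presents Z B W h" and B': "subspace B'" "B' \<subseteq> Z" "B \<inter> Z \<subseteq> B'"
    and x: "x \<in> Z" and y: "y \<in> Z"
  shows "coset W (h ` B') (h x) = coset W (h ` B') (h y) \<longleftrightarrow> x - y \<in> B'"
proof
  note Z = presentsD(1)[OF h]
  assume eq: "coset W (h ` B') (h x) = coset W (h ` B') (h y)"
  have "h x \<in> coset W (h ` B') (h x)"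
    unfolding mem_coset[OF h B'(2) x] using subspace_0[OF B'(1)] by force
  then obtain b where b: "b \<in> B'" "h x = h (y + b)"
    unfolding eq mem_coset[OF h B'(2) y] by blast
  have yb: "y + b \<in> Z" using subspace_add[OF Z y] b B' by blast
  then have "x - (y + b) \<in> B'"
    using presentsD(4)[OF h x yb] b B' subspace_diff[OF Z x yb] by blast
  then show "x - y \<in> B'" using subspace_add[OF B'(1) _ b(1)] by force
next
  note Z = presentsD(1)[OF h]
  assume xy: "x - y \<in> B'"
  have "(\<exists>b\<in>B'. p = h (x + b)) \<longleftrightarrow> (\<exists>b\<in>B'. p = h (y + b))" for p
  proof
    assume "\<exists>b\<in>B'. p = h (x + b)"
    then obtain b where "b \<in> B'" "p = h (x + b)" by blast
    then show "\<exists>b\<in>B'. p = h (y + b)"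
      by (intro bexI[of _ "x - y + b"]) (use subspace_add[OF B'(1) xy] in auto)
  next
    assume "\<exists>b\<in>B'. p = h (y + b)"
    then obtain b where "b \<in> B'" "p = h (y + b)" by blast
    then show "\<exists>b\<in>B'. p = h (x + b)"
      by (intro bexI[of _ "b - (x - y)"]) (use subspace_diff[OF B'(1) _ xy] in \<open>auto simp: add.commute\<close>)
  qed
  then show "coset W (h ` B') (h x) = coset W (h ` B') (h y)"
    by (intro set_eqI) (simp only: mem_coset[OF h B'(2) x] mem_coset[OF h B'(2) y])
qed

lemma coset_nonempty: "subspace B' \<Longrightarrow> coset W (h ` B') v \<noteq> {}"
  using subspace_0 unfolding coset_def by blast

text \<open>Iterated quotients collapse: chains, homology and anti-coinvariants are all reached from
  one free space by repeated use. Since \<open>quot\<close> computes with unions over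
  representatives, each operation is checked for every representative.\<close>

lemma presents_quot:
  assumes h: "presents Z B W h" and B': "subspace B'" "B' \<subseteq> Z" "B \<inter> Z \<subseteq> B'"
  shows "presents Z B' (quot W (h ` B')) (\<lambda>x. coset W (h ` B') (h x))"
proof -
  note Z = presentsD(1)[OF h] and mem = mem_coset[OF h B'(2)] and iff = coset_eq_iff[OF h B']
  have add: "qmap W (h ` B') (\<lambda>p. vadd W p q) (coset W (h ` B') (h x)) =
      coset W (h ` B') (h (x + y))"
    if x: "x \<in> Z" and y: "y \<in> Z" and q: "q \<in> coset W (h ` B') (h y)" for x y q
  proof (rule qmap_eqI[OF coset_nonempty[OF B'(1)]])
    fix p assume "p \<in> coset W (h ` B') (h x)"
    then obtain b where b: "b \<in> B'" "p = h (x + b)" using mem[OF x] by blast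
    obtain b' where b': "b' \<in> B'" "q = h (y + b')" using mem[OF y] q by blast
    have xb: "x + b \<in> Z" "y + b' \<in> Z" using subspace_add[OF Z] x y b b' B' by auto
    have "(x + b) + (y + b') - (x + y) = b + b'" by simp
    then have "coset W (h ` B') (h ((x + b) + (y + b'))) = coset W (h ` B') (h (x + y))"
      using iff[OF subspace_add[OF Z xb] subspace_add[OF Z x y]] subspace_add[OF B'(1) b(1) b'(1)]
      by simp
    then show "coset W (h ` B') (vadd W p q) = coset W (h ` B') (h (x + y))"
      using b b' xb presentsD(5)[OF h] by simp
  qed
  have scl: "qmap W (h ` B') (vscl W c) (coset W (h ` B') (h x)) = coset W (h ` B') (h (scale c x))"
    if x: "x \<in> Z" for c x
  proof (rule qmap_eqI[OF coset_nonempty[OF B'(1)]])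
    fix p assume "p \<in> coset W (h ` B') (h x)"
    then obtain b where b: "b \<in> B'" "p = h (x + b)" using mem[OF x] by blast
    have xb: "x + b \<in> Z" using subspace_add[OF Z] x b B' by auto
    have "scale c (x + b) - scale c x = scale c b" by (simp add: scale_right_distrib)
    then have "coset W (h ` B') (h (scale c (x + b))) = coset W (h ` B') (h (scale c x))"
      using iff[OF subspace_scale[OF Z xb] subspace_scale[OF Z x]] subspace_scale[OF B'(1) b(1)]
      by simp
    then show "coset W (h ` B') (vscl W c p) = coset W (h ` B') (h (scale c x))"
      using b xb presentsD(6)[OF h] by simp
  qed
  show ?thesis
    unfolding presents_def
  proof (intro conjI ballI allI)
    show "(\<lambda>x. coset W (h ` B') (h x)) ` Z = carr (quot W (h ` B'))"
      using presentsD(3)[OF h, symmetric] by (simp add: quot_def image_image)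
    fix x y assume x: "x \<in> Z" and y: "y \<in> Z"
    show "vadd (quot W (h ` B')) (coset W (h ` B') (h x)) (coset W (h ` B') (h y)) =
        coset W (h ` B') (h (x + y))"
      using add[OF x y] coset_nonempty[OF B'(1), of W h "h y"] by (simp add: quot_def)
    show "(coset W (h ` B') (h x) = coset W (h ` B') (h y)) = (x - y \<in> B')"
      by (rule iff[OF x y])
  next
    fix c x assume "x \<in> Z"
    then show "vscl (quot W (h ` B')) c (coset W (h ` B') (h x)) = coset W (h ` B') (h (scale c x))"
      using scl by (simp add: quot_def)
  qed (rule Z B'(1))+
qed

lemma qmap_coset:
  assumes h: "presents Z B V h" and B': "B' \<subseteq> Z" "subspace B'" and x: "x \<in> Z"
    and f: "\<And>b. b \<in> B' \<Longrightarrow> coset W N (f (h (x + b))) = Q"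
  shows "qmap W N f (coset V (h ` B') (h x)) = Q"
proof (rule qmap_eqI[OF coset_nonempty[OF B'(2)]])
  fix p assume "p \<in> coset V (h ` B') (h x)"
  then obtain b where b: "b \<in> B'" "p = h (x + b)" using mem_coset[OF h B'(1) x] by blast
  show "coset W N (f p) = Q" unfolding b(2) by (rule f[OF b(1)])
qed

end

text \<open>The common frame of both isomorphisms. The bilinear form \<open>T\<close> on
  representatives vanishes on \<open>B2\<close>, has its left kernel inside \<open>B1\<close>, and
  represents every functional vanishing on \<open>B2\<close>. The map \<open>f\<close> on classes is
  known through the values \<open>T x y\<close>, and \<open>f_ext\<close> pins these functions down
  off the carrier, because elements of \<open>dual\<close> are extensional.\<close>

lemma lin_iso_dual:
  assumes s1: "vector_space s1" and s2: "vector_space s2"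
    and h1: "vector_space.presents s1 Z1 B1 W1 h1"
    and h2: "vector_space.presents s2 Z2 B2 W2 h2"
    and T_add: "\<And>x x' y. x \<in> Z1 \<Longrightarrow> x' \<in> Z1 \<Longrightarrow> y \<in> Z2 \<Longrightarrow> T (x + x') y = T x y + T x' y"
    and T_scale: "\<And>c x y. x \<in> Z1 \<Longrightarrow> y \<in> Z2 \<Longrightarrow> T (s1 c x) y = c * T x y"
    and T_lin: "\<And>x. x \<in> Z1 \<Longrightarrow> vector_space.functional_on s2 Z2 (T x)"
    and T_B2: "\<And>x y. x \<in> Z1 \<Longrightarrow> y \<in> Z2 \<Longrightarrow> y \<in> B2 \<Longrightarrow> T x y = 0"
    and T_inj: "\<And>x. x \<in> Z1 \<Longrightarrow> (\<And>y. y \<in> Z2 \<Longrightarrow> T x y = 0) \<Longrightarrow> x \<in> B1"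
    and T_surj: "\<And>\<phi>. vector_space.functional_on s2 Z2 \<phi> \<Longrightarrow>
      (\<And>y. y \<in> Z2 \<Longrightarrow> y \<in> B2 \<Longrightarrow> \<phi> y = 0) \<Longrightarrow> \<exists>x\<in>Z1. \<forall>y\<in>Z2. T x y = \<phi> y"
    and f: "\<And>x y. x \<in> Z1 \<Longrightarrow> y \<in> Z2 \<Longrightarrow> f (h1 x) (h2 y) = T x y"
    and f_ext: "\<And>x. x \<in> Z1 \<Longrightarrow> f (h1 x) \<in> extensional (carr W2)"
  shows "lin_iso W1 (dual W2) f"
proof -
  interpret v1: vector_space s1 by (rule s1)
  interpret v2: vector_space s2 by (rule s2)
  note W1 = v1.presentsD(3)[OF h1, symmetric] and W2 = v2.presentsD(3)[OF h2, symmetric]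
  note h1 = v1.presentsD[OF h1] and h2 = v2.presentsD[OF h2]
  have f_dual: "f (h1 x) \<in> carr (dual W2)" if "x \<in> Z1" for x
    using that f_ext[OF that] v2.subspace_add[OF h2(1)] v2.subspace_scale[OF h2(1)]
      v2.functional_on_add[OF T_lin[OF that]] v2.functional_on_scale[OF T_lin[OF that]]
    by (auto simp: dual_def W2 f h2(5,6))
  have inj: "inj_on f (carr W1)"
  proof (rule inj_onI)
    fix u v assume "u \<in> carr W1" "v \<in> carr W1" and eq: "f u = f v"
    then obtain x y where x: "x \<in> Z1" "u = h1 x" and y: "y \<in> Z1" "v = h1 y"
      unfolding W1 by blast
    have "T (x - y) z = 0" if z: "z \<in> Z2" for z
    proof -
      have "T x z = T y z" using f[OF x(1) z] f[OF y(1) z] eq x y by simp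
      moreover have "T (x - y) z + T y z = T x z"
        using T_add[OF v1.subspace_diff[OF h1(1) x(1) y(1)] y(1) z] by simp
      ultimately show ?thesis by simp
    qed
    then have "x - y \<in> B1" using T_inj v1.subspace_diff[OF h1(1) x(1) y(1)] by blast
    then show "u = v" using h1(4) x y by blast
  qed
  have surj: "\<exists>x\<in>Z1. f (h1 x) = \<xi>" if \<xi>: "\<xi> \<in> carr (dual W2)" for \<xi>
  proof -
    have \<xi>_add: "\<xi> (vadd W2 u v) = \<xi> u + \<xi> v" if "u \<in> carr W2" "v \<in> carr W2" for u v
      using that \<xi> by (simp add: dual_def)
    have \<xi>_scl: "\<xi> (vscl W2 c u) = c * \<xi> u" if "u \<in> carr W2" for u c
      using that \<xi> by (simp add: dual_def)
    have lin: "v2.functional_on Z2 (\<lambda>y. \<xi> (h2 y))"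
      unfolding v2.functional_on_def
    proof (intro conjI ballI allI)
      fix x y assume "x \<in> Z2" "y \<in> Z2"
      then show "\<xi> (h2 (x + y)) = \<xi> (h2 x) + \<xi> (h2 y)"
        using \<xi>_add[of "h2 x" "h2 y"] h2(5) W2 by simp
    next
      fix c y assume "y \<in> Z2"
      then show "\<xi> (h2 (s2 c y)) = c * \<xi> (h2 y)"
        using \<xi>_scl[of "h2 y" c] h2(6) W2 by simp
    qed
    have "\<xi> (h2 y) = 0" if "y \<in> Z2" "y \<in> B2" for y
      using v2.functional_on_zero[OF lin h2(1)] h2(4)[OF that(1) v2.subspace_0[OF h2(1)]] that by simp
    then obtain x where x: "x \<in> Z1" "\<forall>y\<in>Z2. T x y = \<xi> (h2 y)" using T_surj[OF lin] by blast
    have "f (h1 x) = \<xi>"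
    proof (rule extensionalityI[OF f_ext[OF x(1)]])
      show "\<xi> \<in> extensional (carr W2)" using \<xi> by (simp add: dual_def)
      show "f (h1 x) u = \<xi> u" if "u \<in> carr W2" for u
        using that x f by (auto simp: W2)
    qed
    with x show ?thesis by blast
  qed
  show ?thesis
    unfolding lin_iso_def
  proof (intro conjI ballI allI)
    show "bij_betw f (carr W1) (carr (dual W2))"
      unfolding bij_betw_def using inj f_dual surj by (force simp: W1)
    fix u v assume "u \<in> carr W1" "v \<in> carr W1"
    then obtain x y where x: "x \<in> Z1" "u = h1 x" and y: "y \<in> Z1" "v = h1 y"
      unfolding W1 by blast
    have xy: "x + y \<in> Z1" using v1.subspace_add[OF h1(1)] x y by blast
    show "f (vadd W1 u v) = vadd (dual W2) (f u) (f v)"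
    proof (rule extensionalityI[where A = "carr W2"])
      show "f (vadd W1 u v) \<in> extensional (carr W2)" using f_ext[OF xy] h1(5) x y by simp
    qed (use x y xy h1(5) f T_add in \<open>auto simp: dual_def W2\<close>)
  next
    fix c u assume "u \<in> carr W1"
    then obtain x where x: "x \<in> Z1" "u = h1 x" unfolding W1 by blast
    have cx: "s1 c x \<in> Z1" using v1.subspace_scale[OF h1(1)] x by blast
    show "f (vscl W1 c u) = vscl (dual W2) c (f u)"
    proof (rule extensionalityI[where A = "carr W2"])
      show "f (vscl W1 c u) \<in> extensional (carr W2)" using f_ext[OF cx] h1(6) x by simp
    qed (use x cx h1(6) f T_scale in \<open>auto simp: dual_def W2\<close>)
  qed
qed


section \<open>Free vector spaces\<close>

lemma lookup_fscale [simp]: "Poly_Mapping.lookup (fscale c p) g = c * Poly_Mapping.lookup p g"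
  by (simp add: fscale_def Poly_Mapping.map.rep_eq when_def)

interpretation free: vector_space "fscale :: 'k::field \<Rightarrow> ('g \<Rightarrow>\<^sub>0 'k) \<Rightarrow> 'g \<Rightarrow>\<^sub>0 'k"
  by unfold_locales (auto intro!: poly_mapping_eqI simp: lookup_add algebra_simps)

lemma carr_free: "carr (free G) = {c. Poly_Mapping.keys c \<subseteq> G}"
  by (simp add: free_def)

lemma fscale_single: "fscale a (Poly_Mapping.single g b) = Poly_Mapping.single g (a * b)"
  by (rule poly_mapping_eqI) (simp add: lookup_single when_def)

lemma subspace_free: "free.subspace (carr (free G :: ('k::field, _) vs))"
proof (rule free.subspaceI)
  fix x y :: "'a \<Rightarrow>\<^sub>0 'k" and c :: 'k
  assume x: "x \<in> carr (free G)"
  then show "fscale c x \<in> carr (free G)"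
    by (auto simp: carr_free in_keys_iff subset_iff)
  assume "y \<in> carr (free G)"
  with x show "x + y \<in> carr (free G)"
    using keys_add[of x y] by (auto simp: carr_free)
qed (simp add: carr_free)

lemma presents_free: "free.presents (carr (free G)) {0} (free G) (\<lambda>x. x)"
  by (rule free.presents_self[OF subspace_free]) (simp_all add: free_def)

lemma single_in_free: "g \<in> G \<Longrightarrow> Poly_Mapping.single g a \<in> carr (free G)"
  by (simp add: carr_free)

lemma free_expand:
  "c = (\<Sum>g\<in>Poly_Mapping.keys c. fscale (Poly_Mapping.lookup c g) (Poly_Mapping.single g 1))"
  by (rule poly_mapping_eqI)
    (simp add: lookup_sum lookup_single when_def in_keys_iff if_distrib[of "times _"] cong: if_cong)

lemma free_span:
  fixes G :: "'g set"
  shows "carr (free G :: ('k::field, 'g \<Rightarrow>\<^sub>0 'k) vs) = free.span ((\<lambda>g. Poly_Mapping.single g 1) ` G)"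
proof (rule subset_antisym)
  show "carr (free G :: ('k, 'g \<Rightarrow>\<^sub>0 'k) vs) \<subseteq> free.span ((\<lambda>g. Poly_Mapping.single g 1) ` G)"
  proof
    fix c :: "'g \<Rightarrow>\<^sub>0 'k" assume c: "c \<in> carr (free G)"
    show "c \<in> free.span ((\<lambda>g. Poly_Mapping.single g 1) ` G)"
      by (subst free_expand[of c]) (rule free.span_sum, rule free.span_scale, rule free.span_base,
        use c in \<open>auto simp: carr_free\<close>)
  qed
  show "free.span ((\<lambda>g. Poly_Mapping.single g 1) ` G) \<subseteq> carr (free G :: ('k, 'g \<Rightarrow>\<^sub>0 'k) vs)"
    by (rule free.span_minimal) (auto intro: single_in_free subspace_free)
qed

lemma linext_linear:
  fixes s :: "'k::field \<Rightarrow> 'v::ab_group_add \<Rightarrow> 'v" and \<phi> :: "'g \<Rightarrow> 'v"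
  assumes "vector_space s"
  shows "Vector_Spaces.linear fscale s (linext s \<phi>)"
proof -
  interpret vector_space s by (rule assms)
  \<comment> \<open>Cancellation can make the keys of a sum smaller than the union of the keys, so
    all sums are rewritten over one common finite set.\<close>
  have ext: "linext s \<phi> c = (\<Sum>g\<in>K. s (Poly_Mapping.lookup c g) (\<phi> g))"
    if "finite K" "Poly_Mapping.keys c \<subseteq> K" for c K
    unfolding linext_def by (rule sum.mono_neutral_left) (use that in \<open>auto simp: in_keys_iff\<close>)
  show ?thesis
  proof unfold_locales
    fix x y :: "'g \<Rightarrow>\<^sub>0 'k"
    let ?K = "Poly_Mapping.keys x \<union> Poly_Mapping.keys y"
    show "linext s \<phi> (x + y) = linext s \<phi> x + linext s \<phi> y"
      using ext[of ?K "x + y"] ext[of ?K x] ext[of ?K y] keys_add[of x y]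
      by (simp add: lookup_add scale_left_distrib sum.distrib)
  next
    fix a and x :: "'g \<Rightarrow>\<^sub>0 'k"
    have "Poly_Mapping.keys (fscale a x) \<subseteq> Poly_Mapping.keys x" by (auto simp: in_keys_iff)
    then show "linext s \<phi> (fscale a x) = s a (linext s \<phi> x)"
      using ext[of "Poly_Mapping.keys x" "fscale a x"] ext[of "Poly_Mapping.keys x" x]
      by (simp add: scale_sum_right)
  qed
qed

lemma linext_single:
  assumes "vector_space s"
  shows "linext s \<phi> (Poly_Mapping.single g a) = s a (\<phi> g)"
proof -
  interpret vector_space s by (rule assms)
  show ?thesis by (cases "a = 0") (simp_all add: linext_def)
qed

lemma linear_free_in_subspace:
  assumes f: "Vector_Spaces.linear fscale s f" and S: "module.subspace s S"
    and gens: "\<And>g. g \<in> G \<Longrightarrow> f (Poly_Mapping.single g 1) \<in> S" and c: "c \<in> carr (free G)"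
  shows "f c \<in> S"
proof -
  interpret f: Vector_Spaces.linear fscale s f by (rule f)
  have "free.span ((\<lambda>g. Poly_Mapping.single g 1) ` G) \<subseteq> f -` S"
    by (rule free.span_minimal[OF _ f.subspace_vimage[OF S]]) (use gens in auto)
  then show ?thesis using c unfolding free_span by blast
qed

lemma linear_free_eq:
  assumes f: "Vector_Spaces.linear fscale s f" and f': "Vector_Spaces.linear fscale s f'"
    and gens: "\<And>g. g \<in> G \<Longrightarrow> f (Poly_Mapping.single g 1) = f' (Poly_Mapping.single g 1)"
    and c: "c \<in> carr (free G)"
  shows "f c = f' c"
proof -
  interpret f: Vector_Spaces.linear fscale s f by (rule f)
  interpret vector_space_pair fscale s by unfold_locales
  show ?thesis
    by (rule linear_eq_on[OF f f' c[unfolded free_span]]) (use gens in auto)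
qed

text \<open>The pair \<open>(k, j)\<close> with \<open>j < k\<close> cancels against
  \<open>(j, k - 1)\<close>: the terms agree by assumption and the exponents differ by one. This
  matches the pairs below the diagonal with those on or above it.\<close>

lemma (in vector_space) alternating_sum_zero:
  assumes h: "\<And>j k. j < k \<Longrightarrow> k \<le> Suc N \<Longrightarrow> h k j = h j (k - 1)"
  shows "(\<Sum>k\<le>Suc N. \<Sum>j\<le>N. scale ((- 1) ^ (k + j)) (h k j)) = 0"
proof -
  let ?f = "\<lambda>(k, j). scale ((- 1) ^ (k + j)) (h k j)"
  let ?L = "{(k, j). j < k \<and> k \<le> Suc N}" and ?U = "{(k, j). k \<le> j \<and> j \<le> N}"
  have split: "{..Suc N} \<times> {..N} = ?L \<union> ?U" "?L \<inter> ?U = {}" by auto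
  have fin: "finite ?L" "finite ?U"
    by (rule finite_subset[of _ "{..Suc N} \<times> {..N}"]; force)+
  have sgn: "(- 1 :: 'a) ^ (k + j) = - ((- 1) ^ (k + j - Suc 0))" if "j < k" for j k
    using that by (cases k) auto
  have "sum ?f ?L = (\<Sum>(k, j)\<in>?U. - scale ((- 1) ^ (k + j)) (h k j))"
    by (rule sum.reindex_bij_witness[of _ "\<lambda>(k, j). (Suc j, k)" "\<lambda>(k, j). (j, k - 1)"])
      (auto simp: h add.commute sgn)
  then have "sum ?f ?L + sum ?f ?U = 0" by (simp add: case_prod_beta sum_negf)
  then show ?thesis
    unfolding sum.cartesian_product split(1) sum.union_disjoint[OF fin split(2)] .
qed


section \<open>Powers of an automorphism\<close>

lemma fcomp_simps [simp]:
  "fobj (fcomp F G) x = fobj F (fobj G x)"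
  "farr (fcomp F G) x y f = farr F (fobj G x) (fobj G y) (farr G x y f)"
  by (simp_all add: fcomp_def)

lemma fid_simps [simp]: "fobj fid x = x" "farr fid x y f = f"
  by (simp_all add: fid_def)

lemma fcomp_assoc: "fcomp (fcomp F G) H = fcomp F (fcomp G H)"
  by (simp add: fcomp_def)

lemma fcomp_fid [simp]: "fcomp fid F = F" "fcomp F fid = F"
  by (simp_all add: fcomp_def fid_def)

text \<open>Outside the objects and morphisms of \<open>A\<close> the powers of \<open>\<Sigma>\<close> need not satisfy
  \<open>\<Sigma>\<^sup>m\<^sup>+\<^sup>n = \<Sigma>\<^sup>m \<Sigma>\<^sup>n\<close>, hence the relativised equality.\<close>

definition feq :: "('k, 'o, 'm) lincat \<Rightarrow> ('o, 'm) func \<Rightarrow> ('o, 'm) func \<Rightarrow> bool" where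
  "feq A F G \<longleftrightarrow> (\<forall>x\<in>obj A. fobj F x = fobj G x) \<and>
     (\<forall>x\<in>obj A. \<forall>y\<in>obj A. \<forall>f\<in>hom A x y. farr F x y f = farr G x y f)"

lemma feq_refl: "feq A F F"
  by (simp add: feq_def)

lemma feq_sym: "feq A F G \<Longrightarrow> feq A G F"
  by (simp add: feq_def)

lemma feq_trans [trans]: "feq A F G \<Longrightarrow> feq A G H \<Longrightarrow> feq A F H"
  by (simp add: feq_def)

lemma feq_fcomp_right: "feq A F F' \<Longrightarrow> feq A (fcomp G F) (fcomp G F')"
  by (simp add: feq_def)

context linear_automorphism
begin

lemma fobj_in: "x \<in> obj A \<Longrightarrow> fobj S x \<in> obj A"
  using fobj_bij by (auto simp: bij_betw_def)

lemma farr_in: "x \<in> obj A \<Longrightarrow> y \<in> obj A \<Longrightarrow> f \<in> hom A x y \<Longrightarrow> farr S x y f \<in> hom A (fobj S x) (fobj S y)"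
  using farr_bij[of x y] by (auto simp: bij_betw_def)

lemma feq_fcomp_left: "feq A F F' \<Longrightarrow> feq A (fcomp F S) (fcomp F' S)"
  by (simp add: feq_def fobj_in farr_in)

lemma finv_fobj_in: "x \<in> obj A \<Longrightarrow> fobj (finv A S) x \<in> obj A"
  using bij_betw_inv_into[OF fobj_bij] by (auto simp: finv_def Let_def bij_betw_def)

lemma fobj_finv: "x \<in> obj A \<Longrightarrow> fobj S (fobj (finv A S) x) = x"
  by (simp add: finv_def Let_def bij_betw_inv_into_right[OF fobj_bij])

lemma finv_fobj: "x \<in> obj A \<Longrightarrow> fobj (finv A S) (fobj S x) = x"
  by (simp add: finv_def Let_def bij_betw_inv_into_left[OF fobj_bij])

lemma finv_farr_bij:
  assumes "x \<in> obj A" "y \<in> obj A"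
  shows "bij_betw (farr (finv A S) x y) (hom A x y) (hom A (fobj (finv A S) x) (fobj (finv A S) y))"
  using bij_betw_inv_into[OF farr_bij[OF finv_fobj_in finv_fobj_in, OF assms]] assms
    fobj_finv[OF assms(1)] fobj_finv[OF assms(2)]
  by (simp add: finv_def Let_def)

lemma finv_farr_in:
  assumes "x \<in> obj A" "y \<in> obj A" "f \<in> hom A x y"
  shows "farr (finv A S) x y f \<in> hom A (fobj (finv A S) x) (fobj (finv A S) y)"
  using finv_farr_bij[OF assms(1,2)] assms by (auto simp: bij_betw_def)

lemma farr_finv:
  assumes "x \<in> obj A" "y \<in> obj A" "f \<in> hom A x y"
  shows "farr S (fobj (finv A S) x) (fobj (finv A S) y) (farr (finv A S) x y f) = f"
  using bij_betw_inv_into_right[OF farr_bij[OF finv_fobj_in finv_fobj_in, OF assms(1,2)], of f]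
    fobj_finv[OF assms(1)] fobj_finv[OF assms(2)] assms
  by (simp add: finv_def Let_def)

lemma finv_farr:
  assumes "x \<in> obj A" "y \<in> obj A" "f \<in> hom A x y"
  shows "farr (finv A S) (fobj S x) (fobj S y) (farr S x y f) = f"
  using bij_betw_inv_into_left[OF farr_bij[OF assms(1,2)] assms(3)] finv_fobj[OF assms(1)]
    finv_fobj[OF assms(2)]
  by (simp add: finv_def Let_def)

text \<open>\<Sigma> is injective on morphisms, so an identity for its inverse may be checked after
  applying \<Sigma>; the algebraic laws in \<open>laut_finv\<close> are obtained in this
  way.\<close>

lemma finv_farr_eqI:
  assumes "x \<in> obj A" "y \<in> obj A" "g \<in> hom A (fobj (finv A S) x) (fobj (finv A S) y)"
    "farr S (fobj (finv A S) x) (fobj (finv A S) y) g = f"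
  shows "farr (finv A S) x y f = g"
  using finv_farr[OF finv_fobj_in finv_fobj_in, OF assms(1-3)] assms(4) fobj_finv assms(1,2) by simp

lemma laut_finv: "linear_automorphism A (finv A S)"
proof unfold_locales
  show "bij_betw (fobj (finv A S)) (obj A) (obj A)"
    using bij_betw_inv_into[OF fobj_bij] by (simp add: finv_def Let_def)
  note fobj_finv[simp] finv_fobj_in[simp] finv_farr_in[simp] farr_finv[simp]
  fix x y assume x[simp]: "x \<in> obj A" and y[simp]: "y \<in> obj A"
  show "bij_betw (farr (finv A S) x y) (hom A x y) (hom A (fobj (finv A S) x) (fobj (finv A S) y))"
    by (rule finv_farr_bij[OF x y])
  let ?H = "hom A (fobj (finv A S) x) (fobj (finv A S) y)"
  have sub: "subspace ?H" by (rule hom_subspace) simp_all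
  fix f assume f[simp]: "f \<in> hom A x y"
  show "farr (finv A S) x y (f + g) = farr (finv A S) x y f + farr (finv A S) x y g"
    if "g \<in> hom A x y" for g
    using that by (intro finv_farr_eqI) (simp_all add: subspace_add[OF sub] farr_add)
  show "farr (finv A S) x y (smul A c f) = smul A c (farr (finv A S) x y f)" for c
    by (intro finv_farr_eqI) (simp_all add: subspace_scale[OF sub] farr_smul)
  show "farr (finv A S) x z (cmp A x y z g f) =
      cmp A (fobj (finv A S) x) (fobj (finv A S) y) (fobj (finv A S) z)
        (farr (finv A S) y z g) (farr (finv A S) x y f)"
    if "z \<in> obj A" "g \<in> hom A y z" for z g
    using that by (intro finv_farr_eqI) (simp_all add: cmp_in_hom farr_cmp)
next
  fix x assume "x \<in> obj A"
  then show "farr (finv A S) x x (ide A x) = ide A (fobj (finv A S) x)"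
    by (intro finv_farr_eqI) (simp_all add: farr_ide finv_fobj_in fobj_finv ide_in_hom)
qed

lemma laut_fcomp:
  assumes "linear_automorphism A G"
  shows "linear_automorphism A (fcomp G S)"
proof -
  interpret G: linear_automorphism A G by (rule assms)
  note [simp] = fobj_in farr_in
  show ?thesis
  proof unfold_locales
    show "bij_betw (fobj (fcomp G S)) (obj A) (obj A)"
      using bij_betw_trans[OF fobj_bij G.fobj_bij] by (simp add: comp_def fcomp_def)
    show "bij_betw (farr (fcomp G S) x y) (hom A x y) (hom A (fobj (fcomp G S) x) (fobj (fcomp G S) y))"
      if "x \<in> obj A" "y \<in> obj A" for x y
      using bij_betw_trans[OF farr_bij[OF that] G.farr_bij[OF fobj_in fobj_in, OF that]]
      by (simp add: comp_def fcomp_def)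
  qed (simp_all add: farr_add farr_smul farr_cmp farr_ide G.farr_add G.farr_smul G.farr_cmp G.farr_ide)
qed

end

lemma (in linear_category) laut_fid: "linear_automorphism A fid"
  by unfold_locales (simp_all add: fid_def bij_betw_def)

context linear_automorphism
begin

lemma laut_fnpow: "linear_automorphism A (fnpow S n)"
proof (induction n)
  case (Suc n)
  then interpret n: linear_automorphism A "fnpow S n" .
  show ?case using n.laut_fcomp[OF linear_automorphism_axioms] by simp
qed (simp add: laut_fid)

lemma laut_fzpow: "linear_automorphism A (fzpow A S n)"
  using laut_fnpow linear_automorphism.laut_fnpow[OF laut_finv] by (simp add: fzpow_def)

lemma feq_fcomp_finv: "feq A (fcomp S (finv A S)) fid" "feq A (fcomp (finv A S) S) fid"
  by (simp_all add: feq_def fobj_finv finv_fobj farr_finv finv_farr)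

lemma fzpow_Suc: "feq A (fzpow A S (n + 1)) (fcomp S (fzpow A S n))"
proof (cases "n \<ge> 0")
  case True
  then have "nat (n + 1) = Suc (nat n)" by simp
  with True show ?thesis by (simp add: fzpow_def feq_refl)
next
  case False
  \<comment> \<open>For negative \<open>n\<close> the power consists of \<open>k + 1\<close> copies
    of the inverse with \<open>k = - n - 1\<close>; composing with \<Sigma> removes the outermost
    one.\<close>
  define k where "k = nat (- n - 1)"
  have n: "fzpow A S n = fcomp (finv A S) (fnpow (finv A S) k)"
    using False Suc_nat_eq_nat_zadd1[of "- n - 1"] by (simp add: fzpow_def k_def flip: fnpow.simps)
  \<comment> \<open>For \<open>n = -1\<close> the exponent \<open>n + 1\<close> is \<open>0\<close>
    and falls under the nonnegative branch of \<open>fzpow\<close>, hence the case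
    distinction.\<close>
  have "fzpow A S (n + 1) = fnpow (finv A S) k"
    using False by (cases "n = -1") (simp_all add: fzpow_def k_def)
  moreover have "linear_automorphism A (fnpow (finv A S) k)"
    by (rule linear_automorphism.laut_fnpow[OF laut_finv])
  from linear_automorphism.feq_fcomp_left[OF this feq_fcomp_finv(1)]
  have "feq A (fcomp S (fzpow A S n)) (fnpow (finv A S) k)" by (simp add: n fcomp_assoc)
  ultimately show ?thesis by (simp add: feq_sym)
qed

lemma fzpow_pred: "feq A (fzpow A S (n - 1)) (fcomp (finv A S) (fzpow A S n))"
proof -
  have "feq A (fcomp (finv A S) (fzpow A S n)) (fcomp (finv A S) (fcomp S (fzpow A S (n - 1))))"
    using feq_fcomp_right[OF fzpow_Suc[of "n - 1"]] by simp
  also have "feq A \<dots> (fzpow A S (n - 1))"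
    using linear_automorphism.feq_fcomp_left[OF laut_fzpow feq_fcomp_finv(2)]
    by (simp add: fcomp_assoc)
  finally show ?thesis by (rule feq_sym)
qed

lemma fzpow_0: "fzpow A S 0 = fid"
  by (simp add: fzpow_def)

lemma fzpow_add: "feq A (fzpow A S (m + n)) (fcomp (fzpow A S m) (fzpow A S n))"
proof (induction m rule: int_induct[where k = 0])
  case base
  show ?case by (simp add: fzpow_0 feq_refl)
next
  case (step1 m)
  have "feq A (fzpow A S (m + 1 + n)) (fcomp S (fzpow A S (m + n)))"
    using fzpow_Suc[of "m + n"] by (simp add: ac_simps)
  also have "feq A \<dots> (fcomp (fcomp S (fzpow A S m)) (fzpow A S n))"
    using feq_fcomp_right[OF step1(2)] by (simp add: fcomp_assoc)
  also have "feq A \<dots> (fcomp (fzpow A S (m + 1)) (fzpow A S n))"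
    by (rule linear_automorphism.feq_fcomp_left[OF laut_fzpow feq_sym[OF fzpow_Suc]])
  finally show ?case .
next
  case (step2 m)
  have "feq A (fzpow A S (m - 1 + n)) (fcomp (finv A S) (fzpow A S (m + n)))"
    using fzpow_pred[of "m + n"] by (simp add: algebra_simps)
  also have "feq A \<dots> (fcomp (fcomp (finv A S) (fzpow A S m)) (fzpow A S n))"
    using feq_fcomp_right[OF step2(2)] by (simp add: fcomp_assoc)
  also have "feq A \<dots> (fcomp (fzpow A S (m - 1)) (fzpow A S n))"
    by (rule linear_automorphism.feq_fcomp_left[OF laut_fzpow feq_sym[OF fzpow_pred]])
  finally show ?case .
qed

lemma So_in: "x \<in> obj A \<Longrightarrow> So A S n x \<in> obj A"
  by (rule linear_automorphism.fobj_in[OF laut_fzpow])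

lemma Sa_in: "x \<in> obj A \<Longrightarrow> y \<in> obj A \<Longrightarrow> f \<in> hom A x y \<Longrightarrow>
    Sa A S n x y f \<in> hom A (So A S n x) (So A S n y)"
  by (rule linear_automorphism.farr_in[OF laut_fzpow])

lemma Sa_add: "x \<in> obj A \<Longrightarrow> y \<in> obj A \<Longrightarrow> f \<in> hom A x y \<Longrightarrow> g \<in> hom A x y \<Longrightarrow>
    Sa A S n x y (f + g) = Sa A S n x y f + Sa A S n x y g"
  by (rule linear_automorphism.farr_add[OF laut_fzpow])

lemma Sa_smul: "x \<in> obj A \<Longrightarrow> y \<in> obj A \<Longrightarrow> f \<in> hom A x y \<Longrightarrow>
    Sa A S n x y (smul A c f) = smul A c (Sa A S n x y f)"
  by (rule linear_automorphism.farr_smul[OF laut_fzpow])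

lemma Sa_cmp: "x \<in> obj A \<Longrightarrow> y \<in> obj A \<Longrightarrow> z \<in> obj A \<Longrightarrow> g \<in> hom A y z \<Longrightarrow> f \<in> hom A x y \<Longrightarrow>
    Sa A S n x z (cmp A x y z g f) =
      cmp A (So A S n x) (So A S n y) (So A S n z) (Sa A S n y z g) (Sa A S n x y f)"
  by (rule linear_automorphism.farr_cmp[OF laut_fzpow])

lemma So_plus: "x \<in> obj A \<Longrightarrow> So A S (m + n) x = So A S m (So A S n x)"
  using fzpow_add[of m n] by (simp add: feq_def)

lemma Sa_plus: "x \<in> obj A \<Longrightarrow> y \<in> obj A \<Longrightarrow> f \<in> hom A x y \<Longrightarrow>
    Sa A S (m + n) x y f = Sa A S m (So A S n x) (So A S n y) (Sa A S n x y f)"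
  using fzpow_add[of m n] by (simp add: feq_def)

lemma fzpow_1: "feq A (fzpow A S 1) S"
  using fzpow_Suc[of 0] by (simp add: fzpow_0)

lemma fzpow_minus_1: "feq A (fzpow A S (- 1)) (finv A S)"
  using fzpow_pred[of 0] by (simp add: fzpow_0)

lemma fzpow_commute: "feq A (fcomp (fzpow A S m) (fzpow A S n)) (fcomp (fzpow A S n) (fzpow A S m))"
  using feq_trans[OF feq_sym[OF fzpow_add[of m n]]] fzpow_add[of n m] by (simp add: add.commute)

end

text \<open>Instantiated below with \<open>\<Sigma>\<close> itself and with its inverse.\<close>

locale commuting_automorphism = linear_automorphism A S + G: linear_automorphism A G
  for A :: "('k::field, 'o, 'm::ab_group_add) lincat" and S G :: "('o, 'm) func" +
  assumes commute: "feq A (fcomp G (fzpow A S n)) (fcomp (fzpow A S n) G)"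
begin

lemma So_commute: "x \<in> obj A \<Longrightarrow> fobj G (So A S n x) = So A S n (fobj G x)"
  using commute[of n] by (simp add: feq_def)

lemma Sa_commute: "x \<in> obj A \<Longrightarrow> y \<in> obj A \<Longrightarrow> f \<in> hom A x y \<Longrightarrow>
    farr G (So A S n x) (So A S n y) (Sa A S n x y f) = Sa A S n (fobj G x) (fobj G y) (farr G x y f)"
  using commute[of n] by (simp add: feq_def)

end

context linear_automorphism
begin

text \<open>Powers of \<Sigma> commute with each other on \<open>A\<close>, and the two instances
  agree there with the powers \<open>1\<close> and \<open>- 1\<close>.\<close>

lemma commuting_automorphismI:
  assumes G: "linear_automorphism A G" and m: "feq A (fzpow A S m) G"
  shows "commuting_automorphism A S G"
proof -
  interpret G: linear_automorphism A G by (rule G)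
  show ?thesis
  proof unfold_locales
    fix n
    have "feq A (fcomp G (fzpow A S n)) (fcomp (fzpow A S m) (fzpow A S n))"
      by (rule linear_automorphism.feq_fcomp_left[OF laut_fzpow feq_sym[OF m]])
    also have "feq A \<dots> (fcomp (fzpow A S n) (fzpow A S m))" by (rule fzpow_commute)
    also have "feq A \<dots> (fcomp (fzpow A S n) G)" by (rule feq_fcomp_right[OF m])
    finally show "feq A (fcomp G (fzpow A S n)) (fcomp (fzpow A S n) G)" .
  qed
qed

lemma commuting_S: "commuting_automorphism A S S"
  by (rule commuting_automorphismI[OF linear_automorphism_axioms fzpow_1])

lemma commuting_finv: "commuting_automorphism A S (finv A S)"
  by (rule commuting_automorphismI[OF laut_finv fzpow_minus_1])

end


section \<open>Generators and relations\<close>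

lemma in_listset: "us \<in> listset Vs \<longleftrightarrow> length us = length Vs \<and> (\<forall>j<length Vs. us ! j \<in> Vs ! j)"
proof (induction Vs arbitrary: us)
  case (Cons V Vs)
  show ?case
    by (cases us) (auto simp: set_Cons_def Cons.IH All_less_Suc2)
qed auto

lemma length_homs [simp]: "length (homs A xs) = length xs - 1"
  by (simp add: homs_def)

lemma nth_homs [simp]: "j < length xs - 1 \<Longrightarrow> homs A xs ! j = hom A (xs ! Suc j) (xs ! j)"
  by (simp add: homs_def)

lemma obj_tuplesD:
  assumes "xs \<in> obj_tuples A n"
  shows "length xs = Suc n" "\<And>j. j \<le> n \<Longrightarrow> xs ! j \<in> obj A" "hd xs = xs ! 0" "last xs = xs ! n"
    "hd xs \<in> obj A" "last xs \<in> obj A"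
proof -
  show len: "length xs = Suc n" using assms by (simp add: obj_tuples_def)
  show nth: "xs ! j \<in> obj A" if "j \<le> n" for j
    using assms that nth_mem[of j xs] by (auto simp: obj_tuples_def)
  show hd: "hd xs = xs ! 0" and last: "last xs = xs ! n"
    using len hd_conv_nth[of xs] last_conv_nth[of xs]
      by (metis length_0_conv nat.distinct(1) diff_Suc_1)+
  show "hd xs \<in> obj A" "last xs \<in> obj A" using nth hd last by auto
qed

lemma obj_tuplesI: "length xs = Suc n \<Longrightarrow> (\<And>j. j \<le> n \<Longrightarrow> xs ! j \<in> obj A) \<Longrightarrow> xs \<in> obj_tuples A n"
  by (auto simp: obj_tuples_def in_set_conv_nth less_Suc_eq_le)

lemma length_factors: "xs \<in> obj_tuples A n \<Longrightarrow> length (factors A S i xs) = Suc n"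
  by (simp add: factors_def obj_tuplesD(1))

lemma factors_0: "xs \<in> obj_tuples A n \<Longrightarrow> factors A S i xs ! 0 = hom A (xs ! 0) (So A S i (xs ! n))"
  by (simp add: factors_def bimod_def orb_hom_def obj_tuplesD(3,4))

lemma factors_Suc: "xs \<in> obj_tuples A n \<Longrightarrow> j < n \<Longrightarrow>
  factors A S i xs ! Suc j = hom A (xs ! Suc j) (xs ! j)"
  by (simp add: factors_def obj_tuplesD(1))

lemma mem_gens:
  "(xs, us) \<in> gens A S n i \<longleftrightarrow> xs \<in> obj_tuples A n \<and> length us = Suc n \<and>
     (\<forall>k\<le>n. us ! k \<in> factors A S i xs ! k)"
  using length_factors[of xs A n S i] by (auto simp: gens_def in_listset less_Suc_eq_le)

lemma mem_gens_Cons: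
  "(xs, u # fs) \<in> gens A S n i \<longleftrightarrow> xs \<in> obj_tuples A n \<and>
     u \<in> hom A (hd xs) (So A S i (last xs)) \<and> fs \<in> listset (homs A xs)"
  by (auto simp: gens_def factors_def bimod_def orb_hom_def set_Cons_def)

lemma gens_cases:
  assumes "g \<in> gens A S n i"
  obtains xs u fs where "g = (xs, u # fs)" "xs \<in> obj_tuples A n"
    "u \<in> hom A (hd xs) (So A S i (last xs))" "fs \<in> listset (homs A xs)" "length fs = n"
proof -
  obtain xs us where g: "g = (xs, us)" by (cases g)
  then obtain u fs where "us = u # fs" using assms by (cases us) (auto simp: mem_gens)
  then show ?thesis using that[of xs u fs] assms g mem_gens[of xs us A S n i]
    by (auto simp: mem_gens_Cons)
qed

lemma gens_update:
  assumes "(xs, us) \<in> gens A S n i" "v \<in> factors A S i xs ! k"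
  shows "(xs, us[k := v]) \<in> gens A S n i"
  using assms by (cases "k < length us") (auto simp: mem_gens nth_list_update)

lemma listset_update:
  "fs \<in> listset Vs \<Longrightarrow> v \<in> Vs ! k \<Longrightarrow> fs[k := v] \<in> listset Vs"
  by (cases "k < length fs") (auto simp: in_listset nth_list_update)

text \<open>The condition under which values on pure tensors define a linear map from the tensor
  product into the quotient by \<open>R\<close>. Here \<open>R\<close> is \<open>rels\<close> for
  maps between chains and \<open>{0}\<close> for the trace.\<close>

definition multilinear_mod :: "('k::field, 'o, 'm::ab_group_add) lincat \<Rightarrow> ('o, 'm) func \<Rightarrow> nat \<Rightarrow> int \<Rightarrow>
    ('k \<Rightarrow> 'v::ab_group_add \<Rightarrow> 'v) \<Rightarrow> 'v set \<Rightarrow> (('o, 'm) gen \<Rightarrow> 'v) \<Rightarrow> bool" where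
  "multilinear_mod A S n i s R \<phi> \<longleftrightarrow>
     (\<forall>xs us k v. (xs, us) \<in> gens A S n i \<longrightarrow> k \<le> n \<longrightarrow> v \<in> factors A S i xs ! k \<longrightarrow>
        (\<forall>w\<in>factors A S i xs ! k.
           \<phi> (xs, us[k := v + w]) - \<phi> (xs, us[k := v]) - \<phi> (xs, us[k := w]) \<in> R) \<and>
        (\<forall>c. \<phi> (xs, us[k := smul A c v]) - s c (\<phi> (xs, us[k := v])) \<in> R))"

lemma multilinear_modD:
  assumes "multilinear_mod A S n i s R \<phi>" "(xs, us) \<in> gens A S n i" "k \<le> n" "v \<in> factors A S i xs ! k"
  shows "w \<in> factors A S i xs ! k \<Longrightarrow>
      \<phi> (xs, us[k := v + w]) - \<phi> (xs, us[k := v]) - \<phi> (xs, us[k := w]) \<in> R"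
    "\<phi> (xs, us[k := smul A c v]) - s c (\<phi> (xs, us[k := v])) \<in> R"
  using assms unfolding multilinear_mod_def by blast+

lemma multilinear_mod_add:
  assumes s: "vector_space s" and R: "module.subspace s R"
    and \<phi>: "multilinear_mod A S n i s R \<phi>" and \<psi>: "multilinear_mod A S n i s R \<psi>"
  shows "multilinear_mod A S n i s R (\<lambda>g. \<phi> g + \<psi> g)"
proof -
  interpret vector_space s by (rule s)
  have *: "(a + b) - (a' + b') - (a'' + b'') \<in> R" if "a - a' - a'' \<in> R" "b - b' - b'' \<in> R"
    for a a' a'' b b' b''
    using subspace_add[OF R that] by (simp add: algebra_simps)
  have **: "(a + b) - s c (a' + b') \<in> R" if "a - s c a' \<in> R" "b - s c b' \<in> R" for a b a' b' c
    using subspace_add[OF R that] by (simp add: algebra_simps)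
  show ?thesis
    unfolding multilinear_mod_def
    using multilinear_modD[OF \<phi>] multilinear_modD[OF \<psi>] * **
      by (intro allI impI conjI ballI; simp only:)
qed

lemma multilinear_mod_sum:
  assumes s: "vector_space s" and R: "module.subspace s R"
    and \<phi>: "\<And>j. j \<in> J \<Longrightarrow> multilinear_mod A S n i s R (\<phi> j)"
  shows "multilinear_mod A S n i s R (\<lambda>g. \<Sum>j\<in>J. \<phi> j g)"
proof -
  interpret vector_space s by (rule s)
  have 0: "multilinear_mod A S n i s R (\<lambda>g. 0)"
    by (simp add: multilinear_mod_def subspace_0[OF R])
  show ?thesis
    using \<phi>
  proof (induction J rule: infinite_finite_induct)
    case (insert j J)
    then show ?case using multilinear_mod_add[OF s R, of A S n i "\<phi> j"] by simp
  qed (simp_all add: 0)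
qed

lemma relsI_add:
  assumes "(xs, us) \<in> gens A S n i" "k < length us" "v \<in> factors A S i xs ! k" "w
    \<in> factors A S i xs ! k"
  shows "Poly_Mapping.single (xs, us[k := v + w]) (1::'k::field) - Poly_Mapping.single
    (xs, us[k := v]) 1
    - Poly_Mapping.single (xs, us[k := w]) 1 \<in> rels A S n i"
  unfolding rels_def by (rule free.span_base) (use assms in blast)

lemma relsI_smul:
  assumes "(xs, us) \<in> gens A S n i" "k < length us" "v \<in> factors A S i xs ! k"
  shows "Poly_Mapping.single (xs, us[k := smul A c v]) (1::'k::field)
    - fscale c (Poly_Mapping.single (xs, us[k := v]) 1) \<in> rels A S n i"
  unfolding rels_def by (rule free.span_base) (use assms in blast)

lemma subspace_rels: "free.subspace (rels A S n i)"
  unfolding rels_def by (rule free.subspace_span)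

text \<open>The universal property of the tensor product: the defining elements of
  \<open>rels\<close> go exactly to the elements that \<open>multilinear_mod\<close> places in
  \<open>R\<close>.\<close>

lemma multilinear_mod_linext:
  assumes s: "vector_space s" and R: "module.subspace s R" and \<phi>: "multilinear_mod A S n i s R \<phi>"
    and r: "r \<in> rels A S n i"
  shows "linext s \<phi> r \<in> R"
proof -
  interpret vector_space s by (rule s)
  interpret l: Vector_Spaces.linear fscale s "linext s \<phi>" by (rule linext_linear[OF s])
  have "rels A S n i \<subseteq> linext s \<phi> -` R"
    unfolding rels_def
  proof (rule free.span_minimal[OF _ l.subspace_vimage[OF R]], safe)
    fix xs us j v w assume *: "(xs, us) \<in> gens A S n i" "j < length us"
      "v \<in> factors A S i xs ! j" "w \<in> factors A S i xs ! j"
    then have "j \<le> n" by (simp add: mem_gens)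
    from multilinear_modD(1)[OF \<phi> *(1) this *(3,4)]
    show "Poly_Mapping.single (xs, us[j := v + w]) 1 - Poly_Mapping.single (xs, us[j := v]) 1 -
        Poly_Mapping.single (xs, us[j := w]) 1 \<in> linext s \<phi> -` R"
      by (simp add: l.diff linext_single[OF s])
  next
    fix xs us j v c assume *: "(xs, us) \<in> gens A S n i" "j < length us"
      "v \<in> factors A S i xs ! j"
    then have "j \<le> n" by (simp add: mem_gens)
    from multilinear_modD(2)[OF \<phi> *(1) this *(3)]
    show "Poly_Mapping.single (xs, us[j := smul A c v]) 1 -
        fscale c (Poly_Mapping.single (xs, us[j := v]) 1) \<in> linext s \<phi> -` R"
      by (simp add: l.diff l.scale linext_single[OF s])
  qed
  then show ?thesis using r by blast
qed

text \<open>Faces, contraction and the action of \<Sigma> share this pattern: changing slot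
  \<open>k\<close> of the source changes a single slot \<open>l\<close> of the target, through a
  linear map \<open>L\<close>. The defect of multilinearity is then a scalar multiple of a relation
  of the target.\<close>

lemma multilinear_mod_single:
  fixes A :: "('k::field, 'o, 'm::ab_group_add) lincat" and a :: 'k
  assumes slot: "\<And>xs us k. (xs, us) \<in> gens A S n i \<Longrightarrow> k \<le> n \<Longrightarrow> \<exists>ys ws l L.
    (ys, ws) \<in> gens A S n' i' \<and> l \<le> n' \<and>
    (\<forall>v\<in>factors A S i xs ! k. L v \<in> factors A S i' ys ! l \<and> \<psi> (xs, us[k := v]) = (ys, ws[l := L v]) \<and>
       (\<forall>w\<in>factors A S i xs ! k. L (v + w) = L v + L w \<and> v + w \<in> factors A S i xs ! k) \<and>
       (\<forall>c. L (smul A c v) = smul A c (L v) \<and> smul A c v \<in> factors A S i xs ! k))"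
  shows "multilinear_mod A S n i fscale (rels A S n' i') (\<lambda>g. Poly_Mapping.single (\<psi> g) a)"
  unfolding multilinear_mod_def
proof (intro allI impI conjI ballI)
  fix xs us k v assume gen: "(xs, us) \<in> gens A S n i" and k: "k \<le> n" and v: "v \<in> factors A S i xs ! k"
  obtain ys ws l L where ws: "(ys, ws) \<in> gens A S n' i'" "l \<le> n'"
    and L: "\<And>v. v \<in> factors A S i xs ! k \<Longrightarrow> L v \<in> factors A S i' ys ! l \<and>
      \<psi> (xs, us[k := v]) = (ys, ws[l := L v])"
      "\<And>v w. v \<in> factors A S i xs ! k \<Longrightarrow> w \<in> factors A S i xs ! k \<Longrightarrow>
        L (v + w) = L v + L w \<and> v + w \<in> factors A S i xs ! k"
      "\<And>v c. v \<in> factors A S i xs ! k \<Longrightarrow> L (smul A c v) = smul A c (L v) \<and>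
        smul A c v \<in> factors A S i xs ! k"
    using slot[OF gen k] by blast
  have l: "l < length ws" using ws by (simp add: mem_gens)
  note scale = free.subspace_scale[OF subspace_rels, where c = a]
  {
    fix w assume w: "w \<in> factors A S i xs ! k"
    show "Poly_Mapping.single (\<psi> (xs, us[k := v + w])) a - Poly_Mapping.single (\<psi> (xs, us[k := v])) a -
        Poly_Mapping.single (\<psi> (xs, us[k := w])) a \<in> rels A S n' i'"
      using scale[OF relsI_add[OF ws(1) l, of "L v" "L w"]] L v w
      by (simp add: free.scale_right_diff_distrib fscale_single)
  }
  fix c
  show "Poly_Mapping.single (\<psi> (xs, us[k := smul A c v])) a -
      fscale c (Poly_Mapping.single (\<psi> (xs, us[k := v])) a) \<in> rels A S n' i'"
    using scale[OF relsI_smul[OF ws(1) l, of "L v" c]] L v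
    by (simp add: free.scale_right_diff_distrib fscale_single mult.commute)
qed

lemma (in linear_automorphism) subspace_factors:
  assumes "xs \<in> obj_tuples A n" "k \<le> n"
  shows "subspace (factors A S i xs ! k)"
  using assms by (cases k) (auto simp: factors_0 factors_Suc obj_tuplesD So_in intro!: hom_subspace)

lemma (in linear_automorphism) multilinear_mod_singleI:
  fixes a :: 'k
  assumes slot: "\<And>xs us k. (xs, us) \<in> gens A S n i \<Longrightarrow> k \<le> n \<Longrightarrow> \<exists>ys ws l L.
    (ys, ws) \<in> gens A S n' i' \<and> l \<le> n' \<and>
    (\<forall>v\<in>factors A S i xs ! k. L v \<in> factors A S i' ys ! l \<and> \<psi> (xs, us[k := v]) = (ys, ws[l := L v]) \<and>
       (\<forall>w\<in>factors A S i xs ! k. L (v + w) = L v + L w) \<and> (\<forall>c. L (smul A c v) = smul A c (L v)))"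
  shows "multilinear_mod A S n i fscale (rels A S n' i') (\<lambda>g. Poly_Mapping.single (\<psi> g) a)"
proof (rule multilinear_mod_single)
  fix xs us k assume gen: "(xs, us) \<in> gens A S n i" and k: "k \<le> n"
  then have "subspace (factors A S i xs ! k)" by (auto simp: mem_gens intro: subspace_factors)
  then show "\<exists>ys ws l L. (ys, ws) \<in> gens A S n' i' \<and> l \<le> n' \<and>
    (\<forall>v\<in>factors A S i xs ! k. L v \<in> factors A S i' ys ! l \<and> \<psi> (xs, us[k := v]) = (ys, ws[l := L v]) \<and>
       (\<forall>w\<in>factors A S i xs ! k. L (v + w) = L v + L w \<and> v + w \<in> factors A S i xs ! k) \<and>
       (\<forall>c. L (smul A c v) = smul A c (L v) \<and> smul A c v \<in> factors A S i xs ! k))"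
    using slot[OF gen k] by (simp add: subspace_add subspace_scale)
qed

lemma (in linear_automorphism) rels_subset_free: "rels A S n i \<subseteq> carr (free (gens A S n i))"
proof -
  have sub: "subspace (factors A S i xs ! k)" if "(xs, us) \<in> gens A S n i" "k < length us" for xs us k
    using that by (auto simp: mem_gens less_Suc_eq_le intro: subspace_factors)
  show ?thesis
    unfolding rels_def
    by (rule free.span_minimal[OF _ subspace_free])
      (auto intro!: free.subspace_diff[OF subspace_free] free.subspace_scale[OF subspace_free]
        single_in_free gens_update subspace_add[OF sub] subspace_scale[OF sub])
qed


section \<open>The Hochschild-Mitchell complex of the orbit category\<close>

lemma nth_omit_obj: "j < length xs \<Longrightarrow> k < length xs - 1 \<Longrightarrow>
  omit_obj j xs ! k = xs ! (if k < j then k else Suc k)"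
  by (auto simp: omit_obj_def nth_append)

lemma omit_obj_tuple: "xs \<in> obj_tuples A (Suc n) \<Longrightarrow> j \<le> Suc n \<Longrightarrow> omit_obj j xs \<in> obj_tuples A n"
  by (rule obj_tuplesI) (auto simp: nth_omit_obj obj_tuplesD(1,2), simp add: omit_obj_def
    obj_tuplesD(1))

definition contract_at :: "nat \<Rightarrow> 'm \<Rightarrow> 'm list \<Rightarrow> 'm list" where
  "contract_at j w us = take j us @ w # drop (Suc (Suc j)) us"

lemma length_contract_at [simp]: "Suc j < length us \<Longrightarrow> length (contract_at j w us) = length us - 1"
  by (simp add: contract_at_def)

lemma nth_contract_at:
  "Suc j < length us \<Longrightarrow> k < length us - 1 \<Longrightarrow>
    contract_at j w us ! k = (if k < j then us ! k else if k = j then w else us ! Suc k)"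
  by (auto simp: contract_at_def nth_append nth_Cons')

section \<open>Faces of a generator and their multilinearity\<close>

context linear_automorphism
begin

text \<open>The coefficient \<open>u\<close> is entry 0 of the list and the morphisms start at entry
  1. With this numbering the term \<open>u f_0\<close> is the contraction of entries 0 and 1, of the
  same form as the inner terms.\<close>

definition face_cmp :: "int \<Rightarrow> nat \<Rightarrow> 'o list \<Rightarrow> 'm \<Rightarrow> 'm \<Rightarrow> 'm" where
  "face_cmp i j xs f g = (if j = 0 then ract A S i (last xs) (xs ! 0) (xs ! 1) f g
     else cmp A (xs ! (j + 1)) (xs ! j) (xs ! (j - 1)) f g)"

definition face :: "int \<Rightarrow> nat \<Rightarrow> ('o, 'm) gen \<Rightarrow> ('o, 'm) gen" where
  "face i j = (\<lambda>(xs, us). (omit_obj j xs, contract_at j (face_cmp i j xs (us ! j) (us ! Suc j)) us))"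

text \<open>The remaining term of the differential: the string is closed up cyclically and its last
  morphism acts on the coefficient from the left, so that slots \<open>0\<close> and
  \<open>Suc n\<close> are combined.\<close>

definition last_face :: "nat \<Rightarrow> int \<Rightarrow> ('o, 'm) gen \<Rightarrow> ('o, 'm) gen" where
  "last_face n i = (\<lambda>(xs, us). (butlast xs, lact A S i (last xs) (xs ! n) (hd xs) (us ! Suc n)
    (hd us) # tl (butlast us)))"

lemma face_eqs:
  assumes "length fs = Suc n"
  shows "face i 0 (xs, u # fs) = (tl xs, ract A S i (last xs) (xs ! 0) (xs ! 1) u (hd fs) # tl fs)"
    "1 \<le> j \<Longrightarrow> j \<le> n \<Longrightarrow> face i j (xs, u # fs) = (omit_obj j xs, u # merge A j xs fs)"
    "last_face n i (xs, u # fs) =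
      (butlast xs, lact A S i (last xs) (xs ! n) (hd xs) (last fs) u # butlast fs)"
proof -
  show "face i 0 (xs, u # fs) = (tl xs, ract A S i (last xs) (xs ! 0) (xs ! 1) u (hd fs) # tl fs)"
    using assms by (cases fs) (auto simp: face_def omit_obj_def contract_at_def face_cmp_def drop_Suc)
  show "face i j (xs, u # fs) = (omit_obj j xs, u # merge A j xs fs)" if "1 \<le> j" "j \<le> n"
    using that assms by (cases j) (auto simp: face_def merge_def contract_at_def face_cmp_def)
  show "last_face n i (xs, u # fs) =
      (butlast xs, lact A S i (last xs) (xs ! n) (hd xs) (last fs) u # butlast fs)"
    using assms by (cases fs) (auto simp: last_face_def last_conv_nth)
qed

lemma diff_gen_faces:
  assumes "g \<in> gens A S (Suc n) i"
  shows "diff_gen A S n i g = (\<Sum>j\<le>n. Poly_Mapping.single (face i j g) ((- 1) ^ j)) +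
    Poly_Mapping.single (last_face n i g) ((- 1) ^ (n + 1))"
proof -
  from assms obtain xs u fs where g: "g = (xs, u # fs)" and len: "length fs = Suc n"
    by (rule gens_cases)
  have "{..n} = insert 0 {1..n}" by auto
  then have "(\<Sum>j\<le>n. Poly_Mapping.single (face i j g) ((- 1 :: 'k) ^ j)) =
      Poly_Mapping.single (face i 0 g) 1 + (\<Sum>j=1..n. Poly_Mapping.single (face i j g) ((- 1) ^ j))"
    by simp
  moreover have "(\<Sum>j=1..n. Poly_Mapping.single (omit_obj j xs, u # merge A j xs fs) ((- 1 :: 'k) ^ j)) =
      (\<Sum>j=1..n. Poly_Mapping.single (face i j g) ((- 1) ^ j))"
    using face_eqs(2)[OF len] by (intro sum.cong) (auto simp: g)
  ultimately show ?thesis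
    using face_eqs(1,3)[OF len, of i xs u] by (simp add: diff_gen_def g)
qed

lemma face_cmp_in:
  assumes xs: "xs \<in> obj_tuples A (Suc n)" and j: "j \<le> n"
    and f: "f \<in> factors A S i xs ! j" and g: "g \<in> factors A S i xs ! Suc j"
  shows "face_cmp i j xs f g \<in> factors A S i (omit_obj j xs) ! j"
proof (cases j)
  case 0
  then show ?thesis
    using f g factors_0[OF omit_obj_tuple[OF xs], of 0 S i] factors_0[OF xs, of S i] factors_Suc[OF
      xs, of 0 S i] obj_tuplesD[OF xs]
    by (auto simp: face_cmp_def ract_def nth_omit_obj So_in intro!: cmp_in_hom)
next
  case (Suc j')
  then show ?thesis
    using f g j factors_Suc[OF omit_obj_tuple[OF xs, of j], of j' S i] factors_Suc[OF xs, of j' S i]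
      factors_Suc[OF xs, of j S i] obj_tuplesD[OF xs]
    by (auto simp: face_cmp_def nth_omit_obj intro!: cmp_in_hom)
qed

lemma face_cmp_linear:
  assumes xs: "xs \<in> obj_tuples A (Suc n)" and j: "j \<le> n"
    and f: "f \<in> factors A S i xs ! j" and g: "g \<in> factors A S i xs ! Suc j"
  shows "f' \<in> factors A S i xs ! j \<Longrightarrow> face_cmp i j xs (f + f') g =
    face_cmp i j xs f g + face_cmp i j xs f' g"
    "g' \<in> factors A S i xs ! Suc j \<Longrightarrow> face_cmp i j xs f (g + g') =
      face_cmp i j xs f g + face_cmp i j xs f g'"
    "face_cmp i j xs (smul A c f) g = smul A c (face_cmp i j xs f g)"
    "face_cmp i j xs f (smul A c g) = smul A c (face_cmp i j xs f g)"
proof -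
  \<comment> \<open>In both cases the contraction is a plain composition in \<open>A\<close>; for
    \<open>j = 0\<close> its codomain is the shifted object
    \<open>So A S i (last xs)\<close>.\<close>
  obtain x y z where *: "x \<in> obj A" "y \<in> obj A" "z \<in> obj A" "face_cmp i j xs = cmp A x y z"
    "factors A S i xs ! j = hom A y z" "factors A S i xs ! Suc j = hom A x y"
  proof (cases j)
    case 0
    show ?thesis
      by (rule that[of "xs ! 1" "xs ! 0" "So A S i (last xs)"])
        (use 0 factors_0[OF xs, of S i] factors_Suc[OF xs, of 0 S i] in
          \<open>auto simp: obj_tuplesD[OF xs] So_in face_cmp_def ract_def fun_eq_iff\<close>)
  next
    case (Suc j')
    show ?thesis
      by (rule that[of "xs ! Suc j" "xs ! j" "xs ! j'"])
        (use Suc j factors_Suc[OF xs, of j' S i] factors_Suc[OF xs, of j S i] in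
          \<open>auto simp: obj_tuplesD[OF xs] face_cmp_def fun_eq_iff\<close>)
  qed
  show "f' \<in> factors A S i xs ! j \<Longrightarrow> face_cmp i j xs (f + f') g =
    face_cmp i j xs f g + face_cmp i j xs f' g"
    "g' \<in> factors A S i xs ! Suc j \<Longrightarrow> face_cmp i j xs f (g + g') =
      face_cmp i j xs f g + face_cmp i j xs f g'"
    "face_cmp i j xs (smul A c f) g = smul A c (face_cmp i j xs f g)"
    "face_cmp i j xs f (smul A c g) = smul A c (face_cmp i j xs f g)"
    using f g *(1-3) unfolding *(4-6)
    by (simp_all add: cmp_add_left cmp_add_right cmp_smul_left cmp_smul_right)
qed

lemma factors_omit_obj:
  assumes xs: "xs \<in> obj_tuples A (Suc n)" and j: "j \<le> n" and k: "k \<le> n" "k \<noteq> j"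
  shows "factors A S i (omit_obj j xs) ! k = factors A S i xs ! (if k < j then k else Suc k)"
proof (cases k)
  case 0
  then show ?thesis
    using j k factors_0[OF omit_obj_tuple[OF xs, of j], of S i] factors_0[OF xs, of S i]
    by (simp add: nth_omit_obj obj_tuplesD(1)[OF xs])
next
  case (Suc k')
  then show ?thesis
    using j k factors_Suc[OF omit_obj_tuple[OF xs, of j], of k' S i] factors_Suc[OF xs, of k' S i]
      factors_Suc[OF xs, of k S i]
    by (auto simp: nth_omit_obj obj_tuplesD(1)[OF xs])
qed

lemma face_in_gens:
  assumes g: "(xs, us) \<in> gens A S (Suc n) i" and j: "j \<le> n"
  shows "face i j (xs, us) \<in> gens A S n i"
proof -
  have xs: "xs \<in> obj_tuples A (Suc n)" and len: "length us = Suc (Suc n)"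
    and us: "\<And>k. k \<le> Suc n \<Longrightarrow> us ! k \<in> factors A S i xs ! k"
    using g by (auto simp: mem_gens)
  have "contract_at j (face_cmp i j xs (us ! j) (us ! Suc j)) us ! k
    \<in> factors A S i (omit_obj j xs) ! k"
    if "k \<le> n" for k
    using that j us us[of "Suc k"] face_cmp_in[OF xs j us us] factors_omit_obj[OF xs j that, of i]
    by (simp add: nth_contract_at len)
  then show ?thesis
    using j omit_obj_tuple[OF xs, of j] by (auto simp: face_def mem_gens len)
qed

lemma multilinear_face:
  assumes j: "j \<le> n"
  shows "multilinear_mod A S (Suc n) i fscale (rels A S n i) (\<lambda>g. Poly_Mapping.single (face i j g)
    (a::'k))"
proof (rule multilinear_mod_singleI)
  fix xs us k assume g: "(xs, us) \<in> gens A S (Suc n) i" and k: "k \<le> Suc n"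
  have xs: "xs \<in> obj_tuples A (Suc n)" and len: "length us = Suc (Suc n)"
    and us: "\<And>k. k \<le> Suc n \<Longrightarrow> us ! k \<in> factors A S i xs ! k"
    using g by (auto simp: mem_gens)
  define ws where "ws = contract_at j (face_cmp i j xs (us ! j) (us ! Suc j)) us"
  \<comment> \<open>Slots \<open>j\<close> and \<open>Suc j\<close> both end up in slot
    \<open>j\<close> of the contracted list, and later slots move down by one.\<close>
  define l where "l = (if k \<le> j then k else k - 1)"
  define L where "L v = (if k = j then face_cmp i j xs v (us ! Suc j)
    else if k = Suc j then face_cmp i j xs (us ! j) v else v)" for v
  show "\<exists>ys ws l L. (ys, ws) \<in> gens A S n i \<and> l \<le> n \<and>
    (\<forall>v\<in>factors A S i xs ! k. L v \<in> factors A S i ys ! l \<and>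
      face i j (xs, us[k := v]) = (ys, ws[l := L v]) \<and>
       (\<forall>w\<in>factors A S i xs ! k. L (v + w) = L v + L w) \<and> (\<forall>c. L (smul A c v) = smul A c (L v)))"
  proof (rule exI[of _ "omit_obj j xs"], rule exI[of _ ws], rule exI[of _ l], rule exI[of _ L],
    intro conjI ballI allI)
    show "(omit_obj j xs, ws) \<in> gens A S n i"
      using face_in_gens[OF g j] by (simp add: face_def ws_def)
    show l: "l \<le> n" using k j by (auto simp: l_def)
    fix v assume v: "v \<in> factors A S i xs ! k"
    show "L v \<in> factors A S i (omit_obj j xs) ! l"
      using v j k us[of j] us[of "Suc j"] face_cmp_in[OF xs j, where i =
        i] factors_omit_obj[OF xs j l, of i]
      by (auto simp: L_def l_def)
    have "contract_at j (face_cmp i j xs (us[k := v] ! j) (us[k := v] ! Suc j)) (us[k := v]) =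
      ws[l := L v]"
      by (rule nth_equalityI) (use j k in \<open>auto simp: len ws_def nth_contract_at l_def L_def
        nth_list_update\<close>)
    then show "face i j (xs, us[k := v]) = (omit_obj j xs, ws[l := L v])"
      by (simp add: face_def)
    show "L (v + w) = L v + L w" if "w \<in> factors A S i xs ! k" for w
      using v that j us[of j] us[of "Suc j"] by (auto simp: L_def face_cmp_linear[OF xs j])
    show "L (smul A c v) = smul A c (L v)" for c
      using v j us[of j] us[of "Suc j"] by (auto simp: L_def face_cmp_linear[OF xs j])
  qed
qed

lemma lact_in:
  assumes "x \<in> obj A" "x' \<in> obj A" "y \<in> obj A" "f \<in> hom A x x'" "u \<in> hom A y (So A S i x)"
  shows "lact A S i x x' y f u \<in> hom A y (So A S i x')"
  using assms by (auto simp: lact_def So_in Sa_in intro!: cmp_in_hom)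

lemma lact_linear:
  assumes "x \<in> obj A" "x' \<in> obj A" "y \<in> obj A" "f \<in> hom A x x'" "u \<in> hom A y (So A S i x)"
  shows "f' \<in> hom A x x' \<Longrightarrow> lact A S i x x' y (f + f') u =
    lact A S i x x' y f u + lact A S i x x' y f' u"
    "u' \<in> hom A y (So A S i x) \<Longrightarrow> lact A S i x x' y f (u + u') =
      lact A S i x x' y f u + lact A S i x x' y f u'"
    "lact A S i x x' y (smul A c f) u = smul A c (lact A S i x x' y f u)"
    "lact A S i x x' y f (smul A c u) = smul A c (lact A S i x x' y f u)"
  using assms by (simp_all add: lact_def So_in Sa_in Sa_add Sa_smul cmp_add_left cmp_add_right
    cmp_smul_left cmp_smul_right)

lemma factors_butlast:
  assumes xs: "xs \<in> obj_tuples A (Suc n)" and k: "k \<le> n"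
  shows "factors A S i (butlast xs) ! k = (if k =
    0 then hom A (xs ! 0) (So A S i (xs ! n)) else factors A S i xs ! k)"
proof -
  have ys: "butlast xs \<in> obj_tuples A n"
    by (rule obj_tuplesI) (simp_all add: nth_butlast obj_tuplesD[OF xs])
  show ?thesis
    using k factors_0[OF ys, of S i] factors_Suc[OF ys, of _ S i] factors_Suc[OF xs, of _ S i]
    by (cases k) (simp_all add: nth_butlast obj_tuplesD[OF xs])
qed

lemma last_face_in_gens:
  assumes g: "(xs, us) \<in> gens A S (Suc n) i"
  shows "last_face n i (xs, us) \<in> gens A S n i"
proof -
  have xs: "xs \<in> obj_tuples A (Suc n)" and len: "length us = Suc (Suc n)"
    and us: "\<And>k. k \<le> Suc n \<Longrightarrow> us ! k \<in> factors A S i xs ! k"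
    using g by (auto simp: mem_gens)
  have ys: "butlast xs \<in> obj_tuples A n"
    by (rule obj_tuplesI) (simp_all add: nth_butlast obj_tuplesD[OF xs])
  have hd: "hd us = us ! 0" using len by (simp add: hd_conv_nth flip: length_greater_0_conv)
  have "lact A S i (last xs) (xs ! n) (hd xs) (us ! Suc n) (hd us) \<in> hom A (xs ! 0) (So A S i (xs ! n))"
    using us[of 0] us[of "Suc n"] factors_0[OF xs, of S i] factors_Suc[OF xs, of n S i] hd
    by (auto simp: obj_tuplesD[OF xs] intro!: lact_in)
  moreover have "tl (butlast us) ! (k - 1) \<in> factors A S i xs ! k" if "k \<noteq> 0" "k \<le> n" for k
    using us[of k] that by (simp add: nth_tl nth_butlast len)
  ultimately show ?thesis
    using ys by (auto simp: last_face_def mem_gens len factors_butlast[OF xs] nth_Cons')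
qed

lemma multilinear_last_face:
  "multilinear_mod A S (Suc n) i fscale (rels A S n i) (\<lambda>g. Poly_Mapping.single (last_face n i g)
    (a::'k))"
proof (rule multilinear_mod_singleI)
  fix xs us k assume g: "(xs, us) \<in> gens A S (Suc n) i" and k: "k \<le> Suc n"
  have xs: "xs \<in> obj_tuples A (Suc n)" and len: "length us = Suc (Suc n)"
    and us: "\<And>k. k \<le> Suc n \<Longrightarrow> us ! k \<in> factors A S i xs ! k"
    using g by (auto simp: mem_gens)
  have hd_us: "hd vs = vs ! 0" if "length vs = Suc (Suc n)" for vs :: "'m list"
    using that by (simp add: hd_conv_nth flip: length_greater_0_conv)
  define act where "act = lact A S i (last xs) (xs ! n) (hd xs)"
  note xs_simps [simp] = obj_tuplesD[OF xs]
  have u0: "us ! 0 \<in> hom A (xs ! 0) (So A S i (xs ! Suc n))"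
    and un: "us ! Suc n \<in> hom A (xs ! Suc n) (xs ! n)"
    using us[of 0] us[of "Suc n"] factors_0[OF xs, of S i] factors_Suc[OF xs, of n S i] by auto
  define ws where "ws = act (us ! Suc n) (us ! 0) # tl (butlast us)"
  \<comment> \<open>The last morphism is absorbed into the coefficient, so slot \<open>Suc n\<close>
    ends up in slot \<open>0\<close>.\<close>
  define l where "l = (if k = Suc n then 0 else k)"
  define L where "L v = (if k = 0 then act (us ! Suc n) v
    else if k = Suc n then act v (us ! 0) else v)" for v
  show "\<exists>ys ws l L. (ys, ws) \<in> gens A S n i \<and> l \<le> n \<and>
    (\<forall>v\<in>factors A S i xs ! k. L v \<in> factors A S i ys ! l \<and>
      last_face n i (xs, us[k := v]) = (ys, ws[l := L v]) \<and>
       (\<forall>w\<in>factors A S i xs ! k. L (v + w) = L v + L w) \<and> (\<forall>c. L (smul A c v) = smul A c (L v)))"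
  proof (rule exI[of _ "butlast xs"], rule exI[of _ ws], rule exI[of _ l], rule exI[of _ L], intro
    conjI ballI allI)
    show "(butlast xs, ws) \<in> gens A S n i"
      using last_face_in_gens[OF g] by (simp add: last_face_def ws_def act_def hd_us len)
    show l: "l \<le> n" using k by (auto simp: l_def)
    fix v assume v: "v \<in> factors A S i xs ! k"
    have v0: "v \<in> hom A (xs ! 0) (So A S i (xs ! Suc n))" if "k = 0"
      using v that factors_0[OF xs, of S i] by simp
    have vn: "v \<in> hom A (xs ! Suc n) (xs ! n)" if "k = Suc n"
      using v that factors_Suc[OF xs, of n S i] by simp
    show "L v \<in> factors A S i (butlast xs) ! l"
      using v v0 vn u0 un k factors_butlast[OF xs l, of i]
      by (auto simp: L_def l_def act_def intro!: lact_in)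
    have "act (us[k := v] ! Suc n) (us[k := v] ! 0) # tl (butlast (us[k := v])) = ws[l := L v]"
      by (rule nth_equalityI)
        (use k in \<open>auto simp: len ws_def l_def L_def nth_list_update nth_Cons' nth_tl nth_butlast
          split: nat.split\<close>)
    then show "last_face n i (xs, us[k := v]) = (butlast xs, ws[l := L v])"
      by (simp add: last_face_def act_def hd_us len)
    show "L (v + w) = L v + L w" if "w \<in> factors A S i xs ! k" for w
    proof -
      have w0: "w \<in> hom A (xs ! 0) (So A S i (xs ! Suc n))" if "k = 0"
        using \<open>w \<in> _\<close> that factors_0[OF xs, of S i] by simp
      have wn: "w \<in> hom A (xs ! Suc n) (xs ! n)" if "k = Suc n"
        using \<open>w \<in> _\<close> that factors_Suc[OF xs, of n S i] by simp
      show ?thesis using v0 vn w0 wn u0 un by (auto simp: L_def act_def lact_linear)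
    qed
    show "L (smul A c v) = smul A c (L v)" for c
      using v0 vn u0 un by (auto simp: L_def act_def lact_linear)
  qed
qed

section \<open>The differential on representatives\<close>

abbreviation Free :: "nat \<Rightarrow> int \<Rightarrow> (('o, 'm) gen \<Rightarrow>\<^sub>0 'k) set" where
  "Free n i \<equiv> carr (free (gens A S n i))"

abbreviation D :: "nat \<Rightarrow> int \<Rightarrow> (('o, 'm) gen \<Rightarrow>\<^sub>0 'k) \<Rightarrow> (('o, 'm) gen \<Rightarrow>\<^sub>0 'k)" where
  "D n i \<equiv> linext fscale (diff_gen A S n i)"

text \<open>Updating a generator by an element of the same factor yields a generator, so agreement
  on \<open>gens\<close> suffices. \<open>diff_gen\<close> is identified with a sum of faces only
  there.\<close>

lemma multilinear_mod_cong:
  assumes "multilinear_mod A S n i s R \<phi>" "\<And>g. g \<in> gens A S n i \<Longrightarrow> \<psi> g = \<phi> g"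
  shows "multilinear_mod A S n i s R \<psi>"
  unfolding multilinear_mod_def
proof (intro allI impI conjI ballI)
  fix xs us k v assume gen: "(xs, us) \<in> gens A S n i" and k: "k \<le> n" and v: "v \<in> factors A S i xs ! k"
  have sub: "subspace (factors A S i xs ! k)"
    using gen k by (auto simp: mem_gens intro: subspace_factors)
  note eq = assms(2)[OF gens_update[OF gen]]
  show "\<psi> (xs, us[k := v + w]) - \<psi> (xs, us[k := v]) - \<psi> (xs, us[k := w]) \<in> R"
    if "w \<in> factors A S i xs ! k" for w
    using multilinear_modD(1)[OF assms(1) gen k v that] by (simp add: eq v that subspace_add[OF sub])
  show "\<psi> (xs, us[k := smul A c v]) - s c (\<psi> (xs, us[k := v])) \<in> R" for c
    using multilinear_modD(2)[OF assms(1) gen k v, of c] by (simp add: eq v subspace_scale[OF sub])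
qed

lemma multilinear_diff: "multilinear_mod A S (Suc n) i fscale (rels A S n i) (diff_gen A S n i)"
  by (rule multilinear_mod_cong[OF multilinear_mod_add[OF free.vector_space_axioms subspace_rels
      multilinear_mod_sum[OF free.vector_space_axioms subspace_rels multilinear_face]
        multilinear_last_face]])
    (auto simp: diff_gen_faces)

lemma D_linear: "Vector_Spaces.linear fscale fscale (D n i)"
  by (rule linext_linear[OF free.vector_space_axioms])

lemma D_rels: "r \<in> rels A S (Suc n) i \<Longrightarrow> D n i r \<in> rels A S n i"
  by (rule multilinear_mod_linext[OF free.vector_space_axioms subspace_rels multilinear_diff])

lemma D_Free:
  assumes "c \<in> Free (Suc n) i"
  shows "D n i c \<in> Free n i"
proof (rule linear_free_in_subspace[OF D_linear subspace_free _ assms])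
  fix g assume g: "g \<in> gens A S (Suc n) i"
  obtain xs us where "g = (xs, us)" by (cases g)
  with g show "D n i (Poly_Mapping.single g 1) \<in> Free n i"
    by (auto simp: linext_single[OF free.vector_space_axioms] diff_gen_faces
      intro!: free.subspace_add[OF subspace_free] free.subspace_sum[OF subspace_free] single_in_free
        face_in_gens last_face_in_gens)
qed

lemma nth_face:
  assumes "length us = Suc (Suc n)" "j \<le> n" "k \<le> n"
  shows "snd (face i j (xs, us)) ! k =
    (if k < j then us ! k else if k = j then face_cmp i j xs (us ! j) (us ! Suc j) else us ! Suc k)"
  using assms by (simp add: face_def nth_contract_at)

lemma nth_last_face:
  assumes "length us = Suc (Suc n)" "k \<le> n"
  shows "snd (last_face n i (xs, us)) ! k =
    (if k = 0 then lact A S i (last xs) (xs ! n) (hd xs) (us ! Suc n) (us ! 0) else us ! k)"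
  using assms by (cases us) (auto simp: last_face_def nth_Cons' nth_tl nth_butlast)

lemma length_faces:
  assumes "length us = Suc (Suc n)"
  shows "j \<le> n \<Longrightarrow> length (snd (face i j (xs, us))) = Suc n" "length (snd (last_face n i (xs, us))) =
    Suc n"
  using assms by (simp_all add: face_def last_face_def)

lemma fst_faces: "fst (face i j (xs, us)) = omit_obj j xs" "fst (last_face n i (xs, us)) = butlast xs"
  by (simp_all add: face_def last_face_def)

lemma butlast_tuple: "xs \<in> obj_tuples A (Suc n) \<Longrightarrow> butlast xs \<in> obj_tuples A n"
  by (rule obj_tuplesI) (simp_all add: nth_butlast obj_tuplesD(1,2))

text \<open>For \<open>k = Suc j\<close> the identity is associativity in \<open>A\<close>, with the
  coefficient as one factor if \<open>j = 0\<close>; for larger \<open>k\<close> the two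
  contractions involve disjoint entries.\<close>

lemma face_face:
  assumes g: "(xs, us) \<in> gens A S (Suc (Suc n)) i" and jk: "j < k" "k \<le> Suc n"
  shows "face i j (face i k (xs, us)) = face i (k - 1) (face i j (xs, us))"
proof -
  have xs: "xs \<in> obj_tuples A (Suc (Suc n))" and len: "length us = Suc (Suc (Suc n))"
    and us: "\<And>l. l \<le> Suc (Suc n) \<Longrightarrow> us ! l \<in> factors A S i xs ! l"
    using g by (auto simp: mem_gens)
  note ob = obj_tuplesD[OF xs]
  have tup: "omit_obj l xs \<in> obj_tuples A (Suc n)" if "l \<le> Suc n" for l
    using omit_obj_tuple[OF xs] that by simp
  have nth_omit: "omit_obj l xs ! m = xs ! (if m < l then m else Suc m)"
    if "l \<le> Suc n" "m \<le> Suc n" for l m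
    using that by (simp add: nth_omit_obj ob(1))
  have last_omit: "last (omit_obj l xs) = last xs" if "l \<le> Suc n" for l
    using obj_tuplesD(4)[OF tup[OF that]] nth_omit[OF that] that by (simp add: ob(4))
  have objs: "omit_obj j (omit_obj k xs) = omit_obj (k - 1) (omit_obj j xs)"
  proof (rule nth_equalityI)
    have len: "length (omit_obj j (omit_obj k xs)) =
      Suc n" "length (omit_obj (k - 1) (omit_obj j xs)) = Suc n"
      using obj_tuplesD(1)[OF omit_obj_tuple[OF tup]] jk by simp_all
    then show "length (omit_obj j (omit_obj k xs)) = length (omit_obj (k - 1) (omit_obj j xs))" by simp
    fix l assume "l < length (omit_obj j (omit_obj k xs))"
    then have "l \<le> n" by (simp add: len)
    then show "omit_obj j (omit_obj k xs) ! l = omit_obj (k - 1) (omit_obj j xs) ! l"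
      using jk obj_tuplesD(1)[OF tup[of j]] obj_tuplesD(1)[OF tup[of k]]
        by (auto simp: nth_omit_obj[of _ "omit_obj _ _"] nth_omit)
  qed
  have assoc: "face_cmp i j (omit_obj (Suc j) xs) (us ! j) (face_cmp i (Suc j) xs (us ! Suc j)
    (us ! Suc (Suc j))) =
      face_cmp i j (omit_obj j xs) (face_cmp i j xs (us ! j) (us ! Suc j)) (us ! Suc (Suc j))"
        if k: "k = Suc j"
  proof (cases j)
    case 0
    have "us ! 0 \<in> hom A (xs ! 0) (So A S i (last xs))" "us ! 1 \<in> hom A (xs ! 1) (xs ! 0)" "us ! 2
      \<in> hom A (xs ! 2) (xs ! 1)"
      using us[of 0] us[of 1] us[of 2] factors_0[OF xs, of S i] factors_Suc[OF xs, of _ S i] ob(4)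
      by (simp_all add: numeral_2_eq_2)
    then show ?thesis
      using jk k nth_omit[of 0] nth_omit[of 1] last_omit[of 0] last_omit[of 1] ob(2)[of 0] ob(2)[of
        1] ob(2)[of 2] ob(6)
      by (simp add: 0 face_cmp_def ract_def cmp_assoc So_in numeral_2_eq_2)
  next
    case (Suc j')
    have "us ! Suc j' \<in> hom A (xs ! Suc j') (xs ! j')" "us ! Suc (Suc j')
      \<in> hom A (xs ! Suc (Suc j')) (xs ! Suc j')"
      "us ! Suc (Suc (Suc j')) \<in> hom A (xs ! Suc (Suc (Suc j'))) (xs ! Suc (Suc j'))"
      using us[of "Suc j'"] us[of "Suc (Suc j')"] us[of "Suc (Suc
        (Suc j'))"] factors_Suc[OF xs, of _ S i] jk k Suc by auto
    then show ?thesis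
      using jk k Suc nth_omit[of "Suc j'"] nth_omit[of "Suc (Suc j')"] ob(2)[of j'] ob(2)[of "Suc j'"]
        ob(2)[of "Suc (Suc j')"] ob(2)[of "Suc (Suc (Suc j'))"]
      by (simp add: face_cmp_def cmp_assoc)
  qed
  have far: "face_cmp i j (omit_obj k xs) = face_cmp i j xs" "face_cmp i (k - 1) (omit_obj j xs) =
    face_cmp i k xs"
    if "Suc j < k"
  proof -
    have "Suc (k - Suc (Suc 0)) = k - Suc 0" using that by simp
    then show "face_cmp i j (omit_obj k xs) = face_cmp i j xs" "face_cmp i (k - 1) (omit_obj j xs) =
      face_cmp i k xs"
      using that jk nth_omit[of k] nth_omit[of j] last_omit[of k]
        by (auto simp: face_cmp_def fun_eq_iff)
  qed
  have "snd (face i j (face i k (xs, us))) = snd (face i (k - 1) (face i j (xs, us)))"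
  proof (rule nth_equalityI)
    have lens: "length (snd (face i l (xs, us))) = Suc (Suc n)" if "l \<le> Suc n" for l
      using length_faces(1)[of us "Suc n"] len that by simp
    obtain vs where vs: "face i k (xs, us) = (omit_obj k xs, vs)" "vs = snd (face i k (xs, us))"
      by (cases "face i k (xs, us)") (metis fst_faces(1) fst_conv snd_conv)
    obtain ws where ws: "face i j (xs, us) = (omit_obj j xs, ws)" "ws = snd (face i j (xs, us))"
      by (cases "face i j (xs, us)") (metis fst_faces(1) fst_conv snd_conv)
    have lvs: "length vs = Suc (Suc n)" "length ws = Suc (Suc n)" using vs ws lens jk by auto
    show "length (snd (face i j (face i k (xs, us)))) =
      length (snd (face i (k - 1) (face i j (xs, us))))"
      unfolding vs(1) ws(1) using length_faces(1)[OF lvs(1)] length_faces(1)[OF lvs(2)] jk by simp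
    fix l assume "l < length (snd (face i j (face i k (xs, us))))"
    then have l: "l \<le> n" unfolding vs(1) using length_faces(1)[OF lvs(1), of j] jk by simp
    have v: "vs ! m = (if m < k then us ! m else
      if m = k then face_cmp i k xs (us ! k) (us ! Suc k) else us ! Suc m)"
      if "m \<le> Suc n" for m unfolding vs(2) using nth_face[OF len jk(2) that] .
    have w: "ws ! m = (if m < j then us ! m else
      if m = j then face_cmp i j xs (us ! j) (us ! Suc j) else us ! Suc m)"
      if "m \<le> Suc n" for m unfolding ws(2) using nth_face[OF len _ that, of j] jk by simp
    show "snd (face i j (face i k (xs, us))) ! l = snd (face i (k - 1) (face i j (xs, us))) ! l"
    proof (cases "k = Suc j")
      case True
      then have kj: "k - 1 = j" and j: "j \<le> n" using jk by auto
      show ?thesis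
        unfolding vs(1) ws(1) kj nth_face[OF lvs(1) j l] nth_face[OF lvs(2) j l]
        using l j assoc[OF True] v w unfolding True by auto
    next
      case False
      then have "Suc j < k" using jk by simp
      then show ?thesis
        unfolding vs(1) ws(1) using nth_face[OF lvs(1) _ l, of j] nth_face[OF lvs(2) _ l, of "k -
          1"] jk l v w
          far[OF \<open>Suc j < k\<close>]
        by auto
    qed
  qed
  then show ?thesis using objs by (simp add: prod_eq_iff) (simp add: face_def case_prod_beta)
qed

text \<open>For \<open>j = 0\<close> this is the bimodule law \<open>(f u) g = f (u g)\<close>; for
  \<open>j > 0\<close> the inner contraction meets neither the coefficient nor the last
  morphism.\<close>

lemma face_last_face:
  assumes g: "(xs, us) \<in> gens A S (Suc (Suc n)) i" and j: "j \<le> n"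
  shows "face i j (last_face (Suc n) i (xs, us)) = last_face n i (face i j (xs, us))"
proof -
  have xs: "xs \<in> obj_tuples A (Suc (Suc n))" and len: "length us = Suc (Suc (Suc n))"
    and us: "\<And>l. l \<le> Suc (Suc n) \<Longrightarrow> us ! l \<in> factors A S i xs ! l"
    using g by (auto simp: mem_gens)
  note ob = obj_tuplesD[OF xs]
  have ys: "butlast xs \<in> obj_tuples A (Suc n)" and zs: "omit_obj j xs \<in> obj_tuples A (Suc n)"
    using butlast_tuple[OF xs] omit_obj_tuple[OF xs, of j] j by simp_all
  note oby = obj_tuplesD[OF ys] and obz = obj_tuplesD[OF zs]
  have nth_omit: "omit_obj j xs ! m = xs ! (if m < j then m else Suc m)" if "m \<le> Suc n" for m
    using that j by (simp add: nth_omit_obj ob(1))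
  have nth_but: "butlast xs ! m = xs ! m" if "m \<le> Suc n" for m
    using that by (simp add: nth_butlast ob(1))
  have objs: "omit_obj j (butlast xs) = butlast (omit_obj j xs)"
  proof (rule nth_equalityI)
    have len: "length (omit_obj j (butlast xs)) = Suc n" "length (butlast (omit_obj j xs)) = Suc n"
      using obj_tuplesD(1)[OF omit_obj_tuple[OF ys]] obj_tuplesD(1)[OF butlast_tuple[OF zs]] j
        by simp_all
    then show "length (omit_obj j (butlast xs)) = length (butlast (omit_obj j xs))" by simp
    fix l assume "l < length (omit_obj j (butlast xs))"
    then have "l \<le> n" by (simp add: len)
    then show "omit_obj j (butlast xs) ! l = butlast (omit_obj j xs) ! l"
      using j oby(1) obz(1) by (auto simp: nth_omit_obj[of _ "butlast _"] nth_butlast[of _ "omit_obj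
        _ _"] nth_omit nth_but)
  qed
  have u: "us ! 0 \<in> hom A (xs ! 0) (So A S i (xs ! Suc (Suc n)))" "us ! 1 \<in> hom A (xs ! 1) (xs ! 0)"
    "us ! Suc (Suc n) \<in> hom A (xs ! Suc (Suc n)) (xs ! Suc n)"
    using us[of 0] us[of 1] us[of "Suc (Suc n)"] factors_0[OF xs, of S i] factors_Suc[OF xs, of _ S
      i] by simp_all
  have bimod: "ract A S i (xs ! Suc n) (xs ! 0) (xs ! 1) (lact A S i (xs ! Suc (Suc n)) (xs ! Suc n)
    (xs ! 0) (us ! Suc (Suc n)) (us ! 0)) (us ! 1) =
      lact A S i (xs ! Suc (Suc n)) (xs ! Suc n) (xs ! 1) (us ! Suc (Suc n)) (ract A S i (xs ! Suc
        (Suc n)) (xs ! 0) (xs ! 1) (us ! 0) (us ! 1))"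
    using u ob(2)[of 0] ob(2)[of 1] ob(2)[of "Suc n"] ob(2)[of "Suc (Suc n)"]
      by (simp add: ract_def lact_def cmp_assoc So_in Sa_in)
  obtain vs where vs: "last_face (Suc n) i (xs, us) = (butlast xs, vs)" "vs =
    snd (last_face (Suc n) i (xs, us))"
    by (cases "last_face (Suc n) i (xs, us)") (metis fst_faces(2) fst_conv snd_conv)
  obtain ws where ws: "face i j (xs, us) = (omit_obj j xs, ws)" "ws = snd (face i j (xs, us))"
    by (cases "face i j (xs, us)") (metis fst_faces(1) fst_conv snd_conv)
  have lvs: "length vs = Suc (Suc n)" "length ws = Suc (Suc n)"
    using vs ws length_faces[OF len] j by auto
  have v: "vs ! m = (if m = 0 then lact A S i (xs ! Suc (Suc n)) (xs ! Suc n) (xs ! 0) (us ! Suc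
    (Suc n)) (us ! 0) else us ! m)"
    if "m \<le> Suc n" for m unfolding vs(2) using nth_last_face[OF len that] by (simp add: ob(3,4))
  have w: "ws ! m = (if m < j then us ! m else
    if m = j then face_cmp i j xs (us ! j) (us ! Suc j) else us ! Suc m)"
    if "m \<le> Suc n" for m unfolding ws(2) using nth_face[OF len _ that, of j] j by simp
  have far: "face_cmp i j (butlast xs) = face_cmp i j xs" if "j \<noteq> 0"
    using that j by (auto simp: face_cmp_def fun_eq_iff nth_but)
  have "snd (face i j (last_face (Suc n) i (xs, us))) = snd (last_face n i (face i j (xs, us)))"
    unfolding vs(1) ws(1)
  proof (rule nth_equalityI)
    show "length (snd (face i j (butlast xs, vs))) = length (snd (last_face n i (omit_obj j xs, ws)))"
      using length_faces[OF lvs(1)] length_faces[OF lvs(2)] j by simp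
    fix l assume "l < length (snd (face i j (butlast xs, vs)))"
    then have l: "l \<le> n" using length_faces(1)[OF lvs(1) j] by simp
    show "snd (face i j (butlast xs, vs)) ! l = snd (last_face n i (omit_obj j xs, ws)) ! l"
    proof (cases "j = 0")
      case True
      then show ?thesis
        unfolding nth_face[OF lvs(1) j l] nth_last_face[OF lvs(2) l]
        using l bimod v w nth_omit nth_but by
          (auto simp: face_cmp_def oby(3,4) obz(3,4)[unfolded True] ob(3,4))
    next
      case False
      then show ?thesis
        unfolding nth_face[OF lvs(1) j l] nth_last_face[OF lvs(2) l]
        using l j v w nth_omit nth_but far by (auto simp: oby(3,4) obz(3,4) ob(3,4))
    qed
  qed
  then show ?thesis using objs by (simp add: prod_eq_iff)
    (simp add: face_def last_face_def case_prod_beta)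
qed

text \<open>Acting by the last morphism and then by the one before it is acting by their composite,
  which rests on the functoriality of \<open>\<Sigma>^i\<close>.\<close>

lemma last_face_last_face:
  assumes g: "(xs, us) \<in> gens A S (Suc (Suc n)) i"
  shows "last_face n i (last_face (Suc n) i (xs, us)) = last_face n i (face i (Suc n) (xs, us))"
proof -
  have xs: "xs \<in> obj_tuples A (Suc (Suc n))" and len: "length us = Suc (Suc (Suc n))"
    and us: "\<And>l. l \<le> Suc (Suc n) \<Longrightarrow> us ! l \<in> factors A S i xs ! l"
    using g by (auto simp: mem_gens)
  note ob = obj_tuplesD[OF xs]
  have ys: "butlast xs \<in> obj_tuples A (Suc n)" and zs: "omit_obj (Suc n) xs \<in> obj_tuples A (Suc n)"
    using butlast_tuple[OF xs] omit_obj_tuple[OF xs, of "Suc n"] by simp_all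
  note oby = obj_tuplesD[OF ys] and obz = obj_tuplesD[OF zs]
  have nth_omit: "omit_obj (Suc n) xs ! m = xs ! (if m < Suc n then m else Suc m)" if "m \<le> Suc n" for m
    using that by (simp add: nth_omit_obj ob(1))
  have nth_but: "butlast xs ! m = xs ! m" if "m \<le> Suc n" for m
    using that by (simp add: nth_butlast ob(1))
  have objs: "butlast (butlast xs) = butlast (omit_obj (Suc n) xs)"
    using obj_tuplesD(1)[OF butlast_tuple[OF ys]] obj_tuplesD(1)[OF butlast_tuple[OF zs]] oby(1) obz(1)
    by (intro nth_equalityI) (auto simp: nth_butlast[of _ "butlast _"] nth_butlast[of _ "omit_obj _
      _"] nth_omit nth_but)
  have u: "us ! 0 \<in> hom A (xs ! 0) (So A S i (xs ! Suc (Suc n)))" "us ! Suc n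
    \<in> hom A (xs ! Suc n) (xs ! n)"
    "us ! Suc (Suc n) \<in> hom A (xs ! Suc (Suc n)) (xs ! Suc n)"
    using us[of 0] us[of "Suc n"] us[of "Suc (Suc n)"] factors_0[OF xs, of S i] factors_Suc[OF xs,
      of _ S i] by simp_all
  have act: "lact A S i (xs ! Suc n) (xs ! n) (xs ! 0) (us ! Suc n) (lact A S i (xs ! Suc (Suc n))
    (xs ! Suc n) (xs ! 0) (us ! Suc (Suc n)) (us ! 0)) =
      lact A S i (xs ! Suc (Suc n)) (xs ! n) (xs ! 0) (cmp A (xs ! Suc (Suc n)) (xs ! Suc n)
        (xs ! n) (us ! Suc n) (us ! Suc (Suc n))) (us ! 0)"
    using u ob(2)[of 0] ob(2)[of n] ob(2)[of "Suc n"] ob(2)[of "Suc (Suc n)"]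
      by (simp add: lact_def cmp_assoc So_in Sa_in Sa_cmp)
  obtain vs where vs: "last_face (Suc n) i (xs, us) = (butlast xs, vs)" "vs =
    snd (last_face (Suc n) i (xs, us))"
    by (cases "last_face (Suc n) i (xs, us)") (metis fst_faces(2) fst_conv snd_conv)
  obtain ws where ws: "face i (Suc n) (xs, us) = (omit_obj (Suc n) xs, ws)" "ws =
    snd (face i (Suc n) (xs, us))"
    by (cases "face i (Suc n) (xs, us)") (metis fst_faces(1) fst_conv snd_conv)
  have lvs: "length vs = Suc (Suc n)" "length ws = Suc (Suc n)"
    using vs ws length_faces[OF len] by auto
  have v: "vs ! m = (if m = 0 then lact A S i (xs ! Suc (Suc n)) (xs ! Suc n) (xs ! 0) (us ! Suc
    (Suc n)) (us ! 0) else us ! m)"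
    if "m \<le> Suc n" for m unfolding vs(2) using nth_last_face[OF len that] by (simp add: ob(3,4))
  have w: "ws ! m = (if m < Suc n then us ! m else cmp A (xs ! Suc (Suc n)) (xs ! Suc n) (xs ! n)
    (us ! Suc n) (us ! Suc (Suc n)))"
    if "m \<le> Suc n" for m unfolding ws(2) using nth_face[OF len _ that, of "Suc n" i xs] that
      by (simp add: face_cmp_def)
  have "snd (last_face n i (last_face (Suc n) i (xs, us))) =
    snd (last_face n i (face i (Suc n) (xs, us)))"
    unfolding vs(1) ws(1)
  proof (rule nth_equalityI)
    show "length (snd (last_face n i (butlast xs, vs))) =
      length (snd (last_face n i (omit_obj (Suc n) xs, ws)))"
      using length_faces[OF lvs(1)] length_faces[OF lvs(2)] by simp
    fix l assume "l < length (snd (last_face n i (butlast xs, vs)))"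
    then have l: "l \<le> n" using length_faces(2)[OF lvs(1)] by simp
    show "snd (last_face n i (butlast xs, vs)) ! l = snd (last_face n i (omit_obj (Suc n) xs, ws)) ! l"
      unfolding nth_last_face[OF lvs(1) l] nth_last_face[OF lvs(2) l]
      using l act v w nth_omit nth_but by (auto simp: oby(3,4) obz(3,4))
  qed
  then show ?thesis using objs by (simp add: prod_eq_iff)
    (simp add: face_def last_face_def case_prod_beta)
qed

text \<open>All faces in one family, so that the simplicial identities take their usual form.\<close>

definition any_face :: "nat \<Rightarrow> int \<Rightarrow> nat \<Rightarrow> ('o, 'm) gen \<Rightarrow> ('o, 'm) gen" where
  "any_face n i j = (if j \<le> n then face i j else last_face n i)"

lemma any_face_in_gens: "g \<in> gens A S (Suc n) i \<Longrightarrow> any_face n i j g \<in> gens A S n i"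
  by (cases g) (simp add: any_face_def face_in_gens last_face_in_gens)

lemma diff_gen_any_face:
  "g \<in> gens A S (Suc n) i \<Longrightarrow>
    diff_gen A S n i g = (\<Sum>j\<le>Suc n. Poly_Mapping.single (any_face n i j g) ((- 1) ^ j))"
  by (simp add: diff_gen_faces any_face_def)

lemma any_face_any_face:
  assumes "g \<in> gens A S (Suc (Suc n)) i" "j < k" "k \<le> Suc (Suc n)"
  shows "any_face n i j (any_face (Suc n) i k g) = any_face n i (k - 1) (any_face (Suc n) i j g)"
proof -
  obtain xs us where g: "g = (xs, us)" by (cases g)
  consider "k \<le> Suc n" | "k = Suc (Suc n)" "j \<le> n" | "k = Suc (Suc n)" "j = Suc n"
    using assms by linarith
  then show ?thesis
    using assms face_face[of xs us n i j k] face_last_face[of xs us n i j] last_face_last_face[of xs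
      us n i]
    by cases (auto simp: any_face_def g)
qed

text \<open>The face identities hold for the generators themselves, so the square vanishes already
  in the free space and not only modulo \<open>rels\<close>.\<close>

lemma D_D:
  assumes "c \<in> Free (Suc (Suc n)) i"
  shows "D n i (D (Suc n) i c) = 0"
proof -
  interpret l: Vector_Spaces.linear fscale fscale "D n i" by (rule D_linear)
  note single = linext_single[OF free.vector_space_axioms]
  have "(D n i \<circ> D (Suc n) i) c \<in> {0}"
  proof (rule linear_free_in_subspace[OF linear_comp[OF D_linear D_linear] free.subspace_single_0 _
    assms])
    fix g assume g: "g \<in> gens A S (Suc (Suc n)) i"
    let ?h = "\<lambda>k j. Poly_Mapping.single (any_face n i j (any_face (Suc n) i k g)) (1::'k)"
    have "(D n i \<circ> D (Suc n) i) (Poly_Mapping.single g 1) =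
        (\<Sum>k\<le>Suc (Suc n). \<Sum>j\<le>Suc n. fscale ((- 1) ^ (k + j)) (?h k j))"
      using g by (simp add: single l.sum diff_gen_any_face any_face_in_gens fscale_single
        free.scale_sum_right
          power_add del: sum.atMost_Suc)
    also have "\<dots> = 0"
      by (rule free.alternating_sum_zero) (simp add: any_face_any_face[OF g])
    finally show "(D n i \<circ> D (Suc n) i) (Poly_Mapping.single g 1) \<in> {0}" by simp
  qed
  then show ?thesis by simp
qed

end

text \<open>Cochains sit in the space of all functions of strings with pointwise operations, so
  cohomology can be presented by the same means as homology.\<close>

sublocale linear_category \<subseteq>
  cochain: vector_space "(\<lambda>c \<alpha> xs fs. smul A c (\<alpha> xs fs)) :: 'k \<Rightarrow> ('o list \<Rightarrow> 'm list \<Rightarrow> 'm) \<Rightarrow> _"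
  by unfold_locales (simp_all add: fun_eq_iff scale_right_distrib scale_left_distrib)

context linear_automorphism
begin

section \<open>Chains, cycles and boundaries by representatives\<close>

abbreviation chain_class :: "nat \<Rightarrow> int \<Rightarrow> (('o, 'm) gen \<Rightarrow>\<^sub>0 'k) \<Rightarrow> (('o, 'm) gen \<Rightarrow>\<^sub>0 'k) set" where
  "chain_class n i \<equiv> coset (free (gens A S n i)) (rels A S n i)"

lemma presents_chains:
  "free.presents (Free n i) (rels A S n i) (chains A S n i) (chain_class n i)"
proof -
  have "{0} \<inter> Free n i \<subseteq> rels A S n i" using free.subspace_0[OF subspace_rels] by auto
  from free.presents_quot[OF presents_free subspace_rels rels_subset_free this]
  show ?thesis by (simp add: chains_def image_ident)
qed

lemma tensor_map_class:
  assumes F: "\<And>c. c \<in> Free n i \<Longrightarrow> linext fscale \<phi> c \<in> Free n' i'"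
    and R: "\<And>r. r \<in> rels A S n i \<Longrightarrow> linext fscale \<phi> r \<in> rels A S n' i'"
    and c: "c \<in> Free n i"
  shows "tensor_map A S n' i' \<phi> (chain_class n i c) = chain_class n' i' (linext fscale \<phi> c)"
proof -
  interpret l: Vector_Spaces.linear fscale fscale "linext fscale \<phi>"
    by (rule linext_linear[OF free.vector_space_axioms])
  note rF = subsetD[OF rels_subset_free]
  have "chain_class n' i' (linext fscale \<phi> (c + b)) = chain_class n' i' (linext fscale \<phi> c)"
    if "b \<in> rels A S n i" for b
  proof -
    have "chain_class n' i' (linext fscale \<phi> (c + b)) = chain_class n' i' (linext fscale \<phi> c) \<longleftrightarrow>
        linext fscale \<phi> (c + b) - linext fscale \<phi> c \<in> rels A S n' i'"
      by (rule free.presentsD(4)[OF presents_chains])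
        (intro F free.subspace_add[OF subspace_free] c rF that)+
    then show ?thesis using R[OF that] by (simp add: l.add)
  qed
  then show ?thesis
    using free.qmap_coset[OF presents_free rels_subset_free subspace_rels c,
        where W = "free (gens A S n' i')" and N = "rels A S n' i'" and f = "linext fscale \<phi>"]
    unfolding tensor_map_def by (simp add: image_ident)
qed

lemma diff_class: "c \<in> Free (Suc n) i \<Longrightarrow> diff A S n i (chain_class (Suc n) i c) =
  chain_class n i (D n i c)"
  unfolding diff_def by (rule tensor_map_class[OF D_Free D_rels])

text \<open>The preimage of the boundaries in the free space, as \<open>cyc\<close> is that of the
  cycles. A chain vanishes when its representative lies in \<open>rels\<close>; hence
  \<open>rels\<close> is added here and takes the place of zero in \<open>cyc\<close>.\<close>

definition bound :: "nat \<Rightarrow> int \<Rightarrow> (('o, 'm) gen \<Rightarrow>\<^sub>0 'k) set" where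
  "bound n i = {x + y |x y. x \<in> D n i ` Free (Suc n) i \<and> y \<in> rels A S n i}"

definition cyc :: "nat \<Rightarrow> int \<Rightarrow> (('o, 'm) gen \<Rightarrow>\<^sub>0 'k) set" where
  "cyc n i = (case n of 0 \<Rightarrow> Free 0 i | Suc m \<Rightarrow> {c \<in> Free n i. D m i c \<in> rels A S m i})"

lemma subspace_bound: "free.subspace (bound n i)"
proof -
  interpret l: Vector_Spaces.linear fscale fscale "D n i" by (rule D_linear)
  show ?thesis
    unfolding bound_def by (intro free.subspace_sums l.subspace_image subspace_free subspace_rels)
qed

lemma boundI: "e \<in> Free (Suc n) i \<Longrightarrow> r \<in> rels A S n i \<Longrightarrow> D n i e + r \<in> bound n i"
  unfolding bound_def by blast

lemma D_in_bound: "e \<in> Free (Suc n) i \<Longrightarrow> D n i e \<in> bound n i"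
  using boundI[OF _ free.subspace_0[OF subspace_rels]] by fastforce

lemma rels_subset_bound: "rels A S n i \<subseteq> bound n i"
proof
  interpret l: Vector_Spaces.linear fscale fscale "D n i" by (rule D_linear)
  fix r assume "r \<in> rels A S n i"
  from boundI[OF free.subspace_0[OF subspace_free] this] show "r \<in> bound n i" by simp
qed

lemma bound_subset_free: "bound n i \<subseteq> Free n i"
  unfolding bound_def using D_Free subsetD[OF rels_subset_free]
  by (auto intro!: free.subspace_add[OF subspace_free])

lemma boundaries_eq: "boundaries A S n i = chain_class n i ` bound n i"
proof -
  note pc = free.presentsD[OF presents_chains]
  have "boundaries A S n i = chain_class n i ` D n i ` Free (Suc n) i"
    unfolding boundaries_def pc(3)[symmetric] image_image by (intro image_cong refl diff_class)
  moreover have "chain_class n i (D n i e + r) = chain_class n i (D n i e)"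
    if "e \<in> Free (Suc n) i" "r \<in> rels A S n i" for e r
    using pc(4)[of "D n i e + r" n i "D n i e"] that bound_subset_free boundI[OF that] D_Free by auto
  ultimately show ?thesis
    using D_in_bound by (auto simp: bound_def)
qed

lemma cyc_subset_free: "cyc n i \<subseteq> Free n i"
  by (auto simp: cyc_def split: nat.splits)

lemma subspace_cyc: "free.subspace (cyc n i)"
proof (cases n)
  case (Suc m)
  interpret l: Vector_Spaces.linear fscale fscale "D m i" by (rule D_linear)
  have "cyc n i = Free n i \<inter> D m i -` rels A S m i" by (auto simp: cyc_def Suc)
  then show ?thesis
    using free.subspace_inter[OF subspace_free l.subspace_vimage[OF subspace_rels]] by simp
qed (simp add: cyc_def subspace_free)

lemma cycles_eq: "cycles A S n i = chain_class n i ` cyc n i"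
proof (cases n)
  case 0
  then show ?thesis by (simp add: cycles_def cyc_def free.presentsD(3)[OF presents_chains])
next
  case (Suc m)
  have "diff A S m i (chain_class n i c) = vzero (chains A S m i) \<longleftrightarrow> D m i c \<in> rels A S m i"
    if "c \<in> Free n i" for c
  proof -
    have "vzero (chains A S m i) = chain_class m i 0" by (simp add: chains_def quot_def free_def)
    then show ?thesis
      using that free.presentsD(4)[OF presents_chains D_Free free.subspace_0[OF subspace_free], of c
        m i]
      by (simp add: Suc diff_class)
  qed
  then show ?thesis
    unfolding cycles_def cyc_def Suc free.presentsD(3)[OF presents_chains, symmetric] by auto
qed

abbreviation hom_class :: "nat \<Rightarrow> int \<Rightarrow> (('o, 'm) gen \<Rightarrow>\<^sub>0 'k) \<Rightarrow> (('o, 'm) gen \<Rightarrow>\<^sub>0 'k) set set" where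
  "hom_class n i c \<equiv> coset (chains A S n i) (boundaries A S n i) (chain_class n i c)"

lemma presents_HH_hom: "free.presents (cyc n i) (bound n i) (HH_hom A S n i) (hom_class n i)"
proof -
  have "free.presents (Free n i) (bound n i) (quot (chains A S n i) (boundaries A S n i))
    (hom_class n i)"
    unfolding boundaries_eq
    by (rule free.presents_quot[OF presents_chains subspace_bound bound_subset_free])
      (use rels_subset_bound in blast)
  from free.presents_subspace[OF this subspace_cyc cyc_subset_free]
  show ?thesis by (simp add: HH_hom_def quot_restrict_carr cycles_eq image_image)
qed

lemma mem_hom_class:
  "c \<in> Free n i \<Longrightarrow> p \<in> hom_class n i c \<longleftrightarrow> (\<exists>b\<in>bound n i. p = chain_class n i (c + b))"
  unfolding boundaries_eq by (rule free.mem_coset[OF presents_chains bound_subset_free])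


section \<open>Cochains\<close>

abbreviation Coch :: "nat \<Rightarrow> int \<Rightarrow> ('o list \<Rightarrow> 'm list \<Rightarrow> 'm) set" where
  "Coch n i \<equiv> carr (cochains A S n i)"

text \<open>Cochains without the demand of multilinearity. Such a function is already determined by
  its pairing, which is how \<open>codiff\<close> and \<open>sigma_cochain\<close> are shown to
  yield multilinear maps.\<close>

definition precochains :: "nat \<Rightarrow> int \<Rightarrow> ('o list \<Rightarrow> 'm list \<Rightarrow> 'm) set" where
  "precochains n i = {\<alpha>.
     (\<forall>xs\<in>obj_tuples A n. \<forall>fs\<in>listset (homs A xs). \<alpha> xs fs \<in> hom A (last xs) (So A S i (hd xs))) \<and>
     (\<forall>xs fs. \<not> (xs \<in> obj_tuples A n \<and> fs \<in> listset (homs A xs)) \<longrightarrow> \<alpha> xs fs = 0)}"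

lemma Coch_iff: "\<alpha> \<in> Coch n i \<longleftrightarrow> \<alpha> \<in> precochains n i \<and>
    (\<forall>xs\<in>obj_tuples A n. multilinear_on (smul A) (homs A xs) (\<alpha> xs))"
  by (auto simp: cochains_def precochains_def bimod_def orb_hom_def)

lemma precochainsD: "\<alpha> \<in> precochains n i \<Longrightarrow> xs \<in> obj_tuples A n \<Longrightarrow> fs \<in> listset (homs A xs) \<Longrightarrow>
    \<alpha> xs fs \<in> hom A (last xs) (So A S i (hd xs))"
  by (simp add: precochains_def)

lemma Coch_in_hom: "\<alpha> \<in> Coch n i \<Longrightarrow> xs \<in> obj_tuples A n \<Longrightarrow> fs \<in> listset (homs A xs) \<Longrightarrow>
    \<alpha> xs fs \<in> hom A (last xs) (So A S i (hd xs))"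
  by (rule precochainsD) (simp_all add: Coch_iff)

lemma Coch_multilinear:
  assumes "\<alpha> \<in> Coch n i" "xs \<in> obj_tuples A n" "fs \<in> listset (homs A xs)" "j < n" "v \<in> homs A xs ! j"
  shows "w \<in> homs A xs ! j \<Longrightarrow> \<alpha> xs (fs[j := v + w]) = \<alpha> xs (fs[j := v]) + \<alpha> xs (fs[j := w])"
    "\<alpha> xs (fs[j := smul A c v]) = smul A c (\<alpha> xs (fs[j := v]))"
  using assms by (auto simp: Coch_iff multilinear_on_def obj_tuplesD(1))

lemma hom_subspaceI: "xs \<in> obj_tuples A n \<Longrightarrow> subspace (hom A (last xs) (So A S i (hd xs)))"
  by (intro hom_subspace So_in obj_tuplesD(5,6))

lemma subspace_Coch: "cochain.subspace (Coch n i)"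
proof (rule cochain.subspaceI)
  show "0 \<in> Coch n i"
    by (auto simp: Coch_iff precochains_def multilinear_on_def subspace_0[OF hom_subspaceI])
  show "\<alpha> + \<beta> \<in> Coch n i" if "\<alpha> \<in> Coch n i" "\<beta> \<in> Coch n i" for \<alpha> \<beta>
    using that by (auto simp: Coch_iff precochains_def multilinear_on_def subspace_add[OF hom_subspaceI]
        scale_right_distrib)
  show "(\<lambda>xs fs. smul A c (\<alpha> xs fs)) \<in> Coch n i" if "\<alpha> \<in> Coch n i" for c \<alpha>
    using that by (auto simp: Coch_iff precochains_def multilinear_on_def subspace_scale[OF
      hom_subspaceI]
        scale_right_distrib scale_left_commute)
qed

lemma presents_cochains: "cochain.presents (Coch n i) {0} (cochains A S n i) (\<lambda>\<alpha>. \<alpha>)"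
  by (rule cochain.presents_self[OF subspace_Coch]) (simp_all add: cochains_def fun_eq_iff)

section \<open>Composition in the orbit category and contraction\<close>

lemma orb_cmp_in:
  assumes "x \<in> obj A" "y \<in> obj A" "z \<in> obj A" "f \<in> hom A x (So A S i y)" "g \<in> hom A y (So A S j z)"
  shows "orb_cmp A S x y z j i g f \<in> hom A x (So A S (i + j) z)"
  unfolding orb_cmp_def
  using assms Sa_in[OF assms(2) So_in[OF assms(3)] assms(5), of i]
  by (auto intro!: cmp_in_hom So_in simp: So_plus)

lemma orb_cmp_linear:
  assumes "x \<in> obj A" "y \<in> obj A" "z \<in> obj A" "f \<in> hom A x (So A S i y)" "g \<in> hom A y (So A S j z)"
  shows "f' \<in> hom A x (So A S i y) \<Longrightarrow>
      orb_cmp A S x y z j i g (f + f') = orb_cmp A S x y z j i g f + orb_cmp A S x y z j i g f'"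
    "g' \<in> hom A y (So A S j z) \<Longrightarrow>
      orb_cmp A S x y z j i (g + g') f = orb_cmp A S x y z j i g f + orb_cmp A S x y z j i g' f"
    "orb_cmp A S x y z j i g (smul A c f) = smul A c (orb_cmp A S x y z j i g f)"
    "orb_cmp A S x y z j i (smul A c g) f = smul A c (orb_cmp A S x y z j i g f)"
  using assms Sa_in[OF assms(2) So_in[OF assms(3)], of _ j i]
  by (simp_all add: orb_cmp_def Sa_add Sa_smul So_in So_plus cmp_add_left cmp_add_right
    cmp_smul_left cmp_smul_right)

text \<open>Balancing: both sides are \<open>\<Sigma>^i(u) \<Sigma>^i(f) v\<close>, where
  \<open>\<Sigma>^i(f)\<close> comes from the composition on one side and from the left action on
  the other. This rule and the next two move a morphism of \<open>A\<close> past the composition, as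
  the comparison of the two differentials requires.\<close>

lemma orb_cmp_ract:
  assumes "x \<in> obj A" "y \<in> obj A" "y' \<in> obj A" "z \<in> obj A"
    "u \<in> hom A y (So A S j z)" "f \<in> hom A y' y" "v \<in> hom A x (So A S i y')"
  shows "orb_cmp A S x y' z j i (ract A S j z y y' u f) v =
    orb_cmp A S x y z j i u (lact A S i y' y x f v)"
  using assms Sa_in[OF assms(2) So_in[OF assms(4)] assms(5), of i]
  by (simp add: orb_cmp_def ract_def lact_def Sa_cmp So_in So_plus cmp_assoc Sa_in)

lemma orb_cmp_ract_right:
  assumes "x \<in> obj A" "x' \<in> obj A" "y \<in> obj A" "z \<in> obj A"
    "u \<in> hom A y (So A S j z)" "v \<in> hom A x (So A S i y)" "f \<in> hom A x' x"
  shows "orb_cmp A S x' y z j i u (ract A S i y x x' v f) =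
    cmp A x' x (So A S (i + j) z) (orb_cmp A S x y z j i u v) f"
  using assms Sa_in[OF assms(3) So_in[OF assms(4)] assms(5), of i]
  by (simp add: orb_cmp_def ract_def So_in So_plus cmp_assoc)

lemma orb_cmp_lact_left:
  assumes "x \<in> obj A" "y \<in> obj A" "z \<in> obj A" "z' \<in> obj A"
    "u \<in> hom A y (So A S j z)" "v \<in> hom A x (So A S i y)" "f \<in> hom A z z'"
  shows "orb_cmp A S x y z' j i (lact A S j z z' y f u) v =
    cmp A x (So A S (i + j) z) (So A S (i + j) z') (Sa A S (i + j) z z' f) (orb_cmp A S x y z j i u v)"
  using assms Sa_in[OF assms(2) So_in[OF assms(3)] assms(5), of i] Sa_in[OF So_in So_in Sa_in, OF
    assms(3,4,3,4,7), of i j]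
  by (simp add: orb_cmp_def lact_def So_in So_plus Sa_plus Sa_cmp Sa_in cmp_assoc)

abbreviation contr_val :: "int \<Rightarrow> int \<Rightarrow> ('o list \<Rightarrow> 'm list \<Rightarrow> 'm) \<Rightarrow> ('o, 'm) gen \<Rightarrow> 'm" where
  "contr_val i j \<alpha> g \<equiv> orb_cmp A S (last (fst g)) (hd (fst g)) (last (fst g)) j i (hd (snd g)) (\<alpha>
    (fst g) (tl (snd g)))"

lemma contr_val_in:
  assumes "\<alpha> \<in> precochains n i" "g \<in> gens A S n j"
  shows "contr_val i j \<alpha> g \<in> hom A (last (fst g)) (So A S (i + j) (last (fst g)))"
proof -
  from assms(2) obtain xs u fs where g: "g = (xs, u # fs)" "xs \<in> obj_tuples A n"
      "u \<in> hom A (hd xs) (So A S j (last xs))" "fs \<in> listset (homs A xs)"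
    by (rule gens_cases)
  then show ?thesis
    using precochainsD[OF assms(1) g(2,4)] obj_tuplesD(5,6)[OF g(2)] by (simp add: orb_cmp_in)
qed

lemma contr_val_gen:
  assumes "\<alpha> \<in> precochains n i" "g \<in> gens A S n j"
  shows "([last (fst g)], [contr_val i j \<alpha> g]) \<in> gens A S 0 (i + j)"
proof -
  have "last (fst g) \<in> obj A" using assms(2) by (auto elim!: gens_cases simp: obj_tuplesD(6))
  then have "[last (fst g)] \<in> obj_tuples A 0" by (simp add: obj_tuples_def)
  then show ?thesis
    using contr_val_in[OF assms] by (simp add: mem_gens_Cons homs_def)
qed

lemma multilinear_contr:
  assumes \<alpha>: "\<alpha> \<in> Coch n i"
  shows "multilinear_mod A S n j fscale (rels A S 0 (i + j)) (contr_gen A S i j \<alpha>)"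
proof -
  have pre: "\<alpha> \<in> precochains n i" using \<alpha> by (simp add: Coch_iff)
  have eq: "contr_gen A S i j \<alpha> = (\<lambda>g. Poly_Mapping.single ([last (fst g)], [contr_val i j \<alpha> g]) 1)"
    by (auto simp: contr_gen_def fun_eq_iff)
  show ?thesis
    unfolding eq
  proof (rule multilinear_mod_singleI)
    fix xs us k assume gen: "(xs, us) \<in> gens A S n j" and k: "k \<le> n"
    \<comment> \<open>The target has a single slot, which receives every slot of the source: slot 0
      through linearity of the composition in \<open>u\<close>, the others through multilinearity of
      \<open>\<alpha>\<close>.\<close>
    let ?L = "\<lambda>v. contr_val i j \<alpha> (xs, us[k := v])"
    have xs: "xs \<in> obj_tuples A n" using gen by (simp add: mem_gens)
    have x: "last xs \<in> obj A" using obj_tuplesD[OF xs] by simp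
    obtain u fs where us: "us = u # fs" "u \<in> hom A (hd xs) (So A S j (last xs))" "fs
      \<in> listset (homs A xs)"
      using gen by (auto elim: gens_cases)
    have fac: "factors A S (i + j) [last xs] ! 0 = hom A (last xs) (So A S (i + j) (last xs))"
      using factors_0[of "[last xs]" A 0 S "i + j"] x by (simp add: obj_tuples_def)
    note lin = orb_cmp_linear[OF obj_tuplesD(6,5,6)[OF xs]]
    show "\<exists>ys ws l L. (ys, ws) \<in> gens A S 0 (i + j) \<and> l \<le> 0 \<and>
      (\<forall>v\<in>factors A S j xs ! k. L v \<in> factors A S (i + j) ys ! l \<and>
         ([last (fst (xs, us[k := v]))], [contr_val i j \<alpha> (xs, us[k := v])]) = (ys, ws[l := L v]) \<and>
         (\<forall>w\<in>factors A S j xs ! k. L (v + w) = L v + L w) \<and> (\<forall>c. L (smul A c v) = smul A c (L v)))"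
    proof (rule exI[of _ "[last xs]"], rule exI[of _ "[contr_val i j \<alpha>
      (xs, us)]"], rule exI[of _ 0], rule exI[of _ ?L],
        intro conjI ballI allI)
      show "([last xs], [contr_val i j \<alpha> (xs, us)]) \<in> gens A S 0 (i + j)"
        using contr_val_gen[OF pre gen] by simp
      fix v assume v: "v \<in> factors A S j xs ! k"
      show "?L v \<in> factors A S (i + j) [last xs] ! 0"
        unfolding fac using contr_val_in[OF pre gens_update[OF gen v]] by simp
      show "([last (fst (xs, us[k := v]))], [contr_val i j \<alpha> (xs, us[k := v])]) =
        ([last xs], [contr_val i j \<alpha> (xs, us)][0 := ?L v])"
        by simp
      show "?L (v + w) = ?L v + ?L w" if w: "w \<in> factors A S j xs ! k" for w
      proof (cases k)
        case 0
        then show ?thesis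
          using v w lin(2)[OF Coch_in_hom[OF \<alpha> xs us(3)]] factors_0[OF xs, of S j] us
            by (simp add: obj_tuplesD(3,4)[OF xs])
      next
        case (Suc k')
        then have vw: "v \<in> homs A xs ! k'" "w \<in> homs A xs ! k'"
          using v w k factors_Suc[OF xs, of k' S j] by (auto simp: obj_tuplesD(1)[OF xs])
        show ?thesis
          using Suc k vw us listset_update[OF us(3)] lin(1)[OF Coch_in_hom[OF \<alpha> xs] us(2)]
            Coch_in_hom[OF \<alpha> xs]
            Coch_multilinear(1)[OF \<alpha> xs us(3), of k' v w] by simp
      qed
      show "?L (smul A c v) = smul A c (?L v)" for c
      proof (cases k)
        case 0
        then show ?thesis
          using v lin(4)[OF Coch_in_hom[OF \<alpha> xs us(3)]] factors_0[OF xs, of S j] us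
            by (simp add: obj_tuplesD(3,4)[OF xs])
      next
        case (Suc k')
        then have vw: "v \<in> homs A xs ! k'"
          using v k factors_Suc[OF xs, of k' S j] by (auto simp: obj_tuplesD(1)[OF xs])
        show ?thesis
          using Suc k vw us listset_update[OF us(3)] lin(3)[OF Coch_in_hom[OF \<alpha> xs] us(2)]
            Coch_in_hom[OF \<alpha> xs]
            Coch_multilinear(2)[OF \<alpha> xs us(3), of k' v] by simp
      qed
    qed simp
  qed
qed

lemma contr_Free:
  assumes "\<alpha> \<in> precochains n i" "c \<in> Free n j"
  shows "linext fscale (contr_gen A S i j \<alpha>) c \<in> Free 0 (i + j)"
proof (rule linear_free_in_subspace[OF linext_linear[OF free.vector_space_axioms] subspace_free _
  assms(2)])
  fix g assume "g \<in> gens A S n j"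
  from contr_val_gen[OF assms(1) this]
  show "linext fscale (contr_gen A S i j \<alpha>) (Poly_Mapping.single g 1) \<in> Free 0 (i + j)"
    by (simp add: linext_single[OF free.vector_space_axioms] contr_gen_def case_prod_beta
      single_in_free)
qed

lemma face_strings:
  assumes xs: "xs \<in> obj_tuples A (Suc n)" and fs: "fs \<in> listset (homs A xs)"
  shows "length fs = Suc n"
    "tl xs \<in> obj_tuples A n" "tl fs \<in> listset (homs A (tl xs))"
    "butlast xs \<in> obj_tuples A n" "butlast fs \<in> listset (homs A (butlast xs))"
    "1 \<le> j \<Longrightarrow> j \<le> n \<Longrightarrow> omit_obj j xs \<in> obj_tuples A n"
    "1 \<le> j \<Longrightarrow> j \<le> n \<Longrightarrow> merge A j xs fs \<in> listset (homs A (omit_obj j xs))"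
    "last (tl xs) = last xs" "hd (tl xs) = xs ! 1" "last (butlast xs) = xs ! n" "hd (butlast xs) =
      hd xs"
    "1 \<le> j \<Longrightarrow> j \<le> n \<Longrightarrow> last (omit_obj j xs) = last xs"
    "1 \<le> j \<Longrightarrow> j \<le> n \<Longrightarrow> hd (omit_obj j xs) = hd xs"
    "hd fs \<in> hom A (xs ! 1) (xs ! 0)" "last fs \<in> hom A (xs ! Suc n) (xs ! n)"
proof -
  note [simp] = obj_tuplesD[OF xs]
  \<comment> \<open>With the coefficient \<open>0\<close>, in internal degree 0, a string of
    morphisms becomes a generator, so the facts about faces of generators apply to it.\<close>
  have "0 \<in> hom A (hd xs) (So A S 0 (last xs))"
    by (intro subspace_0 hom_subspace So_in) simp_all
  then have g: "(xs, 0 # fs) \<in> gens A S (Suc n) 0" using xs fs by (simp add: mem_gens_Cons)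
  show len: "length fs = Suc n" using fs by (simp add: in_listset)
  show 0: "tl xs \<in> obj_tuples A n" "tl fs \<in> listset (homs A (tl xs))"
    using face_in_gens[OF g, of 0] face_eqs(1)[OF len, of 0 xs 0] by (simp_all add: mem_gens_Cons)
  show l: "butlast xs \<in> obj_tuples A n" "butlast fs \<in> listset (homs A (butlast xs))"
    using last_face_in_gens[OF g] face_eqs(3)[OF len, of 0 xs 0] by (simp_all add: mem_gens_Cons)
  show j: "omit_obj j xs \<in> obj_tuples A n" "merge A j xs fs \<in> listset (homs A (omit_obj j xs))"
    if "1 \<le> j" "j \<le> n" for j
    using face_in_gens[OF g that(2)] face_eqs(2)[OF len that, of 0 xs 0]
      by (simp_all add: mem_gens_Cons)
  show "last (omit_obj j xs) = last xs" "hd (omit_obj j xs) = hd xs" if "1 \<le> j" "j \<le> n" for j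
    using obj_tuplesD(3,4)[OF j(1)[OF that]] that by (simp_all add: nth_omit_obj)
  show "hd fs \<in> hom A (xs ! 1) (xs ! 0)" "last fs \<in> hom A (xs ! Suc n) (xs ! n)"
    using fs len by (auto simp: in_listset hd_conv_nth last_conv_nth simp flip: length_greater_0_conv)
  show "last (tl xs) = last xs" "hd (tl xs) = xs ! 1" "last (butlast xs) =
    xs ! n" "hd (butlast xs) = hd xs"
    using obj_tuplesD(3,4)[OF 0(1)] obj_tuplesD(3,4)[OF l(1)] by (simp_all add: nth_tl nth_butlast)
qed

lemma codiff_terms:
  assumes \<alpha>: "\<alpha> \<in> Coch n i"
    and xs: "xs \<in> obj_tuples A (Suc n)" and fs: "fs \<in> listset (homs A xs)"
  shows "lact A S i (xs ! 1) (xs ! 0) (last xs) (hd fs) (\<alpha> (tl xs) (tl fs))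
    \<in> hom A (last xs) (So A S i (hd xs))"
    "1 \<le> j \<Longrightarrow> j \<le> n \<Longrightarrow> \<alpha> (omit_obj j xs) (merge A j xs fs) \<in> hom A (last xs) (So A S i (hd xs))"
    "ract A S i (hd xs) (xs ! n) (last xs) (\<alpha> (butlast xs) (butlast fs)) (last fs)
      \<in> hom A (last xs) (So A S i (hd xs))"
proof -
  note st = face_strings[OF xs fs]
  note [simp] = obj_tuplesD[OF xs]
  show "lact A S i (xs ! 1) (xs ! 0) (last xs) (hd fs) (\<alpha> (tl xs) (tl fs))
    \<in> hom A (last xs) (So A S i (hd xs))"
    using Coch_in_hom[OF \<alpha> st(2,3)] st(8,9,14) by (simp add: lact_in)
  show "\<alpha> (omit_obj j xs) (merge A j xs fs) \<in> hom A (last xs) (So A S i (hd xs))" if "1 \<le> j" "j \<le> n"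
    using Coch_in_hom[OF \<alpha> st(6,7)[OF that]] st(12,13)[OF that] by simp
  show "ract A S i (hd xs) (xs ! n) (last xs) (\<alpha> (butlast xs) (butlast fs)) (last fs)
    \<in> hom A (last xs) (So A S i (hd xs))"
    using Coch_in_hom[OF \<alpha> st(4,5)] st(10,11,15) by (auto simp: ract_def So_in intro!: cmp_in_hom)
qed

lemma codiff_precochain:
  assumes \<alpha>: "\<alpha> \<in> Coch n i"
  shows "codiff A S n i \<alpha> \<in> precochains (Suc n) i"
proof -
  have "codiff A S n i \<alpha> xs fs \<in> hom A (last xs) (So A S i (hd xs))"
    if xs: "xs \<in> obj_tuples A (Suc n)" and fs: "fs \<in> listset (homs A xs)" for xs fs
  proof -
    note sub = hom_subspaceI[OF xs]
    show ?thesis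
      unfolding codiff_def if_P[OF conjI[OF xs fs]]
      by (intro subspace_add[OF sub] subspace_sum[OF sub] subspace_scale[OF sub] codiff_terms[OF \<alpha>
        xs fs]) auto
  qed
  then show ?thesis by (auto simp: precochains_def codiff_def)
qed

end


section \<open>The trace pairing\<close>

context weakly_calabi_yau
begin

text \<open>The value of \<open>Theta\<close> on representatives, before any quotient is
  taken.\<close>

definition pairing :: "int \<Rightarrow> ('o list \<Rightarrow> 'm list \<Rightarrow> 'm) \<Rightarrow> (('o, 'm) gen \<Rightarrow>\<^sub>0 'k) \<Rightarrow> 'k" where
  "pairing i \<alpha> c = linext (*) (tr_gen d tr d) (linext fscale (contr_gen A S i (d - i) \<alpha>) c)"

lemma tr_linear: "Vector_Spaces.linear fscale (*) (linext (*) (tr_gen d tr d))"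
  by (rule linext_linear[OF vector_space_mult])

lemma pairing_linear: "Vector_Spaces.linear fscale (*) (pairing i \<alpha>)"
  using linear_comp[OF linext_linear[OF free.vector_space_axioms] tr_linear, unfolded comp_def]
  unfolding pairing_def[abs_def] .

lemma pairing_single:
  "pairing i \<alpha> (Poly_Mapping.single g a) = a * tr (last (fst g)) (contr_val i (d - i) \<alpha> g)"
  by (cases g) (simp add: pairing_def linext_single[OF free.vector_space_axioms]
      linext_single[OF vector_space_mult] contr_gen_def fscale_single tr_gen_def)

lemma tr_functional: "x \<in> obj A \<Longrightarrow> functional_on (hom A x (So A S d x)) (tr x)"
  by (simp add: functional_on_def tr_add tr_smul)

lemma tr_orb_functional:
  assumes x: "x \<in> obj A" and y: "y \<in> obj A" and u: "u \<in> hom A y (So A S (d - i) x)"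
  shows "functional_on (hom A x (So A S i y)) (\<lambda>v. tr x (orb_cmp A S x y x (d - i) i u v))"
proof -
  have "orb_cmp A S x y x (d - i) i u v \<in> hom A x (So A S d x)" if "v \<in> hom A x (So A S i y)" for v
    using orb_cmp_in[OF x y x that u] by simp
  then show ?thesis
    using orb_cmp_linear(1,3)[OF x y x _ u] tr_add[OF x] tr_smul[OF x] by (simp add: functional_on_def)
qed

lemma tr_rels:
  assumes "r \<in> rels A S 0 d"
  shows "linext (*) (tr_gen d tr d) r = 0"
proof -
  have "multilinear_mod A S 0 d (*) {0} (tr_gen d tr d)"
    unfolding multilinear_mod_def
  proof (intro allI impI conjI ballI)
    fix xs us k v assume gen: "(xs, us) \<in> gens A S 0 d" and k: "k \<le> (0::nat)" and v: "v
      \<in> factors A S d xs ! k"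
    have xs: "xs \<in> obj_tuples A 0" using gen by (simp add: mem_gens)
    obtain u where us: "us = [u]" using gen by (auto elim: gens_cases)
    have fac: "factors A S d xs ! k = hom A (hd xs) (So A S d (hd xs))" and x: "hd xs \<in> obj A"
      using k factors_0[OF xs, of S d] obj_tuplesD[OF xs] by auto
    show "tr_gen d tr d (xs, us[k := v + w]) - tr_gen d tr d (xs, us[k := v]) - tr_gen d tr d
      (xs, us[k := w]) \<in> {0}"
      if "w \<in> factors A S d xs ! k" for w
      using that v k us fac tr_add[OF x] by (simp add: tr_gen_def)
    show "tr_gen d tr d (xs, us[k := smul A c v]) - c * tr_gen d tr d (xs, us[k := v]) \<in> {0}" for c
      using v k us fac tr_smul[OF x] by (simp add: tr_gen_def)
  qed
  from multilinear_mod_linext[OF vector_space_mult _ this assms]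
  show ?thesis
    using module.subspace_single_0 vector_space_mult[folded module_iff_vector_space] by blast
qed

lemma tr_commute:
  assumes "x \<in> obj A" "y \<in> obj A" "g \<in> hom A x y" "f \<in> hom A y (So A S d x)"
  shows "tr x (cmp A x y (So A S d x) f g) = tr y (cmp A y (So A S d x) (So A S d y)
    (Sa A S d x y g) f)"
proof -
  have "g \<in> hom A x (So A S 0 y)" "f \<in> hom A y (So A S (d - 0) x)"
    using assms by (simp_all add: fzpow_0)
  then have "tr x (cmp A x (So A S 0 y) (So A S d x) (Sa A S 0 y (So A S (d - 0) x) f) g) =
      (- 1) powi (0 * (d - 0)) *
      tr y (cmp A y (So A S (d - 0) x) (So A S d y) (Sa A S (d - 0) x (So A S 0 y) g) f)"
    using tr_symmetric_0 assms(1,2) unfolding trace_symmetric_def by blast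
  then show ?thesis by (simp add: fzpow_0)
qed

text \<open>The boundary of a generator of degree one is \<open>u f - f u\<close>, whose trace
  vanishes by \<open>tr_commute\<close>; relations are covered by \<open>tr_rels\<close>.\<close>

lemma tr_bound:
  assumes "b \<in> bound 0 d"
  shows "linext (*) (tr_gen d tr d) b = 0"
proof -
  interpret t: Vector_Spaces.linear fscale "(*)" "linext (*) (tr_gen d tr d)" by (rule tr_linear)
  have "(linext (*) (tr_gen d tr d) \<circ> D 0 d) e \<in> {0}" if "e \<in> Free 1 d" for e
  proof (rule linear_free_in_subspace[OF linear_comp[OF D_linear tr_linear] t.vs2.subspace_single_0
    _ that])
    fix g assume "g \<in> gens A S 1 d"
    then obtain xs u fs where g: "g = (xs, u # fs)" and xs: "xs \<in> obj_tuples A 1"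
      and u: "u \<in> hom A (hd xs) (So A S d (last xs))" and fs: "fs \<in> listset (homs A xs)" "length fs = 1"
      by (rule gens_cases)
    obtain f where f: "fs = [f]" using fs by (cases fs) auto
    obtain x y where xy: "xs = [x, y]" using obj_tuplesD(1)[OF xs] by (cases xs; cases "tl xs") auto
    have "f \<in> hom A y x" using fs f xy by (simp add: in_listset)
    then have "tr y (cmp A y x (So A S d y) u f) =
      tr x (cmp A x (So A S d y) (So A S d x) (Sa A S d y x f) u)"
      using u xs xy by (intro tr_commute) (auto simp: obj_tuples_def)
    moreover have "tr_gen d tr d (ys, us) = tr (hd ys) (hd us)" for ys us by (simp add: tr_gen_def)
    ultimately show "(linext (*) (tr_gen d tr d) \<circ> D 0 d) (Poly_Mapping.single g 1) \<in> {0}"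
      by (simp add: linext_single[OF free.vector_space_axioms] linext_single[OF vector_space_mult]
          diff_gen_def g f xy t.add ract_def lact_def)
  qed
  then show ?thesis
    using assms tr_rels by (auto simp: bound_def t.add)
qed

lemma pairing_rels:
  assumes "\<alpha> \<in> Coch n i" "r \<in> rels A S n (d - i)"
  shows "pairing i \<alpha> r = 0"
  using tr_rels multilinear_mod_linext[OF free.vector_space_axioms subspace_rels
    multilinear_contr[OF assms(1)] assms(2)]
  by (simp add: pairing_def)

lemma pairing_add:
  assumes "\<alpha> \<in> Coch n i" "\<beta> \<in> Coch n i" and c: "c \<in> Free n (d - i)"
  shows "pairing i (\<alpha> + \<beta>) c = pairing i \<alpha> c + pairing i \<beta> c"
proof -
  interpret vector_space_pair fscale "(*) :: 'k \<Rightarrow> 'k \<Rightarrow> 'k"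
    using free.vector_space_axioms vector_space_mult by (simp add: vector_space_pair_def)
  show ?thesis
  proof (rule linear_free_eq[OF pairing_linear linear_compose_add[OF pairing_linear pairing_linear]
    _ c])
    fix g assume "g \<in> gens A S n (d - i)"
    then obtain xs u fs where g: "g = (xs, u # fs)" and xs: "xs \<in> obj_tuples A n"
      and u: "u \<in> hom A (hd xs) (So A S (d - i) (last xs))" and fs: "fs \<in> listset (homs A xs)"
      by (rule gens_cases)
    have x: "last xs \<in> obj A" "hd xs \<in> obj A" using obj_tuplesD[OF xs] by simp_all
    note h = Coch_in_hom[OF assms(1) xs fs] Coch_in_hom[OF assms(2) xs fs]
    show "pairing i (\<alpha> + \<beta>) (Poly_Mapping.single g 1) =
        pairing i \<alpha> (Poly_Mapping.single g 1) + pairing i \<beta> (Poly_Mapping.single g 1)"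
      using orb_cmp_in[OF x(1,2,1) h(1) u] orb_cmp_in[OF x(1,2,1) h(2) u]
      by (simp add: pairing_single g orb_cmp_linear(1)[OF x(1,2,1) h(1) u h(2)] tr_add[OF x(1)])
  qed
qed

lemma pairing_scale:
  assumes "\<alpha> \<in> Coch n i" and c: "c \<in> Free n (d - i)"
  shows "pairing i (\<lambda>xs fs. smul A a (\<alpha> xs fs)) c = a * pairing i \<alpha> c"
proof -
  interpret vector_space_pair fscale "(*) :: 'k \<Rightarrow> 'k \<Rightarrow> 'k"
    using free.vector_space_axioms vector_space_mult by (simp add: vector_space_pair_def)
  show ?thesis
  proof (rule linear_free_eq[OF pairing_linear linear_compose_scale_right[OF pairing_linear] _ c])
    fix g assume "g \<in> gens A S n (d - i)"
    then obtain xs u fs where g: "g = (xs, u # fs)" and xs: "xs \<in> obj_tuples A n"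
      and u: "u \<in> hom A (hd xs) (So A S (d - i) (last xs))" and fs: "fs \<in> listset (homs A xs)"
      by (rule gens_cases)
    have x: "last xs \<in> obj A" "hd xs \<in> obj A" using obj_tuplesD[OF xs] by simp_all
    note h = Coch_in_hom[OF assms(1) xs fs]
    show "pairing i (\<lambda>xs fs. smul A a (\<alpha> xs fs)) (Poly_Mapping.single g 1) =
        a * pairing i \<alpha> (Poly_Mapping.single g 1)"
      using orb_cmp_in[OF x(1,2,1) h u]
      by (simp add: pairing_single g orb_cmp_linear(3)[OF x(1,2,1) h u] tr_smul[OF x(1)])
  qed
qed

text \<open>A nonzero functional that kills all \<open>tr (- g)\<close> would contradict nondegeneracy on the left.\<close>

lemma functional_eq_tr:
  assumes x: "x \<in> obj A" and y: "y \<in> obj A" and \<phi>: "functional_on (hom A y (So A S d x)) \<phi>"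
  obtains g where "g \<in> hom A x y" "\<And>f. f \<in> hom A y (So A S d x) \<Longrightarrow>
    tr x (cmp A x y (So A S d x) f g) = \<phi> f"
proof -
  let ?X = "So A S d x" and ?V = "hom A y (So A S d x)"
  have X: "?X \<in> obj A" using x by (rule So_in)
  have sub: "subspace ?V" "subspace (hom A x y)" using x y X by (simp_all add: hom_subspace)
  obtain B where B: "finite B" "span B = ?V" using finite_dim[OF y X] by blast
  then have BV: "B \<subseteq> ?V" using span_superset by blast
  have in_tr: "cmp A x y ?X f g \<in> hom A x ?X" if "f \<in> ?V" "g \<in> hom A x y" for f g
    using that x y X by (simp add: cmp_in_hom)
  have pg: "functional_on ?V (\<lambda>f. tr x (cmp A x y ?X f g))" if "g \<in> hom A x y" for g
    using that x y X in_tr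
    by (simp add: functional_on_def cmp_add_left cmp_smul_left tr_add tr_smul)
  \<comment> \<open>\<open>I\<close> is the image of \<open>hom A x y\<close> in the coordinate
    space over the finite spanning set \<open>B\<close>, a morphism \<open>g\<close> being recorded
    by the values of its functional on \<open>B\<close>; \<open>v\<close> records
    \<open>\<phi>\<close> in the same way.\<close>
  define I where "I = (\<lambda>g. \<Sum>b\<in>B. Poly_Mapping.single b (tr x (cmp A x y ?X b g))) ` hom A x y"
  define v where "v = (\<Sum>b\<in>B. Poly_Mapping.single b (\<phi> b))"
  have I: "free.subspace I"
  proof (rule free.subspaceI)
    have "tr x (cmp A x y ?X b 0) = 0" if "b \<in> B" for b
    proof -
      have "cmp A x y ?X b (smul A 0 0) = smul A 0 (cmp A x y ?X b 0)"
        using that BV x y X subspace_0[OF sub(2)] by (intro cmp_smul_right) auto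
      then show ?thesis using functional_on_zero[OF tr_functional[OF x] hom_subspace[OF x X]] by simp
    qed
    then show "0 \<in> I" unfolding I_def by (intro image_eqI[OF _ subspace_0[OF sub(2)]]) simp
  next
    fix p q assume "p \<in> I" "q \<in> I"
    then obtain g h where gh: "g \<in> hom A x y" "h \<in> hom A x y"
      "p = (\<Sum>b\<in>B. Poly_Mapping.single b (tr x (cmp A x y ?X b g)))"
      "q = (\<Sum>b\<in>B. Poly_Mapping.single b (tr x (cmp A x y ?X b h)))" unfolding I_def by blast
    have "tr x (cmp A x y ?X b (g + h)) = tr x (cmp A x y ?X b g) + tr x (cmp A x y ?X b h)"
      if "b \<in> B" for b
      using that BV gh x y X in_tr by (simp add: cmp_add_right tr_add subset_iff)
    then show "p + q \<in> I"
      unfolding I_def gh by (intro image_eqI[OF _ subspace_add[OF sub(2) gh(1,2)]])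
        (simp add: single_add sum.distrib)
  next
    fix c p assume "p \<in> I"
    then obtain g where g: "g \<in> hom A x y"
      "p = (\<Sum>b\<in>B. Poly_Mapping.single b (tr x (cmp A x y ?X b g)))" unfolding I_def by blast
    have "tr x (cmp A x y ?X b (smul A c g)) = c * tr x (cmp A x y ?X b g)" if "b \<in> B" for b
      using that BV g x y X in_tr by (simp add: cmp_smul_right tr_smul subset_iff)
    then show "fscale c p \<in> I"
      unfolding I_def g by (intro image_eqI[OF _ subspace_scale[OF sub(2) g(1), of c]])
        (simp add: fscale_single free.scale_sum_right)
  qed
  have "v \<in> I"
  proof (rule ccontr)
    assume "v \<notin> I"
    from free.separating_functional[OF I this]
    obtain \<psi> :: "('m \<Rightarrow>\<^sub>0 'k) \<Rightarrow> 'k" where \<psi>: "Vector_Spaces.linear fscale (*) \<psi>" "\<psi> v = 1"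
      "\<And>p. p \<in> I \<Longrightarrow> \<psi> p = 0" by blast
    interpret \<psi>: Vector_Spaces.linear fscale "(*)" \<psi> by (rule \<psi>)
    \<comment> \<open>The coefficients of \<open>f\<close> are the values of the separating
      functional on the coordinate unit vectors. Applied to the values on \<open>B\<close> of any
      functional \<open>\<xi>\<close>, the separating functional therefore returns
      \<open>\<xi> f\<close>.\<close>
    define f where "f = (\<Sum>b\<in>B. smul A (\<psi> (Poly_Mapping.single b 1)) b)"
    have fV: "smul A c b \<in> ?V" if "b \<in> B" for b c
      using that BV subspace_scale[OF sub(1)] by blast
    have f: "f \<in> ?V" unfolding f_def by (intro subspace_sum[OF sub(1)] fV)
    have eval: "\<psi> (\<Sum>b\<in>B. Poly_Mapping.single b (\<xi> b)) = \<xi> f" if "functional_on ?V \<xi>" for \<xi>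
    proof -
      have "\<psi> (Poly_Mapping.single b (\<xi> b)) = \<xi> b * \<psi> (Poly_Mapping.single b 1)" for b
        using \<psi>.scale[of "\<xi> b" "Poly_Mapping.single b 1"] by (simp add: fscale_single)
      moreover have "\<xi> f = (\<Sum>b\<in>B. \<xi> (smul A (\<psi> (Poly_Mapping.single b 1)) b))"
        unfolding f_def by (rule functional_on_sum[OF that sub(1)]) (rule fV)
      ultimately show ?thesis
        using functional_on_scale[OF that] BV by (auto simp: \<psi>.sum mult.commute intro!: sum.cong)
    qed
    have "tr x (cmp A x y ?X f g) = 0" if "g \<in> hom A x y" for g
      using eval[OF pg[OF that]] \<psi>(3) that by (simp add: I_def)
    then have "f = 0" using nondegenerate_left[OF x y f] by blast
    then show False
      using eval[OF \<phi>] \<psi>(2) functional_on_zero[OF \<phi> sub(1)] by (simp add: v_def)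
  qed
  then obtain g where g: "g \<in> hom A x y" "v = (\<Sum>b\<in>B. Poly_Mapping.single b (tr x (cmp A x y ?X b g)))"
    unfolding I_def by blast
  have on_B: "tr x (cmp A x y ?X b g) = \<phi> b" if "b \<in> B" for b
    using arg_cong[OF g(2), of "\<lambda>p. Poly_Mapping.lookup p b"] B(1) that
    by (simp add: v_def lookup_sum lookup_single when_def)
  have "tr x (cmp A x y ?X f g) = \<phi> f" if "f \<in> ?V" for f
  proof -
    let ?S = "{f \<in> ?V. tr x (cmp A x y ?X f g) = \<phi> f}"
    have "subspace ?S"
      using functional_on_zero[OF pg[OF g(1)] sub(1)] functional_on_zero[OF \<phi> sub(1)] sub(1)
        functional_on_add[OF pg[OF g(1)]] functional_on_add[OF \<phi>]
        functional_on_scale[OF pg[OF g(1)]] functional_on_scale[OF \<phi>]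
      by (auto simp: subspace_def)
    then have "span B \<subseteq> ?S" by (rule span_minimal[rotated]) (use BV on_B in auto)
    then show ?thesis using that B(2) by blast
  qed
  with g(1) show ?thesis by (rule that)
qed

lemma So_diff: "x \<in> obj A \<Longrightarrow> So A S i (So A S (d - i) x) = So A S d x"
  using So_plus[of x i "d - i"] by simp

text \<open>\<open>\<Sigma>^i\<close> identifies morphisms
  \<open>y \<rightarrow> \<Sigma>^(d-i) x\<close> with morphisms
  \<open>\<Sigma>^i y \<rightarrow> \<Sigma>^d x\<close>; the functional is transported along it and
  represented by a morphism \<open>x \<rightarrow> \<Sigma>^i y\<close>.\<close>

lemma functional_eq_tr_orb:
  assumes x: "x \<in> obj A" and y: "y \<in> obj A" and \<phi>: "functional_on (hom A y (So A S (d - i) x)) \<phi>"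
  obtains g where "g \<in> hom A x (So A S i y)"
    "\<And>u. u \<in> hom A y (So A S (d - i) x) \<Longrightarrow> tr x (orb_cmp A S x y x (d - i) i u g) = \<phi> u"
proof -
  let ?H = "hom A y (So A S (d - i) x)"
  interpret Si: linear_automorphism A "fzpow A S i" by (rule laut_fzpow)
  let ?s = "Sa A S i y (So A S (d - i) x)"
  have z: "So A S (d - i) x \<in> obj A" using x by (rule So_in)
  have bij: "bij_betw ?s ?H (hom A (So A S i y) (So A S d x))"
    using Si.farr_bij[OF y z] by (simp add: So_diff x)
  have sub: "subspace ?H" using y z by (rule hom_subspace)
  define \<xi> where "\<xi> f = \<phi> (inv_into ?H ?s f)" for f
  have \<xi>: "\<xi> (?s u) = \<phi> u" if "u \<in> ?H" for u
    using bij_betw_inv_into_left[OF bij that] by (simp add: \<xi>_def)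
  have "functional_on (hom A (So A S i y) (So A S d x)) \<xi>"
    unfolding functional_on_def bij_betw_imp_surj_on[OF bij, symmetric]
    using \<xi> functional_on_add[OF \<phi>] functional_on_scale[OF \<phi>] subspace_add[OF sub] subspace_scale[OF
      sub]
    by (auto simp flip: Sa_add[OF y z] Sa_smul[OF y z])
  from functional_eq_tr[OF x So_in[OF y] this]
  obtain g where g: "g \<in> hom A x (So A S i y)"
    "\<And>f. f \<in> hom A (So A S i y) (So A S d x) \<Longrightarrow> tr x (cmp A x (So A S i y) (So A S d x) f g) = \<xi> f"
      by blast
  show ?thesis
  proof
    show "g \<in> hom A x (So A S i y)" by (rule g)
    fix u assume u: "u \<in> ?H"
    then have "?s u \<in> hom A (So A S i y) (So A S d x)" using bij by (auto simp: bij_betw_def)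
    then show "tr x (orb_cmp A S x y x (d - i) i u g) = \<phi> u"
      using g(2) \<xi>[OF u] by (simp add: orb_cmp_def)
  qed
qed

text \<open>The same identification turns the assumption into a statement about all morphisms
  \<open>\<Sigma>^i y \<rightarrow> \<Sigma>^d x\<close>, to which nondegeneracy on the right
  applies.\<close>

lemma tr_orb_eqI:
  assumes x: "x \<in> obj A" and y: "y \<in> obj A" and g: "g \<in> hom A x (So A S i y)" and g': "g'
    \<in> hom A x (So A S i y)"
    and eq: "\<And>u. u \<in> hom A y (So A S (d - i) x) \<Longrightarrow>
      tr x (orb_cmp A S x y x (d - i) i u g) = tr x (orb_cmp A S x y x (d - i) i u g')"
  shows "g = g'"
proof -
  interpret Si: linear_automorphism A "fzpow A S i" by (rule laut_fzpow)
  have z: "So A S (d - i) x \<in> obj A" using x by (rule So_in)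
  have bij: "bij_betw (Sa A S i y (So A S (d - i) x)) (hom A y (So A S (d - i) x)) (hom A
    (So A S i y) (So A S d x))"
    using Si.farr_bij[OF y z] by (simp add: So_diff x)
  have sub: "subspace (hom A x (So A S i y))" using x So_in[OF y] by (rule hom_subspace)
  have diff: "g - g' \<in> hom A x (So A S i y)" using subspace_diff[OF sub g g'] .
  have "tr x (cmp A x (So A S i y) (So A S d x) f (g - g')) = 0"
    if f: "f \<in> hom A (So A S i y) (So A S d x)" for f
  proof -
    obtain u where u: "u \<in> hom A y (So A S (d - i) x)" "f = Sa A S i y (So A S (d - i) x) u"
      using f bij by (auto simp: bij_betw_def)
    note obs = x So_in[OF y] So_in[OF x]
    have "tr x (cmp A x (So A S i y) (So A S d x) f g) = tr x (cmp A x (So A S i y) (So A S d x) f g')"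
      using eq[OF u(1)] by (simp add: orb_cmp_def u)
    moreover have "cmp A x (So A S i y) (So A S d x) f g =
        cmp A x (So A S i y) (So A S d x) f (g - g') + cmp A x (So A S i y) (So A S d x) f g'"
      using cmp_add_right[OF obs f diff g'] by simp
    ultimately show ?thesis
      using tr_add[OF x cmp_in_hom[OF obs f diff] cmp_in_hom[OF obs f g']] by simp
  qed
  then have "g - g' = 0" using nondegenerate_right[OF x So_in[OF y] diff] by blast
  then show ?thesis by simp
qed

text \<open>Testing on single generators with a fixed string and a varying coefficient recovers each
  value separately; off the strings both functions are \<open>0\<close>.\<close>

lemma pairing_eqI:
  assumes \<alpha>: "\<alpha> \<in> precochains n i" and \<beta>: "\<beta> \<in> precochains n i"
    and eq: "\<And>c. c \<in> Free n (d - i) \<Longrightarrow> pairing i \<alpha> c = pairing i \<beta> c"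
  shows "\<alpha> = \<beta>"
proof (intro ext)
  fix xs fs
  show "\<alpha> xs fs = \<beta> xs fs"
  proof (cases "xs \<in> obj_tuples A n \<and> fs \<in> listset (homs A xs)")
    case True
    then have xs: "xs \<in> obj_tuples A n" and fs: "fs \<in> listset (homs A xs)" by auto
    show ?thesis
    proof (rule tr_orb_eqI[OF obj_tuplesD(6,5)[OF xs] precochainsD[OF \<alpha> xs fs] precochainsD[OF \<beta> xs
      fs]])
      fix u assume "u \<in> hom A (hd xs) (So A S (d - i) (last xs))"
      then have "(xs, u # fs) \<in> gens A S n (d - i)" using xs fs by (simp add: mem_gens_Cons)
      from eq[OF single_in_free[OF this, of 1]]
      show "tr (last xs) (orb_cmp A S (last xs) (hd xs) (last xs) (d - i) i u (\<alpha> xs fs)) =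
          tr (last xs) (orb_cmp A S (last xs) (hd xs) (last xs) (d - i) i u (\<beta> xs fs))"
        by (simp add: pairing_single)
    qed
  next
    case False
    then show ?thesis using \<alpha> \<beta> by (simp add: precochains_def)
  qed
qed

text \<open>The relations in slot 0 make \<open>\<psi>\<close> linear in the coefficient and so
  produce a value for each string; the relations in the other slots then become the multilinearity
  of these values.\<close>

lemma functional_eq_pairing:
  assumes \<psi>: "Vector_Spaces.linear fscale (*) \<psi>" and rel: "\<And>r. r \<in> rels A S n (d - i) \<Longrightarrow> \<psi> r = 0"
  obtains \<alpha> where "\<alpha> \<in> Coch n i" "\<And>c. c \<in> Free n (d - i) \<Longrightarrow> pairing i \<alpha> c = \<psi> c"
proof -
  interpret \<psi>: Vector_Spaces.linear fscale "(*)" \<psi> by (rule \<psi>)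
  let ?e = "\<lambda>g. Poly_Mapping.single g (1::'k)"
  let ?T = "\<lambda>xs u g. tr (last xs) (orb_cmp A S (last xs) (hd xs) (last xs) (d - i) i u g)"
  have rel_add: "\<psi> (?e (xs, us[k := v + w])) = \<psi> (?e (xs, us[k := v])) + \<psi> (?e (xs, us[k := w]))"
    and rel_smul: "\<psi> (?e (xs, us[k := smul A c v])) = c * \<psi> (?e (xs, us[k := v]))"
    if "(xs, us) \<in> gens A S n (d - i)" "k < length us" "v \<in> factors A S (d - i) xs ! k" "w
      \<in> factors A S (d - i) xs ! k"
    for xs us k v w c
    using rel[OF relsI_add[OF that]] rel[OF relsI_smul[OF that(1-3), of c]]
    by (simp_all add: \<psi>.diff \<psi>.scale diff_eq_eq add.commute)
  have "\<exists>g. g \<in> hom A (last xs) (So A S i (hd xs)) \<and>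
      (\<forall>u\<in>hom A (hd xs) (So A S (d - i) (last xs)). ?T xs u g = \<psi> (?e (xs, u # fs)))"
    if xs: "xs \<in> obj_tuples A n" and fs: "fs \<in> listset (homs A xs)" for xs fs
  proof -
    have "functional_on (hom A (hd xs) (So A S (d - i) (last xs))) (\<lambda>u. \<psi> (?e (xs, u # fs)))"
      unfolding functional_on_def
    proof (intro conjI ballI allI)
      fix u v assume u: "u \<in> hom A (hd xs) (So A S (d - i) (last xs))" "v
        \<in> hom A (hd xs) (So A S (d - i) (last xs))"
      then have "(xs, u # fs) \<in> gens A S n (d - i)" using xs fs by (simp add: mem_gens_Cons)
      from rel_add[OF this, of 0 u v] show "\<psi> (?e (xs, (u + v) # fs)) =
        \<psi> (?e (xs, u # fs)) + \<psi> (?e (xs, v # fs))"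
        using u factors_0[OF xs, of S "d - i"] by (simp add: obj_tuplesD(3,4)[OF xs])
    next
      fix u c assume u: "u \<in> hom A (hd xs) (So A S (d - i) (last xs))"
      then have "(xs, u # fs) \<in> gens A S n (d - i)" using xs fs by (simp add: mem_gens_Cons)
      from rel_smul[OF this, of 0 u u c] show "\<psi> (?e (xs, smul A c u # fs)) = c * \<psi> (?e (xs, u # fs))"
        using u factors_0[OF xs, of S "d - i"] by (simp add: obj_tuplesD(3,4)[OF xs])
    qed
    from functional_eq_tr_orb[OF obj_tuplesD(6,5)[OF xs] this] show ?thesis by metis
  qed
  then obtain G where G: "\<And>xs fs. xs \<in> obj_tuples A n \<Longrightarrow> fs \<in> listset (homs A xs) \<Longrightarrow>
    G xs fs \<in> hom A (last xs) (So A S i (hd xs))"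
    "\<And>xs fs u. xs \<in> obj_tuples A n \<Longrightarrow> fs \<in> listset (homs A xs) \<Longrightarrow>
      u \<in> hom A (hd xs) (So A S (d - i) (last xs)) \<Longrightarrow>
      ?T xs u (G xs fs) = \<psi> (?e (xs, u # fs))"
    by metis
  \<comment> \<open>The choice \<open>G\<close> is controlled on strings only; elsewhere cochains
    are required to be \<open>0\<close>.\<close>
  define \<alpha> where "\<alpha> xs fs = (if xs \<in> obj_tuples A n \<and> fs \<in> listset (homs A xs) then G xs fs else 0)"
    for xs fs
  have pre: "\<alpha> \<in> precochains n i" by (auto simp: precochains_def \<alpha>_def G)
  have "multilinear_on (smul A) (homs A xs) (\<alpha> xs)" if xs: "xs \<in> obj_tuples A n" for xs
    unfolding multilinear_on_def
  proof (intro conjI ballI allI impI)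
    note x = obj_tuplesD(6,5)[OF xs]
    note sub = hom_subspaceI[OF xs, of i]
    fix us j v assume us: "us \<in> listset (homs A xs)" and j: "j < length (homs A xs)" and v: "v
      \<in> homs A xs ! j"
    have jn: "j < n" using j by (simp add: obj_tuplesD(1)[OF xs])
    \<comment> \<open>The coefficient occupies slot 0, so argument \<open>j\<close> of a cochain is
      slot \<open>Suc j\<close> of a generator.\<close>
    have fac: "factors A S (d - i) xs ! Suc j = homs A xs ! j"
      using factors_Suc[OF xs jn] jn by (simp add: obj_tuplesD(1)[OF xs])
    have sub': "subspace (homs A xs ! j)" using jn by (simp add: obj_tuplesD(1,2)[OF xs] hom_subspace)
    have len: "length us = n" using us by (simp add: in_listset obj_tuplesD(1)[OF xs])
    note in_ls = listset_update[OF us, of _ j]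
    {
      fix w assume w: "w \<in> homs A xs ! j"
      note vw = subspace_add[OF sub' v w]
      show "\<alpha> xs (us[j := v + w]) = \<alpha> xs (us[j := v]) + \<alpha> xs (us[j := w])"
      proof (rule tr_orb_eqI[OF x])
        fix u assume u: "u \<in> hom A (hd xs) (So A S (d - i) (last xs))"
        have "(xs, u # us) \<in> gens A S n (d - i)" using xs us u by (simp add: mem_gens_Cons)
        from rel_add[OF this, of "Suc j" v w]
        show "?T xs u (\<alpha> xs (us[j := v + w])) = ?T xs u (\<alpha> xs (us[j := v]) + \<alpha> xs (us[j := w]))"
          using G(1)[OF xs in_ls] G(2)[OF xs in_ls u] v w vw jn len u xs in_ls fac
            functional_on_add[OF tr_orb_functional[OF x u]]
          by (simp add: \<alpha>_def)
      qed (use G(1)[OF xs in_ls] v w vw xs in_ls in \<open>simp_all add: \<alpha>_def subspace_add[OF sub]\<close>)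
    }
    fix c
    note cv = subspace_scale[OF sub' v, of c]
    show "\<alpha> xs (us[j := smul A c v]) = smul A c (\<alpha> xs (us[j := v]))"
    proof (rule tr_orb_eqI[OF x])
      fix u assume u: "u \<in> hom A (hd xs) (So A S (d - i) (last xs))"
      have "(xs, u # us) \<in> gens A S n (d - i)" using xs us u by (simp add: mem_gens_Cons)
      from rel_smul[OF this, of "Suc j" v v c]
      show "?T xs u (\<alpha> xs (us[j := smul A c v])) = ?T xs u (smul A c (\<alpha> xs (us[j := v])))"
        using G(1)[OF xs in_ls] G(2)[OF xs in_ls u] v cv jn len u xs in_ls fac
          functional_on_scale[OF tr_orb_functional[OF x u]]
        by (simp add: \<alpha>_def)
    qed (use G(1)[OF xs in_ls] v cv xs in_ls in \<open>simp_all add: \<alpha>_def subspace_scale[OF sub]\<close>)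
  qed
  with pre have \<alpha>: "\<alpha> \<in> Coch n i" by (simp add: Coch_iff)
  have "pairing i \<alpha> c = \<psi> c" if "c \<in> Free n (d - i)" for c
  proof (rule linear_free_eq[OF pairing_linear \<psi> _ that])
    fix g assume "g \<in> gens A S n (d - i)"
    then obtain xs u fs where g: "g = (xs, u # fs)" and xs: "xs \<in> obj_tuples A n"
      and u: "u \<in> hom A (hd xs) (So A S (d - i) (last xs))" and fs: "fs \<in> listset (homs A xs)"
      by (rule gens_cases)
    show "pairing i \<alpha> (?e g) = \<psi> (?e g)"
      using G(2)[OF xs fs u] xs fs by (simp add: pairing_single g \<alpha>_def)
  qed
  with \<alpha> show ?thesis by (rule that)
qed

text \<open>Each summand of the codifferential is matched with the summand of
  \<open>diff_gen\<close> in the same position and with the same sign; only the two outer ones need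
  an argument.\<close>

lemma pairing_codiff:
  assumes \<alpha>: "\<alpha> \<in> Coch n i" and c: "c \<in> Free (Suc n) (d - i)"
  shows "pairing i (codiff A S n i \<alpha>) c = pairing i \<alpha> (D n (d - i) c)"
proof -
  interpret P: Vector_Spaces.linear fscale "(*)" "pairing i \<alpha>" by (rule pairing_linear)
  have "pairing i (codiff A S n i \<alpha>) c = (pairing i \<alpha> \<circ> D n (d - i)) c"
  proof (rule linear_free_eq[OF pairing_linear linear_comp[OF D_linear pairing_linear] _ c])
    fix g assume "g \<in> gens A S (Suc n) (d - i)"
    then obtain xs u fs where g: "g = (xs, u # fs)" and xs: "xs \<in> obj_tuples A (Suc n)"
      and u: "u \<in> hom A (hd xs) (So A S (d - i) (last xs))" and fs: "fs \<in> listset (homs A xs)"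
      by (rule gens_cases)
    let ?x = "last xs" and ?y = "hd xs"
    note st = face_strings[OF xs fs] and ob = obj_tuplesD[OF xs] and terms = codiff_terms[OF \<alpha> xs fs]
    have x: "?x \<in> obj A" and y: "?y \<in> obj A" and obs: "xs ! 0 \<in> obj A" "xs ! 1 \<in> obj A" "xs ! n \<in> obj A"
      using ob by simp_all
    define X where "X v = tr ?x (orb_cmp A S ?x ?y ?x (d - i) i u v)" for v
    let ?H = "hom A ?x (So A S i ?y)"
    have H: "subspace ?H" by (rule hom_subspaceI[OF xs])
    have X: "functional_on ?H X"
      using tr_orb_functional[OF x y u] by (simp add: X_def[abs_def])
    let ?t0 = "lact A S i (xs ! 1) (xs ! 0) ?x (hd fs) (\<alpha> (tl xs) (tl fs))"
    let ?tj = "\<lambda>j. \<alpha> (omit_obj j xs) (merge A j xs fs)"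
    let ?tn = "ract A S i ?y (xs ! n) ?x (\<alpha> (butlast xs) (butlast fs)) (last fs)"
    have "pairing i (codiff A S n i \<alpha>) (Poly_Mapping.single g 1) = X (codiff A S n i \<alpha> xs fs)"
      by (simp add: pairing_single g X_def)
    also have "\<dots> = X (?t0 + (\<Sum>j=1..n. smul A ((- 1) ^ j) (?tj j)) + smul A ((- 1) ^ (n + 1)) ?tn)"
      unfolding codiff_def if_P[OF conjI[OF xs fs]] ..
    also have "\<dots> = X ?t0 + X (\<Sum>j=1..n. smul A ((- 1) ^ j) (?tj j)) + X (smul A ((- 1) ^ (n + 1)) ?tn)"
    proof -
      have s: "(\<Sum>j=1..n. smul A ((- 1) ^ j) (?tj j)) \<in> ?H"
        by (intro subspace_sum[OF H] subspace_scale[OF H] terms(2)) auto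
      show ?thesis
        using functional_on_add[OF X subspace_add[OF H terms(1) s] subspace_scale[OF H terms(3)]]
          functional_on_add[OF X terms(1) s] by metis
    qed
    also have "X (\<Sum>j=1..n. smul A ((- 1) ^ j) (?tj j)) = (\<Sum>j=1..n. (- 1) ^ j * X (?tj j))"
    proof -
      have "X (\<Sum>j=1..n. smul A ((- 1) ^ j) (?tj j)) = (\<Sum>j=1..n. X (smul A ((- 1) ^ j) (?tj j)))"
        by (rule functional_on_sum[OF X H]) (auto intro!: subspace_scale[OF H] terms(2))
      also have "\<dots> = (\<Sum>j=1..n. (- 1) ^ j * X (?tj j))"
        by (intro sum.cong refl functional_on_scale[OF X] terms(2)) auto
      finally show ?thesis .
    qed
    also have "X (smul A ((- 1) ^ (n + 1)) ?tn) = (- 1) ^ (n + 1) * X ?tn"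
      by (rule functional_on_scale[OF X terms(3)])
    \<comment> \<open>Balancing moves \<open>f_0\<close> from the value of \<open>\<alpha>\<close>
      to the coefficient: \<open>u \<circ> (f_0 v) = (u f_0) \<circ> v\<close>.\<close>
    also have "X ?t0 = pairing i \<alpha> (Poly_Mapping.single
        (tl xs, ract A S (d - i) ?x (xs ! 0) (xs ! 1) u (hd fs) # tl fs) 1)"
    proof -
      have "\<alpha> (tl xs) (tl fs) \<in> hom A ?x (So A S i (xs ! 1))"
        using Coch_in_hom[OF \<alpha> st(2,3)] st(8,9) by simp
      from orb_cmp_ract[OF x obs(1,2) x _ st(14) this, of u "d - i"] u show ?thesis
        by (simp add: pairing_single X_def st(8,9) ob(3))
    qed
    also have "(\<Sum>j=1..n. (- 1) ^ j * X (?tj j)) =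
        pairing i \<alpha> (\<Sum>j=1..n. Poly_Mapping.single (omit_obj j xs, u # merge A j xs fs) ((- 1) ^ j))"
      unfolding P.sum by (intro sum.cong refl) (simp add: pairing_single X_def st(12,13))
    \<comment> \<open>\<open>u \<circ> (v f) = (u \<circ> v) f\<close> has the same trace as
      \<open>f (u \<circ> v) = (f u) \<circ> v\<close>, the latter being taken at
      \<open>xs ! n\<close> instead of the last object.\<close>
    also have "(- 1) ^ (n + 1) * X ?tn = pairing i \<alpha> (Poly_Mapping.single
        (butlast xs, lact A S (d - i) ?x (xs ! n) ?y (last fs) u # butlast fs) ((- 1) ^ (n + 1)))"
    proof -
      have a: "\<alpha> (butlast xs) (butlast fs) \<in> hom A (xs ! n) (So A S i ?y)"
        using Coch_in_hom[OF \<alpha> st(4,5)] st(10,11) by simp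
      have f: "last fs \<in> hom A ?x (xs ! n)" using st(15) ob(4) by simp
      have o: "orb_cmp A S (xs ! n) ?y ?x (d - i) i u (\<alpha> (butlast xs) (butlast fs))
        \<in> hom A (xs ! n) (So A S d ?x)"
        using orb_cmp_in[OF obs(3) y x a u] by simp
      show ?thesis
        using orb_cmp_ract_right[OF obs(3) x y x u a f] orb_cmp_lact_left[OF obs(3) y x obs(3) u a f]
          tr_commute[OF x obs(3) f o]
        by (simp add: pairing_single X_def st(10,11))
    qed
    also have "pairing i \<alpha> (Poly_Mapping.single
          (tl xs, ract A S (d - i) ?x (xs ! 0) (xs ! 1) u (hd fs) # tl fs) 1) +
        pairing i \<alpha> (\<Sum>j=1..n. Poly_Mapping.single (omit_obj j xs, u # merge A j xs fs) ((- 1) ^ j)) +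
        pairing i \<alpha> (Poly_Mapping.single
          (butlast xs, lact A S (d - i) ?x (xs ! n) ?y (last fs) u # butlast fs) ((- 1) ^ (n + 1))) =
        pairing i \<alpha> (diff_gen A S n (d - i) g)"
      unfolding g diff_gen_def by (simp only: case_prod_conv Let_def list.sel P.add)
    finally show "pairing i (codiff A S n i \<alpha>) (Poly_Mapping.single g 1) =
        (pairing i \<alpha> \<circ> D n (d - i)) (Poly_Mapping.single g 1)"
      by (simp add: linext_single[OF free.vector_space_axioms])
  qed
  then show ?thesis by simp
qed

end


section \<open>Duality between homology and cohomology\<close>

context weakly_calabi_yau
begin

lemma Coch_0: "(\<lambda>xs fs. 0) \<in> Coch n i"
  using cochain.subspace_0[OF subspace_Coch] by (simp add: zero_fun_def)

lemma pairing_zero: "c \<in> Free n (d - i) \<Longrightarrow> pairing i (\<lambda>xs fs. 0) c = 0"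
  using pairing_scale[OF Coch_0, of c n i 0] by simp

lemma pairing_diff:
  assumes "\<alpha> \<in> Coch n i" "\<beta> \<in> Coch n i" "c \<in> Free n (d - i)"
  shows "pairing i (\<alpha> - \<beta>) c = pairing i \<alpha> c - pairing i \<beta> c"
  using pairing_add[OF cochain.subspace_diff[OF subspace_Coch assms(1,2)] assms(2,3)] by simp

text \<open>Cocycles, coboundaries and the cocycles with invariant class are annihilators or
  intersections of such, and inherit their linear structure from the pairing.\<close>

lemma subspace_annihilator:
  assumes "Q \<subseteq> Free n (d - i)"
  shows "cochain.subspace {\<alpha> \<in> Coch n i. \<forall>c\<in>Q. pairing i \<alpha> c = 0}"
proof (rule cochain.subspaceI)
  note C = subspace_Coch[of n i]
  show "0 \<in> {\<alpha> \<in> Coch n i. \<forall>c\<in>Q. pairing i \<alpha> c = 0}"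
    using pairing_zero assms cochain.subspace_0[OF C] by (auto simp: zero_fun_def)
  show "\<alpha> + \<beta> \<in> {\<alpha> \<in> Coch n i. \<forall>c\<in>Q. pairing i \<alpha> c = 0}"
    if "\<alpha> \<in> {\<alpha> \<in> Coch n i. \<forall>c\<in>Q. pairing i \<alpha> c = 0}" "\<beta> \<in> {\<alpha> \<in> Coch n i. \<forall>c\<in>Q. pairing i \<alpha> c = 0}"
      for \<alpha> \<beta>
    using that assms cochain.subspace_add[OF C] pairing_add[of \<alpha> n i \<beta>] by (simp add: subset_iff)
  show "(\<lambda>xs fs. smul A a (\<alpha> xs fs)) \<in> {\<alpha> \<in> Coch n i. \<forall>c\<in>Q. pairing i \<alpha> c = 0}"
    if "\<alpha> \<in> {\<alpha> \<in> Coch n i. \<forall>c\<in>Q. pairing i \<alpha> c = 0}" for a \<alpha>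
    using that assms cochain.subspace_scale[OF C] pairing_scale[of \<alpha> n i] by (simp add: subset_iff)
qed

text \<open>The differential of a cochain is multilinear because it represents \<open>tr\<close> of the contraction
  composed with the differential of chains.\<close>

lemma codiff_Coch:
  assumes \<alpha>: "\<alpha> \<in> Coch n i"
  shows "codiff A S n i \<alpha> \<in> Coch (Suc n) i"
proof -
  have "(pairing i \<alpha> \<circ> D n (d - i)) r = 0" if "r \<in> rels A S (Suc n) (d - i)" for r
    using pairing_rels[OF \<alpha> D_rels[OF that]] by simp
  from functional_eq_pairing[OF linear_comp[OF D_linear pairing_linear] this]
  obtain \<beta> where \<beta>: "\<beta> \<in> Coch (Suc n) i"
    "\<And>c. c \<in> Free (Suc n) (d - i) \<Longrightarrow> pairing i \<beta> c = (pairing i \<alpha> \<circ> D n (d - i)) c" by blast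
  have "codiff A S n i \<alpha> = \<beta>"
    by (rule pairing_eqI[OF codiff_precochain[OF \<alpha>]])
      (use \<beta> pairing_codiff[OF \<alpha>] in \<open>auto simp: Coch_iff\<close>)
  then show ?thesis using \<beta>(1) by simp
qed

text \<open>The pairing of the codifferential of \<open>\<alpha>\<close> is that of
  \<open>\<alpha>\<close> with boundaries, and a cochain vanishes as soon as its pairing
  does.\<close>

lemma cocycles_iff:
  "\<alpha> \<in> cocycles A S n i \<longleftrightarrow> \<alpha> \<in> Coch n i \<and> (\<forall>c\<in>D n (d - i) ` Free (Suc n) (d - i). pairing i \<alpha> c = 0)"
proof -
  have "codiff A S n i \<alpha> = (\<lambda>xs fs. 0) \<longleftrightarrow> (\<forall>e\<in>Free (Suc n) (d - i). pairing i \<alpha> (D n (d - i) e) = 0)"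
    if \<alpha>: "\<alpha> \<in> Coch n i"
  proof
    assume "codiff A S n i \<alpha> = (\<lambda>xs fs. 0)"
    then show "\<forall>e\<in>Free (Suc n) (d - i). pairing i \<alpha> (D n (d - i) e) = 0"
      using pairing_codiff[OF \<alpha>] pairing_zero by metis
  next
    assume "\<forall>e\<in>Free (Suc n) (d - i). pairing i \<alpha> (D n (d - i) e) = 0"
    then show "codiff A S n i \<alpha> = (\<lambda>xs fs. 0)"
      using codiff_Coch[OF \<alpha>] Coch_0 pairing_codiff[OF \<alpha>] pairing_zero
      by (intro pairing_eqI[of _ "Suc n" i]) (auto simp: Coch_iff)
  qed
  then show ?thesis by (auto simp: cocycles_def cochains_def[of A S "Suc n"])
qed

text \<open>One inclusion is adjointness; the other holds because a functional on the image of the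
  differential extends to all chains.\<close>

lemma coboundaries_iff:
  "\<gamma> \<in> coboundaries A S n i \<longleftrightarrow> \<gamma> \<in> Coch n i \<and> (\<forall>c\<in>cyc n (d - i). pairing i \<gamma> c = 0)"
proof (cases n)
  case 0
  \<comment> \<open>In degree 0 every chain is a cycle, so annihilating the cycles already forces
    zero.\<close>
  have "\<gamma> = (\<lambda>xs fs. 0)" if "\<gamma> \<in> Coch 0 i" "\<forall>c\<in>Free 0 (d - i). pairing i \<gamma> c = 0"
    using that Coch_0 pairing_zero by (intro pairing_eqI[of _ 0 i]) (auto simp: Coch_iff)
  moreover have "coboundaries A S n i = {\<lambda>xs fs. 0}" by (simp add: coboundaries_def 0 cochains_def)
  ultimately show ?thesis using Coch_0 pairing_zero by (auto simp: cyc_def 0)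
next
  case (Suc m)
  show ?thesis
  proof
    assume "\<gamma> \<in> coboundaries A S n i"
    then obtain \<beta> where \<beta>: "\<beta> \<in> Coch m i" "\<gamma> = codiff A S m i \<beta>" by (auto simp: coboundaries_def Suc)
    then show "\<gamma> \<in> Coch n i \<and> (\<forall>c\<in>cyc n (d - i). pairing i \<gamma> c = 0)"
      using codiff_Coch pairing_codiff pairing_rels by (auto simp: cyc_def Suc)
  next
    assume \<gamma>: "\<gamma> \<in> Coch n i \<and> (\<forall>c\<in>cyc n (d - i). pairing i \<gamma> c = 0)"
    then have kern: "pairing i \<gamma> c = 0" if "c \<in> Free (Suc m) (d - i)" "D m (d - i) c
      \<in> rels A S m (d - i)" for c
      using that by (simp add: cyc_def Suc)
    \<comment> \<open>As a functional, \<open>\<gamma>\<close> factors through the differential,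
      with a factor that vanishes on \<open>rels\<close>; the cochain representing this factor has
      codifferential \<open>\<gamma>\<close>.\<close>
    from functional_factor[OF D_linear subspace_free subspace_rels free.linear_functional_on[OF
      pairing_linear] kern]
    obtain \<psi> where \<psi>: "Vector_Spaces.linear fscale (*) \<psi>"
      "\<And>c. c \<in> Free (Suc m) (d - i) \<Longrightarrow> \<psi> (D m (d - i) c) = pairing i \<gamma> c"
      "\<And>r. r \<in> rels A S m (d - i) \<Longrightarrow> \<psi> r = 0" by blast
    from functional_eq_pairing[OF \<psi>(1,3)]
    obtain \<beta> where \<beta>: "\<beta> \<in> Coch m i" "\<And>c. c \<in> Free m (d - i) \<Longrightarrow> pairing i \<beta> c = \<psi> c" by blast
    have "\<gamma> = codiff A S m i \<beta>"
    proof (rule pairing_eqI[of _ n i])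
      show "pairing i \<gamma> c = pairing i (codiff A S m i \<beta>) c" if "c \<in> Free n (d - i)" for c
        using that \<psi>(2) \<beta>(2)[OF D_Free] pairing_codiff[OF \<beta>(1)] by (simp add: Suc)
    qed (use \<gamma> codiff_precochain[OF \<beta>(1)] in \<open>auto simp: Coch_iff Suc\<close>)
    then show "\<gamma> \<in> coboundaries A S n i" using \<beta>(1) by (auto simp: coboundaries_def Suc)
  qed
qed

lemma subspace_cocycles: "cochain.subspace (cocycles A S n i)"
proof -
  have "cocycles A S n i = {\<alpha> \<in> Coch n i. \<forall>c\<in>D n (d - i) ` Free (Suc n) (d - i). pairing i \<alpha> c = 0}"
    by (auto simp: cocycles_iff)
  moreover have "D n (d - i) ` Free (Suc n) (d - i) \<subseteq> Free n (d - i)" using D_Free by blast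
  ultimately show ?thesis using subspace_annihilator by (simp only:)
qed

lemma subspace_coboundaries: "cochain.subspace (coboundaries A S n i)"
proof -
  have "coboundaries A S n i = {\<alpha> \<in> Coch n i. \<forall>c\<in>cyc n (d - i). pairing i \<alpha> c = 0}"
    by (auto simp: coboundaries_iff)
  then show ?thesis using subspace_annihilator[OF cyc_subset_free] by simp
qed

section \<open>Cohomology by representatives and the first isomorphism\<close>

abbreviation coh_class :: "nat \<Rightarrow> int \<Rightarrow> ('o list \<Rightarrow> 'm list \<Rightarrow> 'm) \<Rightarrow> ('o list \<Rightarrow> 'm list \<Rightarrow> 'm) set" where
  "coh_class n i \<equiv> coset (cochains A S n i) (coboundaries A S n i)"

lemma coboundaries_subset: "coboundaries A S n i \<subseteq> Coch n i"
  by (auto simp: coboundaries_iff)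

text \<open>The codifferential has square zero by duality: the image of \<open>D\<close> consists of
  cycles, so what annihilates all cycles annihilates it.\<close>

lemma coboundaries_subset_cocycles: "coboundaries A S n i \<subseteq> cocycles A S n i"
proof -
  have "D n (d - i) e \<in> cyc n (d - i)" if "e \<in> Free (Suc n) (d - i)" for e
    using that D_Free D_D free.subspace_0[OF subspace_rels] by (cases n) (auto simp: cyc_def)
  then show ?thesis by (auto simp: cocycles_iff coboundaries_iff)
qed

lemma cocycles_subset: "cocycles A S n i \<subseteq> Coch n i"
  by (auto simp: cocycles_iff)

lemma presents_HH_coh:
  "cochain.presents (cocycles A S n i) (coboundaries A S n i) (HH_coh A S n i) (coh_class n i)"
proof -
  have "{0} \<inter> Coch n i \<subseteq> coboundaries A S n i"
    using cochain.subspace_0[OF subspace_coboundaries] by auto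
  from cochain.presents_quot[OF presents_cochains subspace_coboundaries coboundaries_subset this]
  have "cochain.presents (Coch n i) (coboundaries A S n i) (quot (cochains A S n i)
    (coboundaries A S n i)) (coh_class n i)"
    by (simp add: image_ident)
  from cochain.presents_subspace[OF this subspace_cocycles cocycles_subset]
  show ?thesis by (simp add: HH_coh_def quot_restrict_carr)
qed

lemma mem_coh_class:
  "\<alpha> \<in> Coch n i \<Longrightarrow> p \<in> coh_class n i \<alpha> \<longleftrightarrow> (\<exists>\<beta>\<in>coboundaries A S n i. p = \<alpha> + \<beta>)"
  using cochain.mem_coset[OF presents_cochains coboundaries_subset] by (simp add: image_ident)

lemma pairing_bound:
  assumes "\<alpha> \<in> cocycles A S n i" "b \<in> bound n (d - i)"
  shows "pairing i \<alpha> b = 0"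
proof -
  interpret P: Vector_Spaces.linear fscale "(*)" "pairing i \<alpha>" by (rule pairing_linear)
  show ?thesis using assms pairing_rels by (auto simp: bound_def cocycles_iff P.add)
qed

text \<open>\<open>Theta\<close> is built from unions over all representatives followed by
  \<open>the_elem\<close>, so the value must be the same for every choice: a cocycle in the class, a
  chain in the class, a boundary added to the contraction and a relation in degree zero.\<close>

lemma Theta_class:
  assumes \<alpha>: "\<alpha> \<in> cocycles A S n i" and c: "c \<in> cyc n (d - i)"
  shows "Theta A S d tr n i (coh_class n i \<alpha>) (hom_class n (d - i) c) = pairing i \<alpha> c"
proof -
  interpret t: Vector_Spaces.linear fscale "(*)" "linext (*) (tr_gen d tr d)" by (rule tr_linear)
  let ?X = "coh_class n i \<alpha>" and ?H = "hom_class n (d - i) c"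
  have \<alpha>C: "\<alpha> \<in> Coch n i" and cF: "c \<in> Free n (d - i)"
    using \<alpha> c cocycles_subset cyc_subset_free by blast+
  have val: "the_elem (linext (*) (tr_gen d tr d) ` P) = pairing i \<alpha> c"
    if P: "P \<in> contr A S i (d - i) ?X ?H" for P
  proof -
    obtain \<alpha>' p where \<alpha>': "\<alpha>' \<in> ?X" and p: "p \<in> ?H"
      and P: "P \<in> coset (chains A S 0 d) (boundaries A S 0 d) (tensor_map A S 0 d (contr_gen A S i
        (d - i) \<alpha>') p)"
      using P unfolding contr_def qmap_def by auto
    obtain \<beta> where \<beta>: "\<beta> \<in> coboundaries A S n i" "\<alpha>' = \<alpha> + \<beta>" using \<alpha>' mem_coh_class[OF \<alpha>C] by blast
    obtain b where b: "b \<in> bound n (d - i)" "p = chain_class n (d - i) (c + b)"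
      using p mem_hom_class[OF cF] by blast
    have \<beta>C: "\<beta> \<in> Coch n i" and bF: "b \<in> Free n (d - i)"
      using \<beta> b coboundaries_subset bound_subset_free by blast+
    have \<alpha>'C: "\<alpha>' \<in> Coch n i" using \<beta> cochain.subspace_add[OF subspace_Coch \<alpha>C \<beta>C] by simp
    have cbF: "c + b \<in> Free n (d - i)" by (rule free.subspace_add[OF subspace_free cF bF])
    have contr_F: "linext fscale (contr_gen A S i (d - i) \<alpha>') e \<in> Free 0 d"
      if "e \<in> Free n (d - i)" for e
      using contr_Free[of \<alpha>' n i e "d - i"] \<alpha>'C that by (simp add: Coch_iff)
    have contr_R: "linext fscale (contr_gen A S i (d - i) \<alpha>') r \<in> rels A S 0 d"
      if "r \<in> rels A S n (d - i)" for r
      using multilinear_mod_linext[OF free.vector_space_axioms subspace_rels multilinear_contr[OF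
        \<alpha>'C] that] by simp
    let ?w = "linext fscale (contr_gen A S i (d - i) \<alpha>') (c + b)"
    have "tensor_map A S 0 d (contr_gen A S i (d - i) \<alpha>') (chain_class n (d - i) (c + b)) =
      chain_class 0 d ?w"
      by (rule tensor_map_class[OF contr_F contr_R cbF])
    then have "P \<in> hom_class 0 d ?w" using P unfolding b(2) by simp
    then obtain b0 where b0: "b0 \<in> bound 0 d" "P = chain_class 0 d (?w + b0)"
      using mem_hom_class[OF contr_F[OF cbF]] by blast
    have wF: "?w + b0 \<in> Free 0 d"
      using contr_F[OF cbF] b0 bound_subset_free free.subspace_add[OF subspace_free] by blast
    have elems: "q \<in> P \<longleftrightarrow> (\<exists>r\<in>rels A S 0 d. q = ?w + b0 + r)" for q
      unfolding b0(2) using free.mem_coset[OF presents_free rels_subset_free wF]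
        by (simp add: image_ident)
    \<comment> \<open>The boundary \<open>b0\<close> and the relation \<open>r\<close> have trace
      zero, and of the four pairings of \<open>\<alpha>\<close>, \<open>\<beta>\<close> with
      \<open>c\<close>, \<open>b\<close> only that of \<open>\<alpha>\<close> with \<open>c\<close>
      survives.\<close>
    have "linext (*) (tr_gen d tr d) (?w + b0 + r) = pairing i \<alpha> c" if "r \<in> rels A S 0 d" for r
    proof -
      have "linext (*) (tr_gen d tr d) (?w + b0 + r) = pairing i \<alpha>' (c + b)"
        using tr_bound[OF b0(1)] tr_rels[OF that] by (simp only: t.add pairing_def add_0_right)
      also have "\<dots> = pairing i \<alpha> (c + b) + pairing i \<beta> (c + b)"
        unfolding \<beta>(2) by (rule pairing_add[OF \<alpha>C \<beta>C cbF])
      also have "pairing i \<alpha> (c + b) = pairing i \<alpha> c"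
        using pairing_bound[OF \<alpha> b(1)] pairing_linear[of i \<alpha>] by (simp add: Vector_Spaces.linear_iff)
      also have "pairing i \<beta> (c + b) = pairing i \<beta> c + pairing i \<beta> b"
        using pairing_linear[of i \<beta>] by (simp add: Vector_Spaces.linear_iff)
      also have "pairing i \<beta> c = 0" using \<beta>(1) c by (simp add: coboundaries_iff)
      also have "pairing i \<beta> b = 0"
        using pairing_bound[OF subsetD[OF coboundaries_subset_cocycles \<beta>(1)] b(1)] .
      finally show ?thesis by simp
    qed
    then have "linext (*) (tr_gen d tr d) q = pairing i \<alpha> c" if "q \<in> P" for q
      using elems[of q] that by force
    moreover have "?w + b0 + 0 \<in> P" using elems[of "?w + b0 + 0"] free.subspace_0[OF subspace_rels]
      by blast
    ultimately have "linext (*) (tr_gen d tr d) ` P = {pairing i \<alpha> c}"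
      by (intro equalityI subsetI) (auto simp: image_iff)
    then show ?thesis by simp
  qed
  \<comment> \<open>\<open>the_elem\<close> is meaningful on a singleton only, so constancy has to
    be complemented by nonemptiness.\<close>
  have "contr A S i (d - i) ?X ?H \<noteq> {}"
  proof -
    have "?X \<noteq> {}" "?H \<noteq> {}" and ne: "coset W (boundaries A S 0 d) v \<noteq> {}"
      for W :: "('k, (('o, 'm) gen \<Rightarrow>\<^sub>0 'k) set) vs" and v
      using cochain.subspace_0[OF subspace_coboundaries, of n i] free.subspace_0[OF subspace_bound,
        of n "d - i"]
        free.subspace_0[OF subspace_bound, of 0 d]
      unfolding boundaries_eq by (auto simp: coset_def)
    then show ?thesis by (auto simp: contr_def qmap_def)
  qed
  then have "(\<lambda>P. the_elem (linext (*) (tr_gen d tr d) ` P)) ` contr A S i (d - i) ?X ?H =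
    {pairing i \<alpha> c}"
    using val by auto
  then have "tr_HH d tr d (contr A S i (d - i) ?X ?H) = pairing i \<alpha> c"
    by (simp add: tr_HH_def)
  moreover have "?H \<in> carr (HH_hom A S n (d - i))"
    using free.presentsD(3)[OF presents_HH_hom] c by blast
  ultimately show ?thesis by (simp add: Theta_def)
qed

text \<open>Factoring through the identity modulo \<open>bound\<close> extends \<open>\<phi>\<close>
  from the cycles to all chains so that it vanishes on all of \<open>bound\<close>. Vanishing on
  \<open>rels\<close> makes the extension representable by a cochain, and vanishing on the image of
  \<open>D\<close> makes that cochain a cocycle.\<close>

lemma cocycle_eq_functional:
  assumes \<phi>: "free.functional_on (cyc n (d - i)) \<phi>"
    and kill: "\<And>b. b \<in> cyc n (d - i) \<Longrightarrow> b \<in> bound n (d - i) \<Longrightarrow> \<phi> b = 0"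
  obtains \<alpha> where "\<alpha> \<in> cocycles A S n i" "\<And>c. c \<in> cyc n (d - i) \<Longrightarrow> pairing i \<alpha> c = \<phi> c"
proof -
  have id: "Vector_Spaces.linear fscale fscale (\<lambda>c::('o, 'm) gen \<Rightarrow>\<^sub>0 'k. c)"
    by unfold_locales simp_all
  from functional_factor[OF id subspace_cyc subspace_bound \<phi> kill]
  obtain \<psi> where \<psi>: "Vector_Spaces.linear fscale (*) \<psi>" "\<And>c. c \<in> cyc n (d - i) \<Longrightarrow> \<psi> c = \<phi> c"
    "\<And>b. b \<in> bound n (d - i) \<Longrightarrow> \<psi> b = 0" by blast
  have "\<psi> r = 0" if "r \<in> rels A S n (d - i)" for r using \<psi>(3) rels_subset_bound that by blast
  from functional_eq_pairing[OF \<psi>(1) this]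
  obtain \<alpha> where \<alpha>: "\<alpha> \<in> Coch n i" "\<And>c. c \<in> Free n (d - i) \<Longrightarrow> pairing i \<alpha> c = \<psi> c" by blast
  have "\<alpha> \<in> cocycles A S n i"
    using \<alpha> D_in_bound D_Free \<psi>(3) by (simp add: cocycles_iff)
  then show ?thesis using that \<alpha>(2) \<psi>(2) cyc_subset_free by (metis subsetD)
qed

lemma pairing_cyc_linear: "free.functional_on Z (pairing i \<alpha>)"
  by (rule free.linear_functional_on[OF pairing_linear])

lemma Theta_iso: "lin_iso (HH_coh A S n i) (dual (HH_hom A S n (d - i))) (Theta A S d tr n i)"
proof (rule lin_iso_dual[OF cochain.vector_space_axioms free.vector_space_axioms presents_HH_coh
  presents_HH_hom,
      where T = "pairing i"])
  note sub = subsetD[OF cocycles_subset] subsetD[OF cyc_subset_free]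
  show "pairing i (\<alpha> + \<beta>) c = pairing i \<alpha> c + pairing i \<beta> c"
    if "\<alpha> \<in> cocycles A S n i" "\<beta> \<in> cocycles A S n i" "c \<in> cyc n (d - i)" for \<alpha> \<beta> c
    using that by (intro pairing_add sub)
  show "pairing i (\<lambda>xs fs. smul A a (\<alpha> xs fs)) c = a * pairing i \<alpha> c"
    if "\<alpha> \<in> cocycles A S n i" "c \<in> cyc n (d - i)" for a \<alpha> c
    using that by (intro pairing_scale sub)
  show "\<alpha> \<in> coboundaries A S n i"
    if "\<alpha> \<in> cocycles A S n i" "\<And>c. c \<in> cyc n (d - i) \<Longrightarrow> pairing i \<alpha> c = 0" for \<alpha>
    using that sub by (simp add: coboundaries_iff)
  show "\<exists>\<alpha>\<in>cocycles A S n i. \<forall>c\<in>cyc n (d - i). pairing i \<alpha> c = \<phi> c"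
    if "free.functional_on (cyc n (d - i)) \<phi>"
      "\<And>b. b \<in> cyc n (d - i) \<Longrightarrow> b \<in> bound n (d - i) \<Longrightarrow> \<phi> b = 0" for \<phi>
    using cocycle_eq_functional[OF that] by metis
qed (simp_all add: pairing_cyc_linear pairing_bound Theta_class, simp add: Theta_def)

end


section \<open>The action of \<open>\<Sigma>\<close>\<close>

definition act_slot :: "('k::field, 'o, 'm) lincat \<Rightarrow> ('o, 'm) func \<Rightarrow> ('o, 'm) func \<Rightarrow> int \<Rightarrow>
    'o list \<Rightarrow> nat \<Rightarrow> 'm \<Rightarrow> 'm" where
  "act_slot A S G i xs k v = (if k = 0 then smul A ((- 1) powi i) (farr G (hd xs) (So A S i
    (last xs)) v)
     else farr G (xs ! k) (xs ! (k - 1)) v)"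

text \<open>The sign \<open>(-1)^i\<close> is its own inverse, so one formula serves \<Sigma> and
  its inverse as \<open>G\<close>.\<close>

definition act_gen :: "('k::field, 'o, 'm) lincat \<Rightarrow> ('o, 'm) func \<Rightarrow> ('o, 'm) func \<Rightarrow> int \<Rightarrow>
    ('o, 'm) gen \<Rightarrow> ('o, 'm) gen" where
  "act_gen A S G i = (\<lambda>(xs, us). (map (fobj G) xs,
     smul A ((- 1) powi i) (farr G (hd xs) (So A S i (last xs)) (hd us)) # map_arrs G xs (tl us)))"

abbreviation act :: "('k::field, 'o, 'm::ab_group_add) lincat \<Rightarrow> ('o, 'm) func \<Rightarrow> ('o, 'm) func \<Rightarrow> int \<Rightarrow>
    (('o, 'm) gen \<Rightarrow>\<^sub>0 'k) \<Rightarrow> (('o, 'm) gen \<Rightarrow>\<^sub>0 'k)" where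
  "act A S G i \<equiv> linext fscale (\<lambda>g. Poly_Mapping.single (act_gen A S G i g) 1)"

lemma sigma_gen_eq: "sigma_gen A S i = (\<lambda>g. Poly_Mapping.single (act_gen A S S i g) 1)"
  by (auto simp: sigma_gen_def act_gen_def sact_def fun_eq_iff)

lemma length_map_arrs [simp]: "length (map_arrs G xs fs) = length fs"
  by (simp add: map_arrs_def)

lemma nth_map_arrs [simp]: "j < length fs \<Longrightarrow> map_arrs G xs fs ! j =
  farr G (xs ! Suc j) (xs ! j) (fs ! j)"
  by (simp add: map_arrs_def)

lemma nth_act_gen:
  "length us = Suc n \<Longrightarrow> k \<le> n \<Longrightarrow> snd (act_gen A S G i (xs, us)) ! k = act_slot A S G i xs k (us ! k)"
  by (cases us; cases k) (auto simp: act_gen_def act_slot_def)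

lemma length_act_gen: "length us = Suc n \<Longrightarrow> length (snd (act_gen A S G i (xs, us))) = Suc n"
  by (simp add: act_gen_def)

lemma fst_act_gen: "fst (act_gen A S G i (xs, us)) = map (fobj G) xs"
  by (simp add: act_gen_def)

lemma sign_square: "(- 1 :: 'k::field) powi i * (- 1) powi i = 1"
  by (simp add: power_int_minus_left)

context commuting_automorphism
begin

lemma map_tuple: "xs \<in> obj_tuples A n \<Longrightarrow> map (fobj G) xs \<in> obj_tuples A n"
  by (auto simp: obj_tuples_def G.fobj_in)

lemma act_slot_in:
  assumes xs: "xs \<in> obj_tuples A n" and k: "k \<le> n" and v: "v \<in> factors A S i xs ! k"
  shows "act_slot A S G i xs k v \<in> factors A S i (map (fobj G) xs) ! k"
proof (cases k)
  case 0
  then have "v \<in> hom A (xs ! 0) (So A S i (xs ! n))" using v factors_0[OF xs] by simp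
  then have "farr G (xs ! 0) (So A S i (xs ! n)) v
    \<in> hom A (fobj G (xs ! 0)) (So A S i (fobj G (xs ! n)))"
    using G.farr_in[of "xs ! 0" "So A S i (xs ! n)" v] So_commute[of "xs ! n" i]
      by (simp add: obj_tuplesD[OF xs] So_in)
  moreover have "subspace (hom A (fobj G (xs ! 0)) (So A S i (fobj G (xs ! n))))"
    by (simp add: hom_subspace So_in G.fobj_in obj_tuplesD[OF xs])
  ultimately show ?thesis
    using 0 factors_0[OF map_tuple[OF xs], of S i]
      by (simp add: act_slot_def obj_tuplesD[OF xs] subspace_scale)
next
  case (Suc j)
  then show ?thesis
    using k v factors_Suc[OF xs, of j S i] factors_Suc[OF map_tuple[OF xs], of j S i]
    by (simp add: act_slot_def obj_tuplesD[OF xs] G.farr_in)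
qed

lemma act_slot_linear:
  assumes xs: "xs \<in> obj_tuples A n" and k: "k \<le> n" and v: "v \<in> factors A S i xs ! k"
  shows "w \<in> factors A S i xs ! k \<Longrightarrow>
      act_slot A S G i xs k (v + w) = act_slot A S G i xs k v + act_slot A S G i xs k w"
    "act_slot A S G i xs k (smul A c v) = smul A c (act_slot A S G i xs k v)"
proof -
  have v0: "w \<in> hom A (xs ! 0) (So A S i (xs ! n))" if "k = 0" "w \<in> factors A S i xs ! k" for w
    using that factors_0[OF xs, of S i] by simp
  have vS: "w \<in> hom A (xs ! k) (xs ! (k - 1))" if "k \<noteq> 0" "w \<in> factors A S i xs ! k" for w
    using that k factors_Suc[OF xs, of "k - 1" S i] by simp
  show "act_slot A S G i xs k (v + w) = act_slot A S G i xs k v + act_slot A S G i xs k w"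
    if "w \<in> factors A S i xs ! k"
    using v0[OF _ v] vS[OF _ v] v0[OF _ that] vS[OF _ that] k
    by (cases "k = 0") (simp_all add: act_slot_def obj_tuplesD[OF xs] G.farr_add So_in
      scale_right_distrib)
  show "act_slot A S G i xs k (smul A c v) = smul A c (act_slot A S G i xs k v)"
    using v0[OF _ v] vS[OF _ v] k
    by (cases "k = 0") (simp_all add: act_slot_def obj_tuplesD[OF xs] G.farr_smul So_in
      scale_left_commute)
qed

lemma act_gen_in:
  assumes "g \<in> gens A S n i"
  shows "act_gen A S G i g \<in> gens A S n i"
proof -
  obtain xs us where g: "g = (xs, us)" by (cases g)
  then have xs: "xs \<in> obj_tuples A n" and len: "length us = Suc n"
    and us: "\<And>k. k \<le> n \<Longrightarrow> us ! k \<in> factors A S i xs ! k"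
    using assms by (auto simp: mem_gens)
  obtain vs where vs: "act_gen A S G i g = (map (fobj G) xs, vs)" "vs = snd (act_gen A S G i g)"
    by (simp add: act_gen_def g)
  have "vs ! k \<in> factors A S i (map (fobj G) xs) ! k" if "k \<le> n" for k
    unfolding vs(2) g nth_act_gen[OF len that] by (rule act_slot_in[OF xs that us[OF that]])
  then show ?thesis
    unfolding vs(1) mem_gens using map_tuple[OF xs] length_act_gen[OF len] vs(2) g by auto
qed

lemma multilinear_act:
  "multilinear_mod A S n i fscale (rels A S n i) (\<lambda>g. Poly_Mapping.single (act_gen A S G i g) (1::'k))"
proof (rule multilinear_mod_singleI)
  fix xs us k assume gen: "(xs, us) \<in> gens A S n i" and k: "k \<le> n"
  have xs: "xs \<in> obj_tuples A n" and len: "length us = Suc n" using gen by (auto simp: mem_gens)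
  define ws where "ws = snd (act_gen A S G i (xs, us))"
  have lws: "length ws = Suc n" using length_act_gen[OF len] by (simp add: ws_def)
  have eq: "act_gen A S G i (xs, us) = (map (fobj G) xs, ws)" by (simp add: ws_def act_gen_def)
  show "\<exists>ys ws l L. (ys, ws) \<in> gens A S n i \<and> l \<le> n \<and>
    (\<forall>v\<in>factors A S i xs ! k. L v \<in> factors A S i ys ! l \<and>
      act_gen A S G i (xs, us[k := v]) = (ys, ws[l := L v]) \<and>
       (\<forall>w\<in>factors A S i xs ! k. L (v + w) = L v + L w) \<and> (\<forall>c. L (smul A c v) = smul A c (L v)))"
  proof (rule exI[of _ "map (fobj G) xs"], rule exI[of _ ws], rule exI[of _ k], rule exI[of _
    "act_slot A S G i xs k"],
      intro conjI ballI allI)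
    show "(map (fobj G) xs, ws) \<in> gens A S n i" using act_gen_in[OF gen] eq by simp
    fix v assume v: "v \<in> factors A S i xs ! k"
    show "act_slot A S G i xs k v \<in> factors A S i (map (fobj G) xs) ! k"
      by (rule act_slot_in[OF xs k v])
    have len': "length (us[k := v]) = Suc n" using len by simp
    have "snd (act_gen A S G i (xs, us[k := v])) = ws[k := act_slot A S G i xs k v]"
    proof (rule nth_equalityI)
      fix l assume "l < length (snd (act_gen A S G i (xs, us[k := v])))"
      then have l: "l \<le> n" by (simp add: length_act_gen[OF len'])
      show "snd (act_gen A S G i (xs, us[k := v])) ! l = ws[k := act_slot A S G i xs k v] ! l"
        unfolding nth_act_gen[OF len' l] using k l
          by (simp add: nth_list_update len lws) (simp add: ws_def nth_act_gen[OF len l])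
    qed (simp add: length_act_gen[OF len'] lws)
    then show "act_gen A S G i (xs, us[k := v]) = (map (fobj G) xs, ws[k := act_slot A S G i xs k v])"
      by (simp add: prod_eq_iff fst_act_gen)
  qed (use k act_slot_linear[OF xs k] in auto)
qed

lemma act_linear: "Vector_Spaces.linear fscale fscale (act A S G i)"
  by (rule linext_linear[OF free.vector_space_axioms])

lemma act_rels: "r \<in> rels A S n i \<Longrightarrow> act A S G i r \<in> rels A S n i"
  by (rule multilinear_mod_linext[OF free.vector_space_axioms subspace_rels multilinear_act])

lemma act_single: "act A S G i (Poly_Mapping.single g a) = Poly_Mapping.single (act_gen A S G i g) a"
  by (simp add: linext_single[OF free.vector_space_axioms] fscale_single)

lemma act_Free: "c \<in> Free n i \<Longrightarrow> act A S G i c \<in> Free n i"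
  by (rule linear_free_in_subspace[OF act_linear subspace_free])
    (simp_all add: act_single single_in_free act_gen_in)

lemma act_gen_eqI:
  assumes "length us = Suc n" "fst h = map (fobj G) xs" "length (snd h) = Suc n"
    "\<And>k. k \<le> n \<Longrightarrow> snd h ! k = act_slot A S G i xs k (us ! k)"
  shows "h = act_gen A S G i (xs, us)"
proof (rule prod_eqI)
  show "fst h = fst (act_gen A S G i (xs, us))" using assms by (simp add: fst_act_gen)
  show "snd h = snd (act_gen A S G i (xs, us))"
    by (rule nth_equalityI)
      (use assms in \<open>auto simp: less_Suc_eq_le length_act_gen[OF assms(1)] nth_act_gen[OF assms(1)]\<close>)
qed

text \<open>This is functoriality of \<open>G\<close>; in face 0 the sign on the coefficient passes
  through the composition by linearity.\<close>

lemma act_gen_face: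
  assumes g: "(xs, us) \<in> gens A S (Suc n) i" and j: "j \<le> n"
  shows "face i j (act_gen A S G i (xs, us)) = act_gen A S G i (face i j (xs, us))"
proof -
  have xs: "xs \<in> obj_tuples A (Suc n)" and len: "length us = Suc (Suc n)"
    and us: "\<And>k. k \<le> Suc n \<Longrightarrow> us ! k \<in> factors A S i xs ! k"
    using g by (auto simp: mem_gens)
  note ob = obj_tuplesD[OF xs]
  have ys: "omit_obj j xs \<in> obj_tuples A n" using omit_obj_tuple[OF xs] j by simp
  note oby = obj_tuplesD[OF ys]
  have nth_omit: "omit_obj j xs ! m = xs ! (if m < j then m else Suc m)" if "m \<le> n" for m
    using that j by (simp add: nth_omit_obj ob(1))
  define vs where "vs = snd (act_gen A S G i (xs, us))"
  define ws where "ws = snd (face i j (xs, us))"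
  have vs: "act_gen A S G i (xs, us) = (map (fobj G) xs, vs)" by (simp add: vs_def act_gen_def)
  have ws: "face i j (xs, us) = (omit_obj j xs, ws)" by (simp add: ws_def face_def)
  have lvs: "length vs = Suc (Suc n)" using length_act_gen[OF len] by (simp add: vs_def)
  have lws: "length ws = Suc n" using length_faces(1)[OF len j] by (simp add: ws_def)
  have v: "vs ! k = act_slot A S G i xs k (us ! k)" if "k \<le> Suc n" for k
    using nth_act_gen[OF len that] by (simp add: vs_def)
  have w: "ws ! k = (if k < j then us ! k else
    if k = j then face_cmp i j xs (us ! j) (us ! Suc j) else us ! Suc k)"
    if "k \<le> n" for k using nth_face[OF len j that] by (simp add: ws_def)
  \<comment> \<open>Away from slot \<open>j\<close>, an entry keeps its source and target when the
    object with index \<open>j\<close> is omitted.\<close>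
  have slot: "act_slot A S G i (omit_obj j xs) k = act_slot A S G i xs (if k < j then k else Suc k)"
    if "k \<le> n" "k \<noteq> j" for k
  proof -
    have "k - 1 < j \<longleftrightarrow> k < j \<or> k = 0" if "k \<noteq> 0 \<or> j \<noteq> 0" using \<open>k \<noteq> j\<close> that by auto
    then show ?thesis
      using that j nth_omit[of 0] nth_omit[of n] nth_omit[of k] nth_omit[of "k - 1"]
      by (auto simp: act_slot_def fun_eq_iff oby(3,4) ob(3,4))
  qed
  have cmp: "face_cmp i j (map (fobj G) xs) (act_slot A S G i xs j (us ! j)) (act_slot A S G i xs
    (Suc j) (us ! Suc j)) =
      act_slot A S G i (omit_obj j xs) j (face_cmp i j xs (us ! j) (us ! Suc j))"
  proof (cases j)
    case 0
    have "us ! 0 \<in> hom A (xs ! 0) (So A S i (xs ! Suc n))" "us ! 1 \<in> hom A (xs ! 1) (xs ! 0)"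
      using us[of 0] us[of 1] factors_0[OF xs, of S i] factors_Suc[OF xs, of 0 S i] by simp_all
    then show ?thesis
      using 0 nth_omit[of 0] nth_omit[of n] ob(2)[of 0] ob(2)[of 1] ob(2)[of "Suc n"]
        obj_tuplesD(3,4)[OF map_tuple[OF xs]] ob(1) oby(3,4)[unfolded 0] G.farr_in So_commute
        G.farr_in[of "xs ! 0" "So A S i (xs ! Suc n)"]
      by (simp add: face_cmp_def act_slot_def ract_def ob(3,4) G.farr_cmp So_in G.fobj_in cmp_smul_left)
  next
    case (Suc j')
    have "us ! Suc j' \<in> hom A (xs ! Suc j') (xs ! j')" "us ! Suc (Suc j')
      \<in> hom A (xs ! Suc (Suc j')) (xs ! Suc j')"
      using us[of "Suc j'"] us[of "Suc (Suc j')"] factors_Suc[OF xs, of _ S i] j Suc by auto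
    then show ?thesis
      using Suc j nth_omit[of j] nth_omit[of j'] ob(1) ob(2)[of j'] ob(2)[of "Suc j'"] ob(2)[of "Suc
        (Suc j')"]
      by (simp add: face_cmp_def act_slot_def G.farr_cmp)
  qed
  show ?thesis
    unfolding ws
  proof (rule act_gen_eqI[OF lws])
    show "fst (face i j (act_gen A S G i (xs, us))) = map (fobj G) (omit_obj j xs)"
      by (simp add: vs fst_faces omit_obj_def take_map drop_map)
    show "length (snd (face i j (act_gen A S G i (xs, us)))) = Suc n"
      unfolding vs by (rule length_faces(1)[OF lvs j])
    fix k assume k: "k \<le> n"
    show "snd (face i j (act_gen A S G i (xs, us))) ! k = act_slot A S G i (omit_obj j xs) k (ws ! k)"
      unfolding vs nth_face[OF lvs j k] using k j v w[OF k] cmp slot[OF k] by auto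
  qed
qed

text \<open>The left action applies \<open>\<Sigma>^i\<close> to the last morphism, so here
  \<open>G\<close> has to commute with the powers of \<Sigma> on morphisms and not only on
  objects.\<close>

lemma act_gen_last_face:
  assumes g: "(xs, us) \<in> gens A S (Suc n) i"
  shows "last_face n i (act_gen A S G i (xs, us)) = act_gen A S G i (last_face n i (xs, us))"
proof -
  have xs: "xs \<in> obj_tuples A (Suc n)" and len: "length us = Suc (Suc n)"
    and us: "\<And>k. k \<le> Suc n \<Longrightarrow> us ! k \<in> factors A S i xs ! k"
    using g by (auto simp: mem_gens)
  note ob = obj_tuplesD[OF xs]
  have ys: "butlast xs \<in> obj_tuples A n" by (rule butlast_tuple[OF xs])
  note oby = obj_tuplesD[OF ys]
  have nth_but: "butlast xs ! m = xs ! m" if "m \<le> n" for m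
    using that by (simp add: nth_butlast ob(1))
  define vs where "vs = snd (act_gen A S G i (xs, us))"
  define ws where "ws = snd (last_face n i (xs, us))"
  have vs: "act_gen A S G i (xs, us) = (map (fobj G) xs, vs)" by (simp add: vs_def act_gen_def)
  have ws: "last_face n i (xs, us) = (butlast xs, ws)" by (simp add: ws_def last_face_def)
  have lvs: "length vs = Suc (Suc n)" using length_act_gen[OF len] by (simp add: vs_def)
  have lws: "length ws = Suc n" using length_faces(2)[OF len] by (simp add: ws_def)
  have v: "vs ! k = act_slot A S G i xs k (us ! k)" if "k \<le> Suc n" for k
    using nth_act_gen[OF len that] by (simp add: vs_def)
  have w: "ws ! k = (if k = 0 then lact A S i (xs ! Suc n) (xs ! n) (xs ! 0) (us ! Suc n)
    (us ! 0) else us ! k)"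
    if "k \<le> n" for k using nth_last_face[OF len that] by (simp add: ws_def ob(3,4))
  have u: "us ! 0 \<in> hom A (xs ! 0) (So A S i (xs ! Suc n))" "us ! Suc n \<in> hom A (xs ! Suc n) (xs ! n)"
    using us[of 0] us[of "Suc n"] factors_0[OF xs, of S i] factors_Suc[OF xs, of n S i] by simp_all
  have x: "xs ! 0 \<in> obj A" "xs ! n \<in> obj A" "xs ! Suc n \<in> obj A" using ob(2) by simp_all
  have zero: "lact A S i (fobj G (xs ! Suc n)) (fobj G (xs ! n)) (fobj G (xs ! 0))
      (farr G (xs ! Suc n) (xs ! n) (us ! Suc n))
      (smul A ((- 1) powi i) (farr G (xs ! 0) (So A S i (xs ! Suc n)) (us ! 0))) =
    smul A ((- 1) powi i) (farr G (xs ! 0) (So A S i (xs ! n)) (lact A S i (xs ! Suc n) (xs ! n)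
      (xs ! 0) (us ! Suc n) (us ! 0)))"
    using u x G.farr_in[OF x(1) So_in[OF x(3)] u(1)] G.farr_in[OF x(3,2) u(2)]
      G.farr_in[OF So_in[OF x(3)] So_in[OF x(2)] Sa_in[OF x(3,2) u(2)], of i]
    by (simp add: lact_def G.farr_cmp So_in Sa_in So_commute Sa_commute G.fobj_in cmp_smul_right)
  have slot: "act_slot A S G i (butlast xs) k = act_slot A S G i xs k" if "k \<le> n" "k \<noteq> 0" for k
    using that by (auto simp: act_slot_def fun_eq_iff nth_but)
  show ?thesis
    unfolding ws
  proof (rule act_gen_eqI[OF lws])
    show "fst (last_face n i (act_gen A S G i (xs, us))) = map (fobj G) (butlast xs)"
      by (simp add: vs fst_faces map_butlast)
    show "length (snd (last_face n i (act_gen A S G i (xs, us)))) = Suc n"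
      unfolding vs by (rule length_faces(2)[OF lvs])
    fix k assume k: "k \<le> n"
    show "snd (last_face n i (act_gen A S G i (xs, us))) ! k = act_slot A S G i (butlast xs) k (ws ! k)"
    proof (cases "k = 0")
      case True
      then show ?thesis
        unfolding vs nth_last_face[OF lvs k] using v w[of 0] zero obj_tuplesD(3,4)[OF map_tuple[OF xs]]
        by (simp add: act_slot_def ob oby nth_but)
    next
      case False
      then show ?thesis
        unfolding vs nth_last_face[OF lvs k] using k v w[OF k] slot[OF k] by simp
    qed
  qed
qed

lemma act_D:
  assumes "c \<in> Free (Suc n) i"
  shows "D n i (act A S G i c) = act A S G i (D n i c)"
proof -
  interpret a: Vector_Spaces.linear fscale fscale "act A S G i" by (rule act_linear)
  have "(D n i \<circ> act A S G i) c = (act A S G i \<circ> D n i) c"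
  proof (rule linear_free_eq[OF linear_comp[OF act_linear D_linear] linear_comp[OF D_linear
    act_linear] _ assms])
    fix g assume g: "g \<in> gens A S (Suc n) i"
    then have "any_face n i j (act_gen A S G i g) = act_gen A S G i (any_face n i j g)" for j
      by (cases g) (auto simp: any_face_def act_gen_face act_gen_last_face)
    then show "(D n i \<circ> act A S G i) (Poly_Mapping.single g 1) =
      (act A S G i \<circ> D n i) (Poly_Mapping.single g 1)"
      using g act_gen_in[OF g] by (simp add: act_single linext_single[OF free.vector_space_axioms,
        of "diff_gen A S n i"]
          diff_gen_any_face a.sum a.add del: sum.atMost_Suc)
  qed
  then show ?thesis by simp
qed

lemma act_bound: "b \<in> bound n i \<Longrightarrow> act A S G i b \<in> bound n i"
proof -
  interpret a: Vector_Spaces.linear fscale fscale "act A S G i" by (rule act_linear)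
  assume "b \<in> bound n i"
  then obtain e r where "b = D n i e + r" "e \<in> Free (Suc n) i" "r \<in> rels A S n i"
    by (auto simp: bound_def)
  then show ?thesis using boundI[OF act_Free act_rels] by (simp add: a.add flip: act_D)
qed

lemma act_cyc: "c \<in> cyc n i \<Longrightarrow> act A S G i c \<in> cyc n i"
  by (cases n) (auto simp: cyc_def act_Free act_D act_rels)

text \<open>Since \<open>G\<close> commutes with the powers of \<Sigma>, it respects composition in
  the orbit category as well; no sign appears, in contrast to the action on the bimodule.\<close>

lemma farr_orb_cmp:
  assumes "x \<in> obj A" "y \<in> obj A" "z \<in> obj A" "f \<in> hom A x (So A S i y)" "g \<in> hom A y (So A S j z)"
  shows "farr G x (So A S (i + j) z) (orb_cmp A S x y z j i g f) =
    orb_cmp A S (fobj G x) (fobj G y) (fobj G z) j i (farr G y (So A S j z) g) (farr G x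
      (So A S i y) f)"
  using assms Sa_in[OF assms(2) So_in[OF assms(3)] assms(5), of i]
    Sa_commute[OF assms(2) So_in[OF assms(3)] assms(5), of i]
  by (simp add: orb_cmp_def G.farr_cmp So_in So_plus So_commute G.fobj_in)

end

context linear_automorphism
begin

text \<open>The two signs on the coefficient multiply to \<open>1\<close>, so the operators are
  inverse to each other on generators and not only modulo \<open>rels\<close>.\<close>

lemma act_inverse:
  assumes G: "commuting_automorphism A S G" and H: "commuting_automorphism A S H"
    and GH: "feq A (fcomp G H) fid" and c: "c \<in> Free n i"
  shows "act A S G i (act A S H i c) = c"
proof -
  interpret G: commuting_automorphism A S G by (rule G)
  interpret H: commuting_automorphism A S H by (rule H)
  have obj: "fobj G (fobj H x) = x" if "x \<in> obj A" for x using GH that by (simp add: feq_def)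
  have arr: "farr G (fobj H x) (fobj H y) (farr H x y f) = f"
    if "x \<in> obj A" "y \<in> obj A" "f \<in> hom A x y" for x y f
    using GH that by (simp add: feq_def)
  have "(act A S G i \<circ> act A S H i) c = (\<lambda>c. c) c"
  proof (rule linear_free_eq[OF linear_comp[OF H.act_linear G.act_linear] _ _ c])
    show "Vector_Spaces.linear fscale fscale (\<lambda>c::('o, 'm) gen \<Rightarrow>\<^sub>0 'k. c)" by unfold_locales simp_all
    fix g assume g: "g \<in> gens A S n i"
    obtain xs us where g': "g = (xs, us)" by (cases g)
    have xs: "xs \<in> obj_tuples A n" and len: "length us = Suc n"
      and us: "\<And>k. k \<le> n \<Longrightarrow> us ! k \<in> factors A S i xs ! k"
      using g by (auto simp: mem_gens g')
    note ob = obj_tuplesD[OF xs]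
    define vs where "vs = snd (act_gen A S H i (xs, us))"
    have vs: "act_gen A S H i (xs, us) = (map (fobj H) xs, vs)" by (simp add: vs_def act_gen_def)
    have lvs: "length vs = Suc n" using length_act_gen[OF len] by (simp add: vs_def)
    have "g = act_gen A S G i (map (fobj H) xs, vs)"
    proof (rule G.act_gen_eqI[OF lvs])
      show "fst g = map (fobj G) (map (fobj H) xs)"
        using xs obj by (auto simp: g' obj_tuples_def intro!: map_idI[symmetric])
      show "length (snd g) = Suc n" by (simp add: g' len)
      fix k assume k: "k \<le> n"
      have "act_slot A S G i (map (fobj H) xs) k (act_slot A S H i xs k (us ! k)) = us ! k"
      proof (cases "k = 0")
        case True
        have u: "us ! 0 \<in> hom A (xs ! 0) (So A S i (xs ! n))"
          using us[of 0] factors_0[OF xs, of S i] by simp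
        have x: "xs ! 0 \<in> obj A" "xs ! n \<in> obj A" using ob(2) by simp_all
        have "farr H (xs ! 0) (So A S i (xs ! n)) (us ! 0)
          \<in> hom A (fobj H (xs ! 0)) (So A S i (fobj H (xs ! n)))"
          using H.G.farr_in[OF x(1) So_in[OF x(2)] u] by (simp add: H.So_commute x)
        then show ?thesis
          using True arr[OF x(1) So_in[OF x(2)] u] obj_tuplesD(3,4)[OF H.map_tuple[OF xs]] ob(1) x
          by (simp add: act_slot_def ob(3,4) G.G.farr_smul So_in H.G.fobj_in sign_square flip:
            H.So_commute)
      next
        case False
        then have u: "us ! k \<in> hom A (xs ! k) (xs ! (k - 1))"
          using us[OF k] factors_Suc[OF xs, of "k - 1" S i] k by simp
        then show ?thesis using False k arr[OF ob(2) ob(2) u] by (simp add: act_slot_def ob(1))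
      qed
      then show "snd g ! k = act_slot A S G i (map (fobj H) xs) k (vs ! k)"
        by (simp add: g' vs_def nth_act_gen[OF len k])
    qed
    from this[symmetric] have "act_gen A S G i (act_gen A S H i g) = g" by (simp only: g' vs)
    then show "(act A S G i \<circ> act A S H i) (Poly_Mapping.single g 1) = Poly_Mapping.single g 1"
      by (simp add: G.act_single H.act_single)
  qed
  then show ?thesis by simp
qed

end

context linear_automorphism
begin

lemma finv_string:
  assumes xs: "xs \<in> obj_tuples A n" and fs: "fs \<in> listset (homs A xs)"
  shows "map (fobj (finv A S)) xs \<in> obj_tuples A n"
    "map_arrs (finv A S) xs fs \<in> listset (homs A (map (fobj (finv A S)) xs))"
proof -
  interpret inv: commuting_automorphism A S "finv A S" by (rule commuting_finv)
  \<comment> \<open>As for faces, a zero coefficient turns the string into a generator.\<close>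
  have "0 \<in> hom A (hd xs) (So A S 0 (last xs))"
    using obj_tuplesD[OF xs] by (intro subspace_0 hom_subspace So_in) simp_all
  then have "(xs, 0 # fs) \<in> gens A S n 0" using xs fs by (simp add: mem_gens_Cons)
  from inv.act_gen_in[OF this]
  show "map (fobj (finv A S)) xs \<in> obj_tuples A n"
    "map_arrs (finv A S) xs fs \<in> listset (homs A (map (fobj (finv A S)) xs))"
    by (simp_all add: act_gen_def mem_gens_Cons)
qed

lemma hd_last_map:
  "xs \<in> obj_tuples A n \<Longrightarrow> hd (map f xs) = f (hd xs)" "xs \<in> obj_tuples A n \<Longrightarrow>
    last (map f xs) = f (last xs)"
  by (auto simp: obj_tuples_def intro!: hd_map last_map)

lemma sigma_precochain:
  assumes \<alpha>: "\<alpha> \<in> precochains n i"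
  shows "sigma_cochain A S n i \<alpha> \<in> precochains n i"
proof -
  interpret sh: commuting_automorphism A S S by (rule commuting_S)
  have "sigma_cochain A S n i \<alpha> xs fs \<in> hom A (last xs) (So A S i (hd xs))"
    if xs: "xs \<in> obj_tuples A n" and fs: "fs \<in> listset (homs A xs)" for xs fs
  proof -
    let ?ys = "map (fobj (finv A S)) xs"
    note st = finv_string[OF xs fs]
    note ob = obj_tuplesD(5,6)[OF xs] and oby = obj_tuplesD(5,6)[OF st(1)]
    have "farr S (last ?ys) (So A S i (hd ?ys)) (\<alpha> ?ys (map_arrs (finv A S) xs fs)) \<in>
        hom A (fobj S (last ?ys)) (fobj S (So A S i (hd ?ys)))"
      by (intro farr_in So_in oby precochainsD[OF \<alpha> st])
    moreover have "fobj S (last ?ys) = last xs" "fobj S (So A S i (hd ?ys)) = So A S i (hd xs)"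
      using ob oby by (simp_all add: hd_last_map[OF xs] sh.So_commute fobj_finv)
    ultimately show ?thesis
      using xs fs subspace_scale[OF hom_subspaceI[OF xs]]
        by (simp add: sigma_cochain_def sact_def Let_def)
  qed
  then show ?thesis by (auto simp: precochains_def sigma_cochain_def)
qed

end

section \<open>Invariant classes and anti-coinvariants\<close>

context calabi_yau
begin

abbreviation shift :: "int \<Rightarrow> (('o, 'm) gen \<Rightarrow>\<^sub>0 'k) \<Rightarrow> (('o, 'm) gen \<Rightarrow>\<^sub>0 'k)" where
  "shift j \<equiv> act A S S j"

abbreviation unshift :: "int \<Rightarrow> (('o, 'm) gen \<Rightarrow>\<^sub>0 'k) \<Rightarrow> (('o, 'm) gen \<Rightarrow>\<^sub>0 'k)" where
  "unshift j \<equiv> act A S (finv A S) j"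

lemma shift_unshift: "c \<in> Free n j \<Longrightarrow> shift j (unshift j c) = c"
  by (rule act_inverse[OF commuting_S commuting_finv feq_fcomp_finv(1)])

lemma unshift_shift: "c \<in> Free n j \<Longrightarrow> unshift j (shift j c) = c"
  by (rule act_inverse[OF commuting_finv commuting_S feq_fcomp_finv(2)])

lemmas unshift_rels = commuting_automorphism.act_rels[OF commuting_finv]
lemmas unshift_Free = commuting_automorphism.act_Free[OF commuting_finv]
lemmas unshift_cyc = commuting_automorphism.act_cyc[OF commuting_finv]
lemmas unshift_D = commuting_automorphism.act_D[OF commuting_finv]
lemmas unshift_linear = commuting_automorphism.act_linear[OF commuting_finv]
lemmas shift_Free = commuting_automorphism.act_Free[OF commuting_S]
lemmas shift_rels = commuting_automorphism.act_rels[OF commuting_S]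
lemmas shift_cyc = commuting_automorphism.act_cyc[OF commuting_S]
lemmas shift_bound = commuting_automorphism.act_bound[OF commuting_S]
lemmas shift_linear = commuting_automorphism.act_linear[OF commuting_S]

text \<open>Condition (2) with \<open>m = 1\<close>, \<open>x = \<Sigma> y\<close> and \<open>g\<close> the identity.\<close>

lemma tr_shift:
  assumes y: "y \<in> obj A" and f: "f \<in> hom A y (So A S d y)"
  shows "tr (fobj S y) (farr S y (So A S d y) f) = (- 1) powi (d - 1) * tr y f"
proof -
  let ?x = "fobj S y"
  have x: "?x \<in> obj A" using y by (rule fobj_in)
  have o1: "So A S 1 z = fobj S z" if "z \<in> obj A" for z using fzpow_1 that by (simp add: feq_def)
  have a1: "Sa A S 1 z w g = farr S z w g" if "z \<in> obj A" "w \<in> obj A" "g \<in> hom A z w" for z w g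
    using fzpow_1 that by (simp add: feq_def)
  \<comment> \<open>As \<open>\<Sigma>^(d-1)\<close> of \<open>\<Sigma> y\<close> is
    \<open>\<Sigma>^d y\<close>, the morphism \<open>f\<close> has the type that the trace identity
    asks for with \<open>m = 1\<close>.\<close>
  have od: "So A S (d - 1) ?x = So A S d y" using So_plus[OF y, of "d - 1" 1] o1[OF y] by simp
  have odx: "fobj S (So A S d y) = So A S d ?x"
    by (rule commuting_automorphism.So_commute[OF commuting_S y])
  have d: "So A S d y \<in> obj A" using y by (rule So_in)
  have Sf: "farr S y (So A S d y) f \<in> hom A ?x (So A S d ?x)" using farr_in[OF y d f] odx by simp
  have "ide A ?x \<in> hom A ?x (So A S 1 y)" "f \<in> hom A y (So A S (d - 1) ?x)"
    using ide_in_hom[OF x] f by (simp_all add: o1[OF y] od)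
  then have "tr ?x (cmp A ?x (So A S 1 y) (So A S d ?x) (Sa A S 1 y (So A S (d - 1) ?x) f) (ide A ?x)) =
      (- 1) powi (1 * (d - 1)) *
      tr y (cmp A y (So A S (d - 1) ?x) (So A S d y) (Sa A S (d - 1) ?x (So A S 1 y) (ide A ?x)) f)"
    using tr_symmetric[of 1] x y unfolding trace_symmetric_def by blast
  moreover have "Sa A S (d - 1) ?x ?x (ide A ?x) = ide A (So A S d y)"
    using linear_automorphism.farr_ide[OF laut_fzpow x, of "d - 1"] od by simp
  ultimately show ?thesis
    using cmp_ide_right[OF x So_in[OF x] Sf] cmp_ide_left[OF y d f] by (simp add: od o1 a1 x y d f)
qed

text \<open>Writing \<open>u\<close> as the translate of \<open>w\<close>, the element
  \<open>u \<circ> \<Sigma> v\<close> is the translate of \<open>w \<circ> v\<close>, and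
  \<open>tr_shift\<close> compares the two traces. The signs on the coefficient, on the value of the
  cochain and in \<open>tr_shift\<close> leave a single minus.\<close>

lemma pairing_sigma:
  assumes \<alpha>: "\<alpha> \<in> Coch n i" and c: "c \<in> Free n (d - i)"
  shows "pairing i (sigma_cochain A S n i \<alpha>) c = - pairing i \<alpha> (unshift (d - i) c)"
proof -
  interpret sh: commuting_automorphism A S S by (rule commuting_S)
  interpret inv: commuting_automorphism A S "finv A S" by (rule commuting_finv)
  interpret vector_space_pair fscale "(*) :: 'k \<Rightarrow> 'k \<Rightarrow> 'k"
    using free.vector_space_axioms vector_space_mult by (simp add: vector_space_pair_def)
  let ?j = "d - i"
  have "pairing i (sigma_cochain A S n i \<alpha>) c = - (pairing i \<alpha> \<circ> unshift ?j) c"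
  proof (rule linear_free_eq[OF pairing_linear linear_compose_neg[OF linear_comp[OF unshift_linear
    pairing_linear]] _ c])
    fix g assume "g \<in> gens A S n ?j"
    then obtain xs u fs where g: "g = (xs, u # fs)" and xs: "xs \<in> obj_tuples A n"
      and u: "u \<in> hom A (hd xs) (So A S ?j (last xs))" and fs: "fs \<in> listset (homs A xs)"
      by (rule gens_cases)
    define ys where "ys = map (fobj (finv A S)) xs"
    define v where "v = \<alpha> ys (map_arrs (finv A S) xs fs)"
    define w where "w = farr (finv A S) (hd xs) (So A S ?j (last xs)) u"
    define f where "f = orb_cmp A S (last ys) (hd ys) (last ys) ?j i w v"
    let ?sj = "(- 1 :: 'k) powi ?j" and ?si = "(- 1 :: 'k) powi i"
    note st = finv_string[OF xs fs, folded ys_def]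
    have x: "hd xs \<in> obj A" "last xs \<in> obj A" and y: "hd ys \<in> obj A" "last ys \<in> obj A"
      using obj_tuplesD[OF xs] obj_tuplesD[OF st(1)] by simp_all
    have hl: "hd ys = fobj (finv A S) (hd xs)" "last ys = fobj (finv A S) (last xs)"
      unfolding ys_def by (rule hd_last_map[OF xs])+
    have S_y: "fobj S (hd ys) = hd xs" "fobj S (last ys) = last xs"
      using x by (simp_all add: hl fobj_finv)
    have v: "v \<in> hom A (last ys) (So A S i (hd ys))" unfolding v_def by (rule Coch_in_hom[OF \<alpha> st])
    have w: "w \<in> hom A (hd ys) (So A S ?j (last ys))"
      using inv.G.farr_in[OF x(1) So_in[OF x(2)] u] by (simp add: w_def hl inv.So_commute x)
    have Sw: "farr S (hd ys) (So A S ?j (last ys)) w = u"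
      using farr_finv[OF x(1) So_in[OF x(2)] u] by (simp add: w_def hl inv.So_commute x)
    have Sv: "farr S (last ys) (So A S i (hd ys)) v \<in> hom A (last xs) (So A S i (hd xs))"
      using farr_in[OF y(2) So_in[OF y(1)] v] by (simp add: sh.So_commute y S_y)
    have f: "f \<in> hom A (last ys) (So A S d (last ys))"
      unfolding f_def using orb_cmp_in[OF y(2,1,2) v w] by simp
    have "farr S (last ys) (So A S d (last ys)) f =
        orb_cmp A S (last xs) (hd xs) (last xs) ?j i u (farr S (last ys) (So A S i (hd ys)) v)"
      using sh.farr_orb_cmp[OF y(2,1,2) v w] by (simp add: f_def S_y Sw)
    then have "tr (last xs) (orb_cmp A S (last xs) (hd xs) (last xs) ?j i u (farr S (last ys)
      (So A S i (hd ys)) v)) =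
        (- 1) powi (d - 1) * tr (last ys) f"
      using tr_shift[OF y(2) f] S_y by simp
    then have "pairing i (sigma_cochain A S n i \<alpha>) (Poly_Mapping.single g 1) =
      ?si * ((- 1) powi (d - 1) * tr (last ys) f)"
      using functional_on_scale[OF tr_orb_functional[OF x(2,1) u] Sv] xs fs
      by (simp add: pairing_single g sigma_cochain_def sact_def Let_def flip: ys_def v_def)
    moreover have "pairing i \<alpha> (unshift ?j (Poly_Mapping.single g 1)) = ?sj * tr (last ys) f"
    proof -
      have "act_gen A S (finv A S) ?j g = (ys, smul A ?sj w # map_arrs (finv A S) xs fs)"
        by (simp add: g act_gen_def flip: ys_def w_def)
      then show ?thesis
        using orb_cmp_linear(4)[OF y(2,1,2) v w] tr_smul[OF y(2) f]
        by (simp only: inv.act_single pairing_single fst_conv snd_conv list.sel mult_1_left flip: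
          v_def f_def)
    qed
    \<comment> \<open>The exponents \<open>i + d - 1\<close> and \<open>d - i\<close> differ by the
      odd number \<open>2 i - 1\<close>; this is the origin of the minus sign in the
      anti-coinvariants.\<close>
    moreover have "?si * (- 1) powi (d - 1) = - ?sj"
      by (auto simp: power_int_minus_left)
    ultimately show "pairing i (sigma_cochain A S n i \<alpha>) (Poly_Mapping.single g 1) =
        - (pairing i \<alpha> \<circ> unshift ?j) (Poly_Mapping.single g 1)"
      by (simp flip: mult.assoc)
  qed
  then show ?thesis by simp
qed

text \<open>By \<open>pairing_sigma\<close> the translated function represents a functional that
  vanishes on \<open>rels\<close>, hence it coincides with a cochain.\<close>

lemma sigma_Coch:
  assumes \<alpha>: "\<alpha> \<in> Coch n i"
  shows "sigma_cochain A S n i \<alpha> \<in> Coch n i"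
proof -
  interpret vector_space_pair fscale "(*) :: 'k \<Rightarrow> 'k \<Rightarrow> 'k"
    using free.vector_space_axioms vector_space_mult by (simp add: vector_space_pair_def)
  have lin: "Vector_Spaces.linear fscale (*) (\<lambda>c. - (pairing i \<alpha> \<circ> unshift (d - i)) c)"
    by (rule linear_compose_neg[OF linear_comp[OF unshift_linear pairing_linear]])
  have "- (pairing i \<alpha> \<circ> unshift (d - i)) r = 0" if "r \<in> rels A S n (d - i)" for r
    using pairing_rels[OF \<alpha> unshift_rels[OF that]] by simp
  from functional_eq_pairing[OF lin this]
  obtain \<beta> where \<beta>: "\<beta> \<in> Coch n i" "\<And>c. c \<in> Free n (d - i) \<Longrightarrow>
    pairing i \<beta> c = - (pairing i \<alpha> \<circ> unshift (d - i)) c" by blast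
  have "sigma_cochain A S n i \<alpha> = \<beta>"
    by (rule pairing_eqI[OF sigma_precochain]) (use \<alpha> \<beta> pairing_sigma[OF \<alpha>] in \<open>auto simp: Coch_iff\<close>)
  then show ?thesis using \<beta>(1) by simp
qed

lemma sigma_cocycles:
  assumes "\<alpha> \<in> cocycles A S n i"
  shows "sigma_cochain A S n i \<alpha> \<in> cocycles A S n i"
proof -
  have \<alpha>: "\<alpha> \<in> Coch n i" using assms cocycles_subset by blast
  have "pairing i (sigma_cochain A S n i \<alpha>) (D n (d - i) e) = 0" if e: "e \<in> Free (Suc n) (d - i)" for e
    using assms unshift_Free[OF e] by (simp add: pairing_sigma[OF \<alpha> D_Free[OF e]] cocycles_iff flip:
      unshift_D[OF e])
  then show ?thesis using sigma_Coch[OF \<alpha>] by (simp add: cocycles_iff)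
qed

text \<open>Adding a coboundary changes the pairing with a cycle by the pairing of that coboundary
  with a translate of the cycle, again a cycle; so the class does not change.\<close>

lemma sigma_coh_class:
  assumes \<alpha>: "\<alpha> \<in> Coch n i"
  shows "sigma_coh A S n i (coh_class n i \<alpha>) = coh_class n i (sigma_cochain A S n i \<alpha>)"
proof -
  have zero: "{0} \<inter> Coch n i \<subseteq> coboundaries A S n i"
    using cochain.subspace_0[OF subspace_coboundaries] by auto
  note eq_iff = cochain.coset_eq_iff[OF presents_cochains subspace_coboundaries coboundaries_subset
    zero, simplified image_ident]
  have "coh_class n i (sigma_cochain A S n i (\<alpha> + b)) = coh_class n i (sigma_cochain A S n i \<alpha>)"
    if b: "b \<in> coboundaries A S n i" for b
  proof -
    have bC: "b \<in> Coch n i" using b coboundaries_subset by blast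
    have ab: "\<alpha> + b \<in> Coch n i" by (rule cochain.subspace_add[OF subspace_Coch \<alpha> bC])
    let ?\<gamma> = "sigma_cochain A S n i (\<alpha> + b) - sigma_cochain A S n i \<alpha>"
    have "pairing i ?\<gamma> c = 0" if c: "c \<in> cyc n (d - i)" for c
    proof -
      have cF: "c \<in> Free n (d - i)" using c cyc_subset_free by blast
      have "pairing i ?\<gamma> c = - pairing i b (unshift (d - i) c)"
        using pairing_diff[OF sigma_Coch[OF ab] sigma_Coch[OF \<alpha>] cF] pairing_add[OF \<alpha> bC
          unshift_Free[OF cF]]
        by (simp add: pairing_sigma[OF ab cF] pairing_sigma[OF \<alpha> cF])
      then show ?thesis using b unshift_cyc[OF c] by (simp add: coboundaries_iff)
    qed
    then have "?\<gamma> \<in> coboundaries A S n i"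
      using cochain.subspace_diff[OF subspace_Coch sigma_Coch[OF ab] sigma_Coch[OF \<alpha>]]
        by (simp add: coboundaries_iff)
    then show ?thesis using eq_iff[OF sigma_Coch[OF ab] sigma_Coch[OF \<alpha>]] by simp
  qed
  then show ?thesis
    using cochain.qmap_coset[OF presents_cochains coboundaries_subset subspace_coboundaries \<alpha>,
        where W = "cochains A S n i" and N = "coboundaries A S n i" and f = "sigma_cochain A S n i"]
    by (simp add: sigma_coh_def image_ident)
qed

text \<open>The cocycles whose class is invariant, not necessarily they themselves; by
  \<open>pairing_sigma\<close> this is a condition on the pairing with cycles.\<close>

definition invar_cocycles :: "nat \<Rightarrow> int \<Rightarrow> ('o list \<Rightarrow> 'm list \<Rightarrow> 'm) set" where
  "invar_cocycles n i = {\<alpha> \<in> cocycles A S n i. \<forall>c\<in>cyc n (d - i). pairing i \<alpha> (unshift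
    (d - i) c + c) = 0}"

lemma invar_cocycles_iff:
  assumes \<alpha>: "\<alpha> \<in> cocycles A S n i"
  shows "sigma_coh A S n i (coh_class n i \<alpha>) = coh_class n i \<alpha> \<longleftrightarrow> \<alpha> \<in> invar_cocycles n i"
proof -
  have \<alpha>C: "\<alpha> \<in> Coch n i" using \<alpha> cocycles_subset by blast
  note \<sigma>C = sigma_Coch[OF \<alpha>C]
  have "pairing i (sigma_cochain A S n i \<alpha> - \<alpha>) c = - pairing i \<alpha> (unshift (d - i) c + c)"
    if "c \<in> cyc n (d - i)" for c
  proof -
    have cF: "c \<in> Free n (d - i)" using that cyc_subset_free by blast
    show ?thesis
      using pairing_diff[OF \<sigma>C \<alpha>C cF] pairing_sigma[OF \<alpha>C cF] pairing_linear[of i \<alpha>]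
      by (simp add: Vector_Spaces.linear_iff)
  qed
  then have "sigma_cochain A S n i \<alpha> - \<alpha> \<in> coboundaries A S n i \<longleftrightarrow> \<alpha> \<in> invar_cocycles n i"
    using \<alpha> cochain.subspace_diff[OF subspace_Coch \<sigma>C \<alpha>C]
      by (simp add: coboundaries_iff invar_cocycles_def)
  then show ?thesis
    using cochain.presentsD(4)[OF presents_HH_coh sigma_cocycles[OF \<alpha>] \<alpha>]
      by (simp add: sigma_coh_class[OF \<alpha>C])
qed

lemma presents_HH_coh_invar:
  "cochain.presents (invar_cocycles n i) (coboundaries A S n i) (HH_coh_invar A S n i) (coh_class n i)"
proof -
  have "invar_cocycles n i = cocycles A S n i \<inter>
      {\<alpha> \<in> Coch n i. \<forall>c\<in>(\<lambda>c. unshift (d - i) c + c) ` cyc n (d - i). pairing i \<alpha> c = 0}"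
    using cocycles_subset by (auto simp: invar_cocycles_def)
  moreover have "(\<lambda>c. unshift (d - i) c + c) ` cyc n (d - i) \<subseteq> Free n (d - i)"
    using cyc_subset_free unshift_Free free.subspace_add[OF subspace_free] by blast
  ultimately have sub: "cochain.subspace (invar_cocycles n i)"
    using cochain.subspace_inter[OF subspace_cocycles subspace_annihilator] by (simp only:)
  have "invar_cocycles n i \<subseteq> cocycles A S n i" by (auto simp: invar_cocycles_def)
  from cochain.presents_subspace[OF presents_HH_coh sub this]
  have "cochain.presents (invar_cocycles n i) (coboundaries A S n i)
      (HH_coh A S n i\<lparr>carr := coh_class n i ` invar_cocycles n i\<rparr>) (coh_class n i)" .
  moreover have "{v \<in> carr (HH_coh A S n i). sigma_coh A S n i v = v} =
    coh_class n i ` invar_cocycles n i"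
    unfolding cochain.presentsD(3)[OF presents_HH_coh, symmetric]
    using invar_cocycles_iff by (auto simp: invar_cocycles_def)
  ultimately show ?thesis by (simp add: HH_coh_invar_def invar_def)
qed

lemma sigma_hom_class:
  assumes c: "c \<in> Free n j"
  shows "sigma_hom A S n j (hom_class n j c) = hom_class n j (shift j c)"
proof -
  interpret s: Vector_Spaces.linear fscale fscale "shift j" by (rule shift_linear)
  have rb: "rels A S n j \<inter> Free n j \<subseteq> bound n j" using rels_subset_bound by blast
  have "coset (chains A S n j) (boundaries A S n j) (tensor_map A S n j (sigma_gen A S j)
    (chain_class n j (c + b))) =
      hom_class n j (shift j c)" if b: "b \<in> bound n j" for b
  proof -
    have bF: "b \<in> Free n j" using b bound_subset_free by blast
    have cb: "c + b \<in> Free n j" by (rule free.subspace_add[OF subspace_free c bF])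
    have "tensor_map A S n j (sigma_gen A S j) (chain_class n j (c + b)) =
      chain_class n j (shift j (c + b))"
      unfolding sigma_gen_eq by (rule tensor_map_class[OF shift_Free shift_rels cb])
    moreover have "hom_class n j (shift j (c + b)) = hom_class n j (shift j c)"
      unfolding boundaries_eq
      using free.coset_eq_iff[OF presents_chains subspace_bound bound_subset_free rb shift_Free[OF
        cb] shift_Free[OF c]]
        shift_bound[OF b] by (simp add: s.add)
    ultimately show ?thesis by simp
  qed
  then show ?thesis
    using free.qmap_coset[OF presents_chains bound_subset_free subspace_bound c,
        where W = "chains A S n j" and N = "boundaries A S n j" and f =
          "tensor_map A S n j (sigma_gen A S j)"]
    unfolding sigma_hom_def boundaries_eq by blast
qed

text \<open>The cycles whose homology class has the form \<open>v + \<Sigma> v\<close>. Intersecting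
  \<open>bound\<close> with \<open>cyc\<close> keeps the subspace inside \<open>cyc\<close>, as
  \<open>presents_quot\<close> demands.\<close>

definition anti_bound :: "nat \<Rightarrow> int \<Rightarrow> (('o, 'm) gen \<Rightarrow>\<^sub>0 'k) set" where
  "anti_bound n j = {x + y |x y. x \<in> (\<lambda>c. c + shift j c) ` cyc n j \<and> y \<in> bound n j \<inter> cyc n j}"

abbreviation anti_class :: "nat \<Rightarrow> int \<Rightarrow> (('o, 'm) gen \<Rightarrow>\<^sub>0 'k) \<Rightarrow> (('o, 'm) gen \<Rightarrow>\<^sub>0 'k) set set set" where
  "anti_class n j c \<equiv> coset (HH_hom A S n j) (hom_class n j ` anti_bound n j) (hom_class n j c)"

lemma shift_add_in_cyc: "c \<in> cyc n j \<Longrightarrow> c + shift j c \<in> cyc n j"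
  by (intro free.subspace_add[OF subspace_cyc] shift_cyc)

lemma shift_add_in_anti_bound: "c \<in> cyc n j \<Longrightarrow> c + shift j c \<in> anti_bound n j"
proof -
  assume "c \<in> cyc n j"
  moreover have "0 \<in> bound n j \<inter> cyc n j" using free.subspace_0 subspace_bound subspace_cyc by blast
  ultimately have "(c + shift j c) + 0 \<in> anti_bound n j" unfolding anti_bound_def by blast
  then show ?thesis by simp
qed

lemma anti_bound_subset_cyc: "anti_bound n j \<subseteq> cyc n j"
  unfolding anti_bound_def using shift_add_in_cyc free.subspace_add[OF subspace_cyc] by blast

lemma bound_subset_anti_bound: "bound n j \<inter> cyc n j \<subseteq> anti_bound n j"
proof
  interpret s: Vector_Spaces.linear fscale fscale "shift j" by (rule shift_linear)
  fix b assume "b \<in> bound n j \<inter> cyc n j"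
  moreover have "0 + shift j 0 \<in> (\<lambda>c. c + shift j c) ` cyc n j"
    using free.subspace_0[OF subspace_cyc] by blast
  ultimately have "(0 + shift j 0) + b \<in> anti_bound n j" unfolding anti_bound_def by blast
  then show "b \<in> anti_bound n j" by simp
qed

lemma subspace_anti_bound: "free.subspace (anti_bound n j)"
proof -
  interpret s: Vector_Spaces.linear fscale fscale "shift j" by (rule shift_linear)
  have "Vector_Spaces.linear fscale fscale (\<lambda>c. c + shift j c)"
    by unfold_locales (simp_all add: s.add s.scale free.scale_right_distrib)
  then interpret l: Vector_Spaces.linear fscale fscale "\<lambda>c. c + shift j c" .
  show ?thesis
    unfolding anti_bound_def
    by (intro free.subspace_sums l.subspace_image free.subspace_inter subspace_cyc subspace_bound)
qed

text \<open>The summand from \<open>bound\<close> disappears in homology, so the image of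
  \<open>anti_bound\<close> there is exactly the subspace divided out by
  \<open>anti_coinvar\<close>.\<close>

lemma presents_HH_hom_anti_coinvar:
  "free.presents (cyc n j) (anti_bound n j) (HH_hom_anti_coinvar A S n j) (anti_class n j)"
proof -
  note p = free.presentsD[OF presents_HH_hom]
  have "(\<lambda>v. vadd (HH_hom A S n j) v (sigma_hom A S n j v)) ` carr (HH_hom A S n j) =
      (\<lambda>c. hom_class n j (c + shift j c)) ` cyc n j"
    unfolding p(3)[symmetric] image_image
  proof (intro image_cong refl)
    fix c assume c: "c \<in> cyc n j"
    then show "vadd (HH_hom A S n j) (hom_class n j c) (sigma_hom A S n j (hom_class n j c)) =
      hom_class n j (c + shift j c)"
      using sigma_hom_class[OF subsetD[OF cyc_subset_free c]] p(5)[OF c shift_cyc[OF c]] by (simp only:)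
  qed
  also have "\<dots> = hom_class n j ` anti_bound n j"
  proof
    show "(\<lambda>c. hom_class n j (c + shift j c)) ` cyc n j \<subseteq> hom_class n j ` anti_bound n j"
      using shift_add_in_anti_bound by blast
    show "hom_class n j ` anti_bound n j \<subseteq> (\<lambda>c. hom_class n j (c + shift j c)) ` cyc n j"
    proof
      fix h assume "h \<in> hom_class n j ` anti_bound n j"
      then obtain c b where h: "h = hom_class n j (c + shift j c + b)" "c \<in> cyc n j" "b
        \<in> bound n j" "b \<in> cyc n j"
        unfolding anti_bound_def by blast
      have "h = hom_class n j (c + shift j c)"
        unfolding h(1) using p(4)[OF free.subspace_add[OF subspace_cyc shift_add_in_cyc[OF h(2)]
          h(4)] shift_add_in_cyc[OF h(2)]] h(3)
        by simp
      then show "h \<in> (\<lambda>c. hom_class n j (c + shift j c)) ` cyc n j" using h(2) by blast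
    qed
  qed
  finally show ?thesis
    unfolding HH_hom_anti_coinvar_def anti_coinvar_def
    using free.presents_quot[OF presents_HH_hom subspace_anti_bound anti_bound_subset_cyc
      bound_subset_anti_bound] by simp
qed

lemma pairing_anti_bound:
  assumes \<alpha>: "\<alpha> \<in> invar_cocycles n i" and b: "b \<in> anti_bound n (d - i)"
  shows "pairing i \<alpha> b = 0"
proof -
  interpret P: Vector_Spaces.linear fscale "(*)" "pairing i \<alpha>" by (rule pairing_linear)
  obtain c y where b: "b = c + shift (d - i) c + y" "c \<in> cyc n (d - i)" "y \<in> bound n (d - i)"
    using b by (auto simp: anti_bound_def)
  \<comment> \<open>Invariance is stated with the inverse translate; used for the cycle
    \<open>shift (d - i) c\<close>, it gives vanishing on
    \<open>c + shift (d - i) c\<close>.\<close>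
  have "unshift (d - i) (shift (d - i) c) = c" using unshift_shift b(2) cyc_subset_free by blast
  then have "pairing i \<alpha> (c + shift (d - i) c) = 0"
    using \<alpha> shift_cyc[OF b(2)] unfolding invar_cocycles_def by force
  moreover have "pairing i \<alpha> y = 0"
    by (rule pairing_bound[OF _ b(3)]) (use \<alpha> in \<open>simp add: invar_cocycles_def\<close>)
  ultimately show ?thesis by (simp add: b(1) P.add)
qed

text \<open>Representatives of one class differ by \<open>anti_bound\<close>, where the pairing with
  an invariant cocycle vanishes, so \<open>Theta\<close> takes one value on all of them.\<close>

lemma Theta_sigma_class:
  assumes \<alpha>: "\<alpha> \<in> invar_cocycles n i" and c: "c \<in> cyc n (d - i)"
  shows "Theta_sigma A S d tr n i (coh_class n i \<alpha>) (anti_class n (d - i) c) = pairing i \<alpha> c"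
proof -
  interpret P: Vector_Spaces.linear fscale "(*)" "pairing i \<alpha>" by (rule pairing_linear)
  have \<alpha>': "\<alpha> \<in> cocycles A S n i" using \<alpha> by (simp add: invar_cocycles_def)
  note mem = free.mem_coset[OF presents_HH_hom anti_bound_subset_cyc c]
  have "Theta A S d tr n i (coh_class n i \<alpha>) q = pairing i \<alpha> c" if q: "q \<in> anti_class n (d - i) c" for q
  proof -
    obtain b where b: "b \<in> anti_bound n (d - i)" "q = hom_class n (d - i) (c + b)" using q mem by blast
    have "c + b \<in> cyc n (d - i)" using free.subspace_add[OF subspace_cyc c] b anti_bound_subset_cyc
      by blast
    then show ?thesis using Theta_class[OF \<alpha>'] pairing_anti_bound[OF \<alpha> b(1)] by (simp add: b(2) P.add)
  qed
  moreover have "anti_class n (d - i) c \<noteq> {}" by (rule free.coset_nonempty[OF subspace_anti_bound])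
  ultimately have "Theta A S d tr n i (coh_class n i \<alpha>) ` anti_class n (d - i) c = {pairing i \<alpha> c}"
    by auto
  moreover have "anti_class n (d - i) c \<in> carr (HH_hom_anti_coinvar A S n (d - i))"
    using free.presentsD(3)[OF presents_HH_hom_anti_coinvar] c by blast
  ultimately show ?thesis by (simp add: Theta_sigma_def)
qed

text \<open>Injectivity is tested on the same cycles as for \<open>Theta_iso\<close>. For
  surjectivity the functional is represented by a cocycle, and its vanishing on
  \<open>anti_bound\<close> makes the class of that cocycle invariant.\<close>

lemma Theta_sigma_iso:
  "lin_iso (HH_coh_invar A S n i) (dual (HH_hom_anti_coinvar A S n (d - i))) (Theta_sigma A S d tr n i)"
proof (rule lin_iso_dual[OF cochain.vector_space_axioms free.vector_space_axioms presents_HH_coh_invar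
      presents_HH_hom_anti_coinvar, where T = "pairing i"])
  have inv: "\<alpha> \<in> Coch n i" if "\<alpha> \<in> invar_cocycles n i" for \<alpha>
    using that cocycles_subset by (auto simp: invar_cocycles_def)
  note sub = inv subsetD[OF cyc_subset_free]
  show "pairing i (\<alpha> + \<beta>) c = pairing i \<alpha> c + pairing i \<beta> c"
    if "\<alpha> \<in> invar_cocycles n i" "\<beta> \<in> invar_cocycles n i" "c \<in> cyc n (d - i)" for \<alpha> \<beta> c
    using that by (simp add: pairing_add[of _ n] sub)
  show "pairing i (\<lambda>xs fs. smul A a (\<alpha> xs fs)) c = a * pairing i \<alpha> c"
    if "\<alpha> \<in> invar_cocycles n i" "c \<in> cyc n (d - i)" for a \<alpha> c
    using that by (simp add: pairing_scale[of _ n] sub)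
  show "\<alpha> \<in> coboundaries A S n i"
    if "\<alpha> \<in> invar_cocycles n i" "\<And>c. c \<in> cyc n (d - i) \<Longrightarrow> pairing i \<alpha> c = 0" for \<alpha>
    using that sub by (simp add: coboundaries_iff)
  show "\<exists>\<alpha>\<in>invar_cocycles n i. \<forall>c\<in>cyc n (d - i). pairing i \<alpha> c = \<phi> c"
    if \<phi>: "free.functional_on (cyc n (d - i)) \<phi>"
      and kill: "\<And>b. b \<in> cyc n (d - i) \<Longrightarrow> b \<in> anti_bound n (d - i) \<Longrightarrow> \<phi> b = 0" for \<phi>
  proof -
    have "\<phi> b = 0" if "b \<in> cyc n (d - i)" "b \<in> bound n (d - i)" for b
      using kill[OF that(1)] bound_subset_anti_bound that by blast
    from cocycle_eq_functional[OF \<phi> this]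
    obtain \<alpha> where \<alpha>: "\<alpha> \<in> cocycles A S n i" "\<And>c. c \<in> cyc n (d - i) \<Longrightarrow> pairing i \<alpha> c = \<phi> c" by blast
    have "pairing i \<alpha> (unshift (d - i) c + c) = 0" if c: "c \<in> cyc n (d - i)" for c
    proof -
      \<comment> \<open>In terms of \<open>?e\<close> the sum \<open>unshift (d - i) c + c\<close>
        is \<open>?e\<close> plus its translate, an element of \<open>anti_bound\<close>.\<close>
      let ?e = "unshift (d - i) c"
      have e: "?e \<in> cyc n (d - i)" by (rule unshift_cyc[OF c])
      have "shift (d - i) ?e = c" using shift_unshift c cyc_subset_free by blast
      then have "unshift (d - i) c + c \<in> anti_bound n (d - i)" "unshift (d - i) c + c \<in> cyc n (d - i)"
        using shift_add_in_anti_bound[OF e] shift_add_in_cyc[OF e] by simp_all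
      then show ?thesis using \<alpha>(2) kill by simp
    qed
    then show ?thesis using \<alpha> by (auto simp: invar_cocycles_def)
  qed
qed (simp_all add: pairing_cyc_linear pairing_anti_bound Theta_sigma_class, simp add: Theta_sigma_def)

end

theorem theorem4p5:
  fixes A :: "('k::field, 'o, 'm::ab_group_add) lincat"
    and S :: "('o, 'm) func" and d :: int and tr :: "'o \<Rightarrow> 'm \<Rightarrow> 'k"
    and p n :: nat
  assumes "CHAR('k) = p" and "p > 0"
    and "weakly_calabi_yau A S d tr"
  shows "graded_iso (HH_coh A S n) (gshift (gdual (HH_hom A S n)) (- d)) (Theta A S d tr n) \<and>
    (calabi_yau A S d tr \<longrightarrow>
      graded_iso (HH_coh_invar A S n) (gshift (gdual (HH_hom_anti_coinvar A S n)) (- d))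
        (Theta_sigma A S d tr n))"
  \<comment> \<open>In degree \<open>i\<close> the shift by \<open>- d\<close> takes the dual in
    degree \<open>i - d\<close>, which is the dual of the homology in degree
    \<open>- (i - d) = d - i\<close>.\<close>
  using weakly_calabi_yau.Theta_iso[OF assms(3)] calabi_yau.Theta_sigma_iso[of A S d tr]
  by (simp add: graded_iso_def gshift_def gdual_def)

end
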